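(* Let $F:\mathcal{E}\to\mathcal{B}$ be a row-finite Kumjian-Pask fibration. Then $C^*(F)\neq 0$.
   Context: All categories are small. Composition is written anti-diagrammatically: for $\beta:C\to B$ and $\alpha:B\to A$ the composite is $\alpha\beta$; $r(\alpha)$ is the codomain and $s(\alpha)$ the domain of $\alpha$. For an object $X$ of $\mathcal{C}$, $X\mathcal{C}$ is the set of morphisms with codomain $X$. A functor $F:\mathcal{E}\to\mathcal{B}$ is a discrete Conduché fibration if for every morphism $\phi$ of $\mathcal{E}$ and every factorization $F(\phi)=\rho\lambda$ in $\mathcal{B}$ there is a unique factorization $\phi=\tilde\rho\tilde\lambda$ in $\mathcal{E}$ with $F(\tilde\rho)=\rho$, $F(\tilde\lambda)=\lambda$. $F$ is row-finite if for every object $X$ of $\mathcal{E}$ and every morphism $b:B\to F(X)$ of $\mathcal{B}$ the set $\{\alpha\in X\mathcal{E}:F(\alpha)=b\}$ is finite. A category is right Ore if for every cospan $m,n$ (morphisms with common codomain) there are $p,q$ with $mp=nq$. It is strongly right Ore if it is right Ore and, for every cospan $m,n$ and all $p_1,p_2,q_1,q_2$ with $mp_i=nq_i$ ($i=1,2$), there exist $a,b$ with $p_1a=p_2b$ and $q_1a=q_2b$. The slice category $\mathcal{C}/X$ has as objects the elements of $X\mathcal{C}$ and as morphisms the pairs $(\alpha,\gamma)$ with $\alpha\in X\mathcal{C}$, $\gamma\in\mathcal{C}$, $r(\gamma)=s(\alpha)$; $(\alpha,\gamma)$ has range $\alpha$ and source $\alpha\gamma$, and $(\alpha,\gamma)(\alpha\gamma,\delta)=(\alpha,\gamma\delta)$.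 A functor $F:\mathcal{E}\to\mathcal{B}$ induces functors $F:\mathcal{E}/X\to\mathcal{B}/F(X)$. $F$ is locally split if for every object $X$ of $\mathcal{E}$ there is a functor $x:\mathcal{B}/F(X)\to\mathcal{E}/X$ with $F\circ x=\mathrm{Id}_{\mathcal{B}/F(X)}$. A Kumjian-Pask fibration is a locally split discrete Conduché fibration $F:\mathcal{E}\to\mathcal{B}$ with $\mathcal{B}$ strongly right Ore. A Cuntz-Krieger system associated to $F$ in a $C^*$-algebra $D$ consists of a projection $P_X\in D$ for each object $X$ of $\mathcal{E}$ and a partial isometry $S_\alpha\in D$ for each morphism $\alpha$ of $\mathcal{E}$ such that: (1) $P_X\perp P_Y$ for $X\ne Y$; (2) $S_{\alpha\beta}=S_\alpha S_\beta$ for composable $\alpha,\beta$; (3) $P_X=S_{\mathrm{Id}_X}=S_{\mathrm{Id}_X}^*$ for all $X$; (4) $S_\alpha^*S_\alpha=P_Y$ for all $\alpha:Y\to X$; (5) if $F(\alpha)=F(\beta)$ and $\alpha\ne\beta$ then $S_\beta^*S_\alpha=0$; (6) for every object $X$ of $\mathcal{E}$ and every $b:B\to F(X)$ in $\mathcal{B}$, $\sum_{\alpha\in X\mathcal{E},\,F(\alpha)=b}S_\alpha S_\alpha^*=P_X$. $C^*(F)$ denotes the universal $C^*$-algebra for these relations: it is generated by a Cuntz-Krieger system $\{p_X,s_\alpha\}$, and for every Cuntz-Krieger system $\{Q_X,T_\alpha\}$ associated to $F$ in a $C^*$-algebra $B$ there is a unique $*$-homomorphism $C^*(F)\to B$ extending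 $s_\alpha\mapsto T_\alpha$.
   Formalization: The category E is assumed to have at least one object; for empty E the hypotheses hold vacuously over any strongly right Ore B, there are no generators, and C*(F) = 0. *)

theory Defs
  imports
    "HOL-Analysis.Analysis"
    "HOL-Algebra.Module"
    "HOL-Library.Poly_Mapping"
    "HOL-Library.FuncSet"
begin

section \<open>Small categories and functors\<close>

text \<open>Composition is anti-diagrammatic: \<open>\<alpha> \<cdot> \<beta>\<close> is defined when \<open>src \<alpha> = rng \<beta>\<close>; \<open>src\<close> is the
  domain and \<open>rng\<close> the codomain. Nothing is assumed about values outside \<open>Obj\<close> and \<open>Mor\<close>.\<close>

record ('o, 'm) cat =
  Obj :: "'o set"
  Mor :: "'m set"
  src :: "'m \<Rightarrow> 'o"
  rng :: "'m \<Rightarrow> 'o"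
  ident :: "'o \<Rightarrow> 'm"
  cmp :: "'m \<Rightarrow> 'm \<Rightarrow> 'm" (infixl "\<cdot>\<index>" 70)

locale small_category =
  fixes C :: "('o, 'm) cat" (structure)
  assumes src_closed: "\<alpha> \<in> Mor C \<Longrightarrow> src C \<alpha> \<in> Obj C"
    and rng_closed: "\<alpha> \<in> Mor C \<Longrightarrow> rng C \<alpha> \<in> Obj C"
    and ident_closed: "X \<in> Obj C \<Longrightarrow> ident C X \<in> Mor C"
    and src_ident: "X \<in> Obj C \<Longrightarrow> src C (ident C X) = X"
    and rng_ident: "X \<in> Obj C \<Longrightarrow> rng C (ident C X) = X"
    and comp_closed: "\<lbrakk>\<alpha> \<in> Mor C; \<beta> \<in> Mor C; src C \<alpha> = rng C \<beta>\<rbrakk> \<Longrightarrow> \<alpha> \<cdot> \<beta> \<in> Mor C"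
    and src_comp: "\<lbrakk>\<alpha> \<in> Mor C; \<beta> \<in> Mor C; src C \<alpha> = rng C \<beta>\<rbrakk> \<Longrightarrow> src C (\<alpha> \<cdot> \<beta>) = src C \<beta>"
    and rng_comp: "\<lbrakk>\<alpha> \<in> Mor C; \<beta> \<in> Mor C; src C \<alpha> = rng C \<beta>\<rbrakk> \<Longrightarrow> rng C (\<alpha> \<cdot> \<beta>) = rng C \<alpha>"
    and comp_assoc: "\<lbrakk>\<alpha> \<in> Mor C; \<beta> \<in> Mor C; \<gamma> \<in> Mor C; src C \<alpha> = rng C \<beta>; src C \<beta> = rng C \<gamma>\<rbrakk>
      \<Longrightarrow> (\<alpha> \<cdot> \<beta>) \<cdot> \<gamma> = \<alpha> \<cdot> (\<beta> \<cdot> \<gamma>)"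
    and ident_left: "\<alpha> \<in> Mor C \<Longrightarrow> ident C (rng C \<alpha>) \<cdot> \<alpha> = \<alpha>"
    and ident_right: "\<alpha> \<in> Mor C \<Longrightarrow> \<alpha> \<cdot> ident C (src C \<alpha>) = \<alpha>"

record ('o1, 'm1, 'o2, 'm2) cat_map =
  fobj :: "'o1 \<Rightarrow> 'o2"
  fmor :: "'m1 \<Rightarrow> 'm2"

locale cat_functor = dom: small_category E + cod: small_category B
  for E :: "('o1, 'm1) cat" and B :: "('o2, 'm2) cat"
  and F :: "('o1, 'm1, 'o2, 'm2) cat_map" +
  assumes fobj_closed: "X \<in> Obj E \<Longrightarrow> fobj F X \<in> Obj B"
    and fmor_closed: "\<alpha> \<in> Mor E \<Longrightarrow> fmor F \<alpha> \<in> Mor B"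
    and fmor_src: "\<alpha> \<in> Mor E \<Longrightarrow> src B (fmor F \<alpha>) = fobj F (src E \<alpha>)"
    and fmor_rng: "\<alpha> \<in> Mor E \<Longrightarrow> rng B (fmor F \<alpha>) = fobj F (rng E \<alpha>)"
    and fmor_ident: "X \<in> Obj E \<Longrightarrow> fmor F (ident E X) = ident B (fobj F X)"
    and fmor_comp: "\<lbrakk>\<alpha> \<in> Mor E; \<beta> \<in> Mor E; src E \<alpha> = rng E \<beta>\<rbrakk>
      \<Longrightarrow> fmor F (\<alpha> \<cdot>\<^bsub>E\<^esub> \<beta>) = fmor F \<alpha> \<cdot>\<^bsub>B\<^esub> fmor F \<beta>"

definition discrete_conduche_fibration ::
  "('o1, 'm1) cat \<Rightarrow> ('o2, 'm2) cat \<Rightarrow> ('o1, 'm1, 'o2, 'm2) cat_map \<Rightarrow> bool" where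
  "discrete_conduche_fibration E B F \<longleftrightarrow> cat_functor E B F \<and>
    (\<forall>\<phi>\<in>Mor E. \<forall>\<rho>\<in>Mor B. \<forall>\<kappa>\<in>Mor B. src B \<rho> = rng B \<kappa> \<and> fmor F \<phi> = \<rho> \<cdot>\<^bsub>B\<^esub> \<kappa> \<longrightarrow>
      (\<exists>!(\<rho>', \<kappa>'). \<rho>' \<in> Mor E \<and> \<kappa>' \<in> Mor E \<and> src E \<rho>' = rng E \<kappa>' \<and> \<phi> = \<rho>' \<cdot>\<^bsub>E\<^esub> \<kappa>' \<and>
         fmor F \<rho>' = \<rho> \<and> fmor F \<kappa>' = \<kappa>))"

definition fibre ::
  "('o1, 'm1) cat \<Rightarrow> ('o1, 'm1, 'o2, 'm2) cat_map \<Rightarrow> 'o1 \<Rightarrow> 'm2 \<Rightarrow> 'm1 set" where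
  "fibre E F X b = {\<alpha> \<in> Mor E. rng E \<alpha> = X \<and> fmor F \<alpha> = b}"

definition row_finite ::
  "('o1, 'm1) cat \<Rightarrow> ('o2, 'm2) cat \<Rightarrow> ('o1, 'm1, 'o2, 'm2) cat_map \<Rightarrow> bool" where
  "row_finite E B F \<longleftrightarrow>
    (\<forall>X\<in>Obj E. \<forall>b\<in>Mor B. rng B b = fobj F X \<longrightarrow> finite (fibre E F X b))"

definition right_Ore :: "('o, 'm) cat \<Rightarrow> bool" where
  "right_Ore C \<longleftrightarrow>
    (\<forall>m\<in>Mor C. \<forall>n\<in>Mor C. rng C m = rng C n \<longrightarrow>
      (\<exists>p\<in>Mor C. \<exists>q\<in>Mor C. src C m = rng C p \<and> src C n = rng C q \<and> m \<cdot>\<^bsub>C\<^esub> p = n \<cdot>\<^bsub>C\<^esub> q))"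

definition strongly_right_Ore :: "('o, 'm) cat \<Rightarrow> bool" where
  "strongly_right_Ore C \<longleftrightarrow> right_Ore C \<and>
    (\<forall>m\<in>Mor C. \<forall>n\<in>Mor C. \<forall>p1\<in>Mor C. \<forall>p2\<in>Mor C. \<forall>q1\<in>Mor C. \<forall>q2\<in>Mor C.
      rng C m = rng C n \<and>
      src C m = rng C p1 \<and> src C n = rng C q1 \<and> m \<cdot>\<^bsub>C\<^esub> p1 = n \<cdot>\<^bsub>C\<^esub> q1 \<and>
      src C m = rng C p2 \<and> src C n = rng C q2 \<and> m \<cdot>\<^bsub>C\<^esub> p2 = n \<cdot>\<^bsub>C\<^esub> q2 \<longrightarrow>
      (\<exists>a\<in>Mor C. \<exists>b\<in>Mor C.
        src C p1 = rng C a \<and> src C p2 = rng C b \<and> p1 \<cdot>\<^bsub>C\<^esub> a = p2 \<cdot>\<^bsub>C\<^esub> b \<and>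
        src C q1 = rng C a \<and> src C q2 = rng C b \<and> q1 \<cdot>\<^bsub>C\<^esub> a = q2 \<cdot>\<^bsub>C\<^esub> b))"

definition slice :: "('o, 'm) cat \<Rightarrow> 'o \<Rightarrow> ('m, 'm \<times> 'm) cat" where
  "slice C X = \<lparr>
    Obj = {\<alpha> \<in> Mor C. rng C \<alpha> = X},
    Mor = {(\<alpha>, \<gamma>). \<alpha> \<in> Mor C \<and> rng C \<alpha> = X \<and> \<gamma> \<in> Mor C \<and> rng C \<gamma> = src C \<alpha>},
    src = (\<lambda>(\<alpha>, \<gamma>). \<alpha> \<cdot>\<^bsub>C\<^esub> \<gamma>),
    rng = (\<lambda>(\<alpha>, \<gamma>). \<alpha>),
    ident = (\<lambda>\<alpha>. (\<alpha>, ident C (src C \<alpha>))),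
    cmp = (\<lambda>(\<alpha>, \<gamma>) (_, \<delta>). (\<alpha>, \<gamma> \<cdot>\<^bsub>C\<^esub> \<delta>))\<rparr>"

definition slice_map ::
  "('o1, 'm1, 'o2, 'm2) cat_map \<Rightarrow> ('m1, 'm1 \<times> 'm1, 'm2, 'm2 \<times> 'm2) cat_map" where
  "slice_map F = \<lparr>fobj = fmor F, fmor = map_prod (fmor F) (fmor F)\<rparr>"

definition locally_split ::
  "('o1, 'm1) cat \<Rightarrow> ('o2, 'm2) cat \<Rightarrow> ('o1, 'm1, 'o2, 'm2) cat_map \<Rightarrow> bool" where
  "locally_split E B F \<longleftrightarrow>
    (\<forall>X\<in>Obj E. \<exists>x. cat_functor (slice B (fobj F X)) (slice E X) x \<and>
      (\<forall>b\<in>Obj (slice B (fobj F X)). fobj (slice_map F) (fobj x b) = b) \<and>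
      (\<forall>m\<in>Mor (slice B (fobj F X)). fmor (slice_map F) (fmor x m) = m))"

definition kumjian_pask_fibration ::
  "('o1, 'm1) cat \<Rightarrow> ('o2, 'm2) cat \<Rightarrow> ('o1, 'm1, 'o2, 'm2) cat_map \<Rightarrow> bool" where
  "kumjian_pask_fibration E B F \<longleftrightarrow>
    discrete_conduche_fibration E B F \<and> locally_split E B F \<and> strongly_right_Ore B"


section \<open>C*-algebras\<close>

definition complex_field :: "complex ring" where
  "complex_field = \<lparr>carrier = UNIV, mult = (*), one = 1, zero = 0, add = (+)\<rparr>"

text \<open>C*-algebras are not assumed unital: the inherited field \<open>one\<close> is never used.\<close>

record 'a cstar_struct = "(complex, 'a) module" +
  star :: "'a \<Rightarrow> 'a"
  cnorm :: "'a \<Rightarrow> real"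

locale cstar_algebra = module complex_field D
  for D :: "('a, 'z) cstar_struct_scheme" (structure) +
  assumes mult_closed: "\<lbrakk>x \<in> carrier D; y \<in> carrier D\<rbrakk> \<Longrightarrow> x \<otimes> y \<in> carrier D"
    and mult_assoc: "\<lbrakk>x \<in> carrier D; y \<in> carrier D; z \<in> carrier D\<rbrakk>
      \<Longrightarrow> (x \<otimes> y) \<otimes> z = x \<otimes> (y \<otimes> z)"
    and mult_distl: "\<lbrakk>x \<in> carrier D; y \<in> carrier D; z \<in> carrier D\<rbrakk>
      \<Longrightarrow> (x \<oplus> y) \<otimes> z = x \<otimes> z \<oplus> y \<otimes> z"
    and mult_distr: "\<lbrakk>x \<in> carrier D; y \<in> carrier D; z \<in> carrier D\<rbrakk>
      \<Longrightarrow> z \<otimes> (x \<oplus> y) = z \<otimes> x \<oplus> z \<otimes> y"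
    and smult_mult_left: "\<lbrakk>x \<in> carrier D; y \<in> carrier D\<rbrakk> \<Longrightarrow> (c \<odot> x) \<otimes> y = c \<odot> (x \<otimes> y)"
    and smult_mult_right: "\<lbrakk>x \<in> carrier D; y \<in> carrier D\<rbrakk> \<Longrightarrow> x \<otimes> (c \<odot> y) = c \<odot> (x \<otimes> y)"
    and star_closed: "x \<in> carrier D \<Longrightarrow> star D x \<in> carrier D"
    and star_star: "x \<in> carrier D \<Longrightarrow> star D (star D x) = x"
    and star_add: "\<lbrakk>x \<in> carrier D; y \<in> carrier D\<rbrakk> \<Longrightarrow> star D (x \<oplus> y) = star D x \<oplus> star D y"
    and star_mult: "\<lbrakk>x \<in> carrier D; y \<in> carrier D\<rbrakk> \<Longrightarrow> star D (x \<otimes> y) = star D y \<otimes> star D x"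
    and star_smult: "x \<in> carrier D \<Longrightarrow> star D (c \<odot> x) = cnj c \<odot> star D x"
    and cnorm_nonneg: "x \<in> carrier D \<Longrightarrow> 0 \<le> cnorm D x"
    and cnorm_eq_zero: "x \<in> carrier D \<Longrightarrow> cnorm D x = 0 \<longleftrightarrow> x = \<zero>"
    and cnorm_triangle: "\<lbrakk>x \<in> carrier D; y \<in> carrier D\<rbrakk> \<Longrightarrow> cnorm D (x \<oplus> y) \<le> cnorm D x + cnorm D y"
    and cnorm_smult: "x \<in> carrier D \<Longrightarrow> cnorm D (c \<odot> x) = cmod c * cnorm D x"
    and cnorm_mult: "\<lbrakk>x \<in> carrier D; y \<in> carrier D\<rbrakk> \<Longrightarrow> cnorm D (x \<otimes> y) \<le> cnorm D x * cnorm D y"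
    and cstar_identity: "x \<in> carrier D \<Longrightarrow> cnorm D (star D x \<otimes> x) = (cnorm D x)\<^sup>2"
    and complete: "\<lbrakk>\<And>n. f n \<in> carrier D;
        \<And>e. 0 < e \<Longrightarrow> \<exists>N. \<forall>m\<ge>N. \<forall>n\<ge>N. cnorm D (f m \<ominus> f n) < e\<rbrakk>
      \<Longrightarrow> \<exists>l\<in>carrier D. (\<lambda>n::nat. cnorm D (f n \<ominus> l)) \<longlonglongrightarrow> 0"

definition star_hom ::
  "('a, 'y) cstar_struct_scheme \<Rightarrow> ('b, 'z) cstar_struct_scheme \<Rightarrow> ('a \<Rightarrow> 'b) \<Rightarrow> bool" where
  "star_hom D D' \<phi> \<longleftrightarrow> \<phi> \<in> carrier D \<rightarrow> carrier D' \<and>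
    (\<forall>x\<in>carrier D. \<forall>y\<in>carrier D. \<phi> (x \<oplus>\<^bsub>D\<^esub> y) = \<phi> x \<oplus>\<^bsub>D'\<^esub> \<phi> y) \<and>
    (\<forall>x\<in>carrier D. \<forall>y\<in>carrier D. \<phi> (x \<otimes>\<^bsub>D\<^esub> y) = \<phi> x \<otimes>\<^bsub>D'\<^esub> \<phi> y) \<and>
    (\<forall>c. \<forall>x\<in>carrier D. \<phi> (c \<odot>\<^bsub>D\<^esub> x) = c \<odot>\<^bsub>D'\<^esub> \<phi> x) \<and>
    (\<forall>x\<in>carrier D. \<phi> (star D x) = star D' (\<phi> x))"

definition closed_star_subalgebra :: "('a, 'z) cstar_struct_scheme \<Rightarrow> 'a set \<Rightarrow> bool" where
  "closed_star_subalgebra D H \<longleftrightarrow> H \<subseteq> carrier D \<and> \<zero>\<^bsub>D\<^esub> \<in> H \<and>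
    (\<forall>x\<in>H. \<forall>y\<in>H. x \<oplus>\<^bsub>D\<^esub> y \<in> H \<and> x \<otimes>\<^bsub>D\<^esub> y \<in> H) \<and>
    (\<forall>x\<in>H. star D x \<in> H \<and> (\<forall>c. c \<odot>\<^bsub>D\<^esub> x \<in> H)) \<and>
    (\<forall>f l. (\<forall>n::nat. f n \<in> H) \<and> l \<in> carrier D \<and> (\<lambda>n. cnorm D (f n \<ominus>\<^bsub>D\<^esub> l)) \<longlonglongrightarrow> 0 \<longrightarrow> l \<in> H)"


section \<open>Cuntz-Krieger systems\<close>

definition is_projection :: "('a, 'z) cstar_struct_scheme \<Rightarrow> 'a \<Rightarrow> bool" where
  "is_projection D x \<longleftrightarrow> x \<in> carrier D \<and> star D x = x \<and> x \<otimes>\<^bsub>D\<^esub> x = x"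

definition is_partial_isometry :: "('a, 'z) cstar_struct_scheme \<Rightarrow> 'a \<Rightarrow> bool" where
  "is_partial_isometry D x \<longleftrightarrow> x \<in> carrier D \<and> x \<otimes>\<^bsub>D\<^esub> star D x \<otimes>\<^bsub>D\<^esub> x = x"

text \<open>The sum in the last clause is a finite one when \<open>F\<close> is row-finite; for other \<open>F\<close> the
  definition has no meaning (\<open>finsum\<close> is then a dummy value).\<close>

definition cuntz_krieger_system ::
  "('o1, 'm1) cat \<Rightarrow> ('o2, 'm2) cat \<Rightarrow> ('o1, 'm1, 'o2, 'm2) cat_map \<Rightarrow>
   ('a, 'z) cstar_struct_scheme \<Rightarrow> ('o1 \<Rightarrow> 'a) \<Rightarrow> ('m1 \<Rightarrow> 'a) \<Rightarrow> bool" where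
  "cuntz_krieger_system E B F D P S \<longleftrightarrow>
    (\<forall>X\<in>Obj E. is_projection D (P X)) \<and>
    (\<forall>\<alpha>\<in>Mor E. is_partial_isometry D (S \<alpha>)) \<and>
    (\<forall>X\<in>Obj E. \<forall>Y\<in>Obj E. X \<noteq> Y \<longrightarrow> P X \<otimes>\<^bsub>D\<^esub> P Y = \<zero>\<^bsub>D\<^esub>) \<and>
    (\<forall>\<alpha>\<in>Mor E. \<forall>\<beta>\<in>Mor E. src E \<alpha> = rng E \<beta> \<longrightarrow> S (\<alpha> \<cdot>\<^bsub>E\<^esub> \<beta>) = S \<alpha> \<otimes>\<^bsub>D\<^esub> S \<beta>) \<and>
    (\<forall>X\<in>Obj E. P X = S (ident E X) \<and> P X = star D (S (ident E X))) \<and>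
    (\<forall>\<alpha>\<in>Mor E. star D (S \<alpha>) \<otimes>\<^bsub>D\<^esub> S \<alpha> = P (src E \<alpha>)) \<and>
    (\<forall>\<alpha>\<in>Mor E. \<forall>\<beta>\<in>Mor E. fmor F \<alpha> = fmor F \<beta> \<and> \<alpha> \<noteq> \<beta> \<longrightarrow>
      star D (S \<beta>) \<otimes>\<^bsub>D\<^esub> S \<alpha> = \<zero>\<^bsub>D\<^esub>) \<and>
    (\<forall>X\<in>Obj E. \<forall>b\<in>Mor B. rng B b = fobj F X \<longrightarrow>
      finsum D (\<lambda>\<alpha>. S \<alpha> \<otimes>\<^bsub>D\<^esub> star D (S \<alpha>)) (fibre E F X b) = P X)"


section \<open>The free *-algebra on a set\<close>

text \<open>Words in letters \<open>(g, False)\<close>, standing for \<open>g\<close>, and \<open>(g, True)\<close>, standing for \<open>g*\<close>; their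
  concatenation is written additively because that is what the convolution product
  of \<open>Poly_Mapping\<close> expects.\<close>

datatype 'g star_word = Word (letters: "('g \<times> bool) list")

instantiation star_word :: (type) monoid_add
begin
definition "0 = Word []"
definition "v + w = Word (letters v @ letters w)"
instance by standard (auto simp: zero_star_word_def plus_star_word_def)
end

type_synonym 'g free_alg = "'g star_word \<Rightarrow>\<^sub>0 complex"

definition word_star :: "'g star_word \<Rightarrow> 'g star_word" where
  "word_star w = Word (rev (map (\<lambda>(g, b). (g, \<not> b)) (letters w)))"

definition free_star :: "'g free_alg \<Rightarrow> 'g free_alg" where
  "free_star a = Poly_Mapping.map_key word_star (Poly_Mapping.map cnj a)"

definition free_scale :: "complex \<Rightarrow> 'g free_alg \<Rightarrow> 'g free_alg" where
  "free_scale c a = Poly_Mapping.single 0 c * a"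

definition free_gen :: "'g \<Rightarrow> 'g free_alg" where
  "free_gen g = Poly_Mapping.single (Word [(g, False)]) 1"

text \<open>The empty word is excluded, so this is the free non-unital *-algebra on \<open>G\<close>.\<close>

definition free_words :: "'g set \<Rightarrow> 'g star_word set" where
  "free_words G = {w. letters w \<noteq> [] \<and> fst ` set (letters w) \<subseteq> G}"

definition free_star_algebra :: "'g set \<Rightarrow> 'g free_alg set" where
  "free_star_algebra G = {a. Poly_Mapping.keys a \<subseteq> free_words G}"


section \<open>Separated completion with respect to a C*-seminorm\<close>

definition cstar_seminorm ::
  "'r::ring set \<Rightarrow> (complex \<Rightarrow> 'r \<Rightarrow> 'r) \<Rightarrow> ('r \<Rightarrow> 'r) \<Rightarrow> ('r \<Rightarrow> real) \<Rightarrow> bool" where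
  "cstar_seminorm A sc st p \<longleftrightarrow>
    (\<forall>a\<in>A. 0 \<le> p a) \<and>
    (\<forall>a\<in>A. \<forall>b\<in>A. p (a + b) \<le> p a + p b) \<and>
    (\<forall>c. \<forall>a\<in>A. p (sc c a) = cmod c * p a) \<and>
    (\<forall>a\<in>A. \<forall>b\<in>A. p (a * b) \<le> p a * p b) \<and>
    (\<forall>a\<in>A. p (st a * a) = (p a)\<^sup>2)"

definition cauchy_seqs :: "'r::ring set \<Rightarrow> ('r \<Rightarrow> real) \<Rightarrow> (nat \<Rightarrow> 'r) set" where
  "cauchy_seqs A p = {x. (\<forall>n. x n \<in> A) \<and> (\<forall>e>0. \<exists>N. \<forall>m\<ge>N. \<forall>n\<ge>N. p (x m - x n) < e)}"

definition cauchy_class :: "'r::ring set \<Rightarrow> ('r \<Rightarrow> real) \<Rightarrow> (nat \<Rightarrow> 'r) \<Rightarrow> (nat \<Rightarrow> 'r) set" where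
  "cauchy_class A p x = {y \<in> cauchy_seqs A p. (\<lambda>n. p (x n - y n)) \<longlonglongrightarrow> 0}"

definition class_rep :: "(nat \<Rightarrow> 'r) set \<Rightarrow> nat \<Rightarrow> 'r" where
  "class_rep U = (SOME x. x \<in> U)"

definition cstar_completion ::
  "'r::ring set \<Rightarrow> (complex \<Rightarrow> 'r \<Rightarrow> 'r) \<Rightarrow> ('r \<Rightarrow> 'r) \<Rightarrow> ('r \<Rightarrow> real) \<Rightarrow> (nat \<Rightarrow> 'r) set cstar_struct" where
  "cstar_completion A sc st p = \<lparr>
    carrier = cauchy_class A p ` cauchy_seqs A p,
    mult = (\<lambda>U V. cauchy_class A p (\<lambda>n. class_rep U n * class_rep V n)),
    one = undefined,
    zero = cauchy_class A p (\<lambda>n. 0),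
    add = (\<lambda>U V. cauchy_class A p (\<lambda>n. class_rep U n + class_rep V n)),
    smult = (\<lambda>c U. cauchy_class A p (\<lambda>n. sc c (class_rep U n))),
    star = (\<lambda>U. cauchy_class A p (\<lambda>n. st (class_rep U n))),
    cnorm = (\<lambda>U. lim (\<lambda>n. p (class_rep U n)))\<rparr>"


section \<open>The C*-algebra of a functor\<close>

text \<open>Since \<open>P\<^sub>X = S\<^bsub>Id X\<^esub>\<close>, the morphisms suffice as generators, and the relations
  stating that the generators are projections and partial isometries follow from those below.\<close>

definition ck_relators ::
  "('o1, 'm1) cat \<Rightarrow> ('o2, 'm2) cat \<Rightarrow> ('o1, 'm1, 'o2, 'm2) cat_map \<Rightarrow> 'm1 free_alg set" where
  "ck_relators E B F =
    {free_gen (ident E X) * free_gen (ident E Y) | X Y. X \<in> Obj E \<and> Y \<in> Obj E \<and> X \<noteq> Y} \<union>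
    {free_gen (\<alpha> \<cdot>\<^bsub>E\<^esub> \<beta>) - free_gen \<alpha> * free_gen \<beta> | \<alpha> \<beta>.
      \<alpha> \<in> Mor E \<and> \<beta> \<in> Mor E \<and> src E \<alpha> = rng E \<beta>} \<union>
    {free_star (free_gen (ident E X)) - free_gen (ident E X) | X. X \<in> Obj E} \<union>
    {free_star (free_gen \<alpha>) * free_gen \<alpha> - free_gen (ident E (src E \<alpha>)) | \<alpha>. \<alpha> \<in> Mor E} \<union>
    {free_star (free_gen \<beta>) * free_gen \<alpha> | \<alpha> \<beta>.
      \<alpha> \<in> Mor E \<and> \<beta> \<in> Mor E \<and> fmor F \<alpha> = fmor F \<beta> \<and> \<alpha> \<noteq> \<beta>} \<union>
    {(\<Sum>\<alpha>\<in>fibre E F X b. free_gen \<alpha> * free_star (free_gen \<alpha>)) - free_gen (ident E X) | X b.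
      X \<in> Obj E \<and> b \<in> Mor B \<and> rng B b = fobj F X}"

definition ck_seminorms ::
  "('o1, 'm1) cat \<Rightarrow> ('o2, 'm2) cat \<Rightarrow> ('o1, 'm1, 'o2, 'm2) cat_map \<Rightarrow> ('m1 free_alg \<Rightarrow> real) set" where
  "ck_seminorms E B F =
    {p. cstar_seminorm (free_star_algebra (Mor E)) free_scale free_star p \<and>
        (\<forall>a\<in>ck_relators E B F. p a = 0)}"

text \<open>The largest C*-seminorm on the free *-algebra that satisfies the relations. The supremum is
  finite because the relations force \<open>p (free_gen \<alpha>) \<le> 1\<close>.\<close>

definition ck_norm ::
  "('o1, 'm1) cat \<Rightarrow> ('o2, 'm2) cat \<Rightarrow> ('o1, 'm1, 'o2, 'm2) cat_map \<Rightarrow> 'm1 free_alg \<Rightarrow> real" where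
  "ck_norm E B F a = (SUP p\<in>ck_seminorms E B F. p a)"

text \<open>That this is the universal C*-algebra for Cuntz-Krieger systems associated to \<open>F\<close> is
  proved in \<open>cstar_algebra_cstar_of\<close>, \<open>cuntz_krieger_system_cstar_of\<close>, \<open>cstar_of_generated\<close> and
  \<open>cstar_of_universal\<close> below, the last for target C*-algebras over an arbitrary type.\<close>

definition cstar_of ::
  "('o1, 'm1) cat \<Rightarrow> ('o2, 'm2) cat \<Rightarrow> ('o1, 'm1, 'o2, 'm2) cat_map \<Rightarrow>
   (nat \<Rightarrow> 'm1 free_alg) set cstar_struct" where
  "cstar_of E B F =
    cstar_completion (free_star_algebra (Mor E)) free_scale free_star (ck_norm E B F)"

definition cstar_gen ::
  "('o1, 'm1) cat \<Rightarrow> ('o2, 'm2) cat \<Rightarrow> ('o1, 'm1, 'o2, 'm2) cat_map \<Rightarrow> 'm1 \<Rightarrow> (nat \<Rightarrow> 'm1 free_alg) set" where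
  "cstar_gen E B F \<alpha> =
    cauchy_class (free_star_algebra (Mor E)) (ck_norm E B F) (\<lambda>n. free_gen \<alpha>)"


section \<open>The completion is a C*-algebra\<close>

lemma cring_complex_field: "cring complex_field"
proof (rule cringI)
  show "abelian_group complex_field"
    by (rule abelian_groupI) (auto simp: complex_field_def intro: exI[of _ "- x" for x])
  show "Group.comm_monoid complex_field"
    by (rule comm_monoidI) (auto simp: complex_field_def)
qed (simp add: complex_field_def algebra_simps)

locale cstar_seminormed =
  fixes A :: "'r::ring set" and sc :: "complex \<Rightarrow> 'r \<Rightarrow> 'r" and st :: "'r \<Rightarrow> 'r" and p :: "'r \<Rightarrow> real"
  assumes A_zero: "0 \<in> A"
    and A_add: "\<lbrakk>a \<in> A; b \<in> A\<rbrakk> \<Longrightarrow> a + b \<in> A"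
    and A_mult: "\<lbrakk>a \<in> A; b \<in> A\<rbrakk> \<Longrightarrow> a * b \<in> A"
    and A_sc: "a \<in> A \<Longrightarrow> sc c a \<in> A"
    and A_st: "a \<in> A \<Longrightarrow> st a \<in> A"
    and sc_add_left: "sc (c + d) a = sc c a + sc d a"
    and sc_add_right: "sc c (a + b) = sc c a + sc c b"
    and sc_sc: "sc c (sc d a) = sc (c * d) a"
    and sc_one: "sc 1 a = a"
    and sc_mult_left: "sc c a * b = sc c (a * b)"
    and sc_mult_right: "a * sc c b = sc c (a * b)"
    and st_st: "st (st a) = a"
    and st_add: "st (a + b) = st a + st b"
    and st_mult: "st (a * b) = st b * st a"
    and st_sc: "st (sc c a) = sc (cnj c) (st a)"
    and seminorm: "cstar_seminorm A sc st p"
begin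

lemma sc_zero: "sc 0 a = 0"
  using sc_add_left[of 0 0 a] by simp

lemma sc_minus_one: "sc (-1) a = - a"
proof -
  have "sc (-1) a + a = 0"
    using sc_add_left[of "-1" 1 a] by (simp add: sc_one sc_zero)
  then show ?thesis by (simp add: eq_neg_iff_add_eq_0)
qed

lemma A_uminus: "a \<in> A \<Longrightarrow> - a \<in> A"
  using A_sc[of a "-1"] by (simp add: sc_minus_one)

lemma A_minus: "\<lbrakk>a \<in> A; b \<in> A\<rbrakk> \<Longrightarrow> a - b \<in> A"
  using A_add[of a "- b"] by (simp add: A_uminus)

lemmas A_closed = A_zero A_add A_mult A_sc A_st A_uminus A_minus

lemma st_minus: "st (a - b) = st a - st b"
  using st_add[of "a - b" b] by (simp add: algebra_simps)

lemma sc_minus: "sc c (a - b) = sc c a - sc c b"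
  using sc_add_right[of c "a - b" b] by (simp add: algebra_simps)

lemma p_nonneg: "a \<in> A \<Longrightarrow> 0 \<le> p a"
  and p_add: "\<lbrakk>a \<in> A; b \<in> A\<rbrakk> \<Longrightarrow> p (a + b) \<le> p a + p b"
  and p_sc: "a \<in> A \<Longrightarrow> p (sc c a) = cmod c * p a"
  and p_mult: "\<lbrakk>a \<in> A; b \<in> A\<rbrakk> \<Longrightarrow> p (a * b) \<le> p a * p b"
  and p_cstar: "a \<in> A \<Longrightarrow> p (st a * a) = (p a)\<^sup>2"
  using seminorm by (auto simp: cstar_seminorm_def)

lemma p_uminus: "a \<in> A \<Longrightarrow> p (- a) = p a"
  using p_sc[of a "-1"] by (simp add: sc_minus_one)

lemma p_zero: "p 0 = 0"
  using p_sc[of 0 0] A_zero by (simp add: sc_zero)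

lemma p_minus_commute: "\<lbrakk>a \<in> A; b \<in> A\<rbrakk> \<Longrightarrow> p (a - b) = p (b - a)"
  using p_uminus[of "a - b"] A_minus by simp

lemma p_minus_triangle: "\<lbrakk>a \<in> A; b \<in> A; c \<in> A\<rbrakk> \<Longrightarrow> p (a - c) \<le> p (a - b) + p (b - c)"
  using p_add[of "a - b" "b - c"] A_minus by simp

lemma p_diff_le: "\<lbrakk>a \<in> A; b \<in> A\<rbrakk> \<Longrightarrow> \<bar>p a - p b\<bar> \<le> p (a - b)"
  using p_add[of "a - b" b] p_add[of "b - a" a] A_minus p_minus_commute[of a b] by (simp add: abs_le_iff)

lemma p_st_le: assumes "a \<in> A" shows "p a \<le> p (st a)"
proof (cases "p a = 0")
  case False
  have "p a * p a \<le> p (st a) * p a"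
    using p_cstar[OF assms] p_mult[of "st a" a] assms A_st by (simp add: power2_eq_square)
  then show ?thesis using False p_nonneg[OF assms] by simp
qed (use p_nonneg A_st assms in auto)

lemma p_st: "a \<in> A \<Longrightarrow> p (st a) = p a"
  using p_st_le[of a] p_st_le[of "st a"] A_st by (simp add: st_st)

abbreviation "Cs \<equiv> cauchy_seqs A p"
abbreviation "cl \<equiv> cauchy_class A p"
abbreviation "D \<equiv> cstar_completion A sc st p"

lemma Cs_A: "x \<in> Cs \<Longrightarrow> x n \<in> A"
  by (simp add: cauchy_seqs_def)

lemma CsI: "\<lbrakk>\<And>n. x n \<in> A; \<And>e. 0 < e \<Longrightarrow> \<exists>N. \<forall>m\<ge>N. \<forall>n\<ge>N. p (x m - x n) < e\<rbrakk> \<Longrightarrow> x \<in> Cs"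
  by (simp add: cauchy_seqs_def)

lemma CsD: "\<lbrakk>x \<in> Cs; 0 < e\<rbrakk> \<Longrightarrow> \<exists>N. \<forall>m\<ge>N. \<forall>n\<ge>N. p (x m - x n) < e"
  by (simp add: cauchy_seqs_def)

lemma Cs_const: "a \<in> A \<Longrightarrow> (\<lambda>n. a) \<in> Cs"
  by (rule CsI) (auto simp: p_zero)

lemma Cs_dominated:
  assumes x: "x \<in> Cs" and z: "\<And>n. z n \<in> A" and K: "\<And>m n. p (z m - z n) \<le> K * p (x m - x n)"
  shows "z \<in> Cs"
proof (rule CsI)
  fix e :: real assume e: "0 < e"
  have "0 < e / (\<bar>K\<bar> + 1)" using e by simp
  from CsD[OF x this] obtain N where N: "\<forall>m\<ge>N. \<forall>n\<ge>N. p (x m - x n) < e / (\<bar>K\<bar> + 1)" by blast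
  have "p (z m - z n) < e" if "m \<ge> N" "n \<ge> N" for m n
  proof -
    have "p (z m - z n) \<le> K * p (x m - x n)" by (rule K)
    also have "\<dots> \<le> (\<bar>K\<bar> + 1) * p (x m - x n)"
      by (rule mult_right_mono) (simp_all add: p_nonneg A_minus Cs_A[OF x])
    also have "\<dots> < (\<bar>K\<bar> + 1) * (e / (\<bar>K\<bar> + 1))"
      using N that by (intro mult_strict_left_mono) auto
    finally show ?thesis by simp
  qed
  then show "\<exists>N. \<forall>m\<ge>N. \<forall>n\<ge>N. p (z m - z n) < e" by blast
qed (rule z)

lemma Cs_dominated2:
  assumes x: "x \<in> Cs" and y: "y \<in> Cs" and z: "\<And>n. z n \<in> A"
    and K: "\<And>m n. p (z m - z n) \<le> K * (p (x m - x n) + p (y m - y n))"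
  shows "z \<in> Cs"
proof (rule CsI)
  fix e :: real assume e: "0 < e"
  have d: "0 < e / (2 * (\<bar>K\<bar> + 1))" using e by simp
  from CsD[OF x this] obtain N where N: "\<forall>m\<ge>N. \<forall>n\<ge>N. p (x m - x n) < e / (2 * (\<bar>K\<bar> + 1))" by blast
  from CsD[OF y d] obtain M where M: "\<forall>m\<ge>M. \<forall>n\<ge>M. p (y m - y n) < e / (2 * (\<bar>K\<bar> + 1))" by blast
  have "p (z m - z n) < e" if "m \<ge> max N M" "n \<ge> max N M" for m n
  proof -
    have "p (z m - z n) \<le> K * (p (x m - x n) + p (y m - y n))" by (rule K)
    also have "\<dots> \<le> (\<bar>K\<bar> + 1) * (p (x m - x n) + p (y m - y n))"
      by (rule mult_right_mono) (simp_all add: p_nonneg A_minus Cs_A[OF x] Cs_A[OF y])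
    also have "\<dots> < (\<bar>K\<bar> + 1) * (e / (2 * (\<bar>K\<bar> + 1)) + e / (2 * (\<bar>K\<bar> + 1)))"
      using N M that by (intro mult_strict_left_mono add_strict_mono) auto
    also have "\<dots> = e"
    proof -
      have "q * (e / (2 * q) + e / (2 * q)) = e" if "q \<noteq> 0" for q :: real
        using that by (simp add: field_simps)
      then show ?thesis by (metis abs_ge_zero add_nonneg_eq_0_iff zero_le_one zero_neq_one)
    qed
    finally show ?thesis .
  qed
  then show "\<exists>N. \<forall>m\<ge>N. \<forall>n\<ge>N. p (z m - z n) < e" by blast
qed (rule z)

lemma Cs_norm_convergent: assumes x: "x \<in> Cs" shows "convergent (\<lambda>n. p (x n))"
proof -
  have "Cauchy (\<lambda>n. p (x n))"
  proof (rule metric_CauchyI)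
    fix e :: real assume "0 < e"
    from CsD[OF x this] obtain N where N: "\<forall>m\<ge>N. \<forall>n\<ge>N. p (x m - x n) < e" by blast
    have "dist (p (x m)) (p (x n)) < e" if "m \<ge> N" "n \<ge> N" for m n
      using p_diff_le[OF Cs_A[OF x, of m] Cs_A[OF x, of n]] N that
      by (metis dist_real_def le_less_trans)
    then show "\<exists>M. \<forall>m\<ge>M. \<forall>n\<ge>M. dist (p (x m)) (p (x n)) < e" by blast
  qed
  then show ?thesis by (simp add: Cauchy_convergent_iff)
qed

lemma Cs_bounded: assumes x: "x \<in> Cs" obtains K where "0 \<le> K" "\<And>n. p (x n) \<le> K"
proof -
  have "Bseq (\<lambda>n. p (x n))"
    using Cs_norm_convergent[OF x] by (rule convergent_imp_Bseq)
  then obtain K where K: "0 < K" "\<forall>n. norm (p (x n)) \<le> K" by (rule BseqE)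
  have "p (x n) \<le> K" for n using K(2)[rule_format, of n] by simp
  with K(1) show ?thesis using that[of K] by simp
qed

lemma Cs_add: assumes x: "x \<in> Cs" and y: "y \<in> Cs" shows "(\<lambda>n. x n + y n) \<in> Cs"
proof (rule Cs_dominated2[OF x y, where K = 1])
  show "p (x m + y m - (x n + y n)) \<le> 1 * (p (x m - x n) + p (y m - y n))" for m n
    using p_add[of "x m - x n" "y m - y n"] A_minus Cs_A[OF x] Cs_A[OF y]
    by (simp add: algebra_simps)
qed (intro A_add Cs_A x y)

lemma mult_diff_le:
  assumes "a \<in> A" "b \<in> A" "a' \<in> A" "b' \<in> A"
  shows "p (a * b - a' * b') \<le> p a * p (b - b') + p (a - a') * p b'"
proof -
  have "a * b - a' * b' = a * (b - b') + (a - a') * b'" by (simp add: algebra_simps)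
  then have "p (a * b - a' * b') \<le> p (a * (b - b')) + p ((a - a') * b')"
    using p_add[of "a * (b - b')" "(a - a') * b'"] assms by (simp add: A_closed)
  also have "\<dots> \<le> p a * p (b - b') + p (a - a') * p b'"
    using assms by (intro add_mono p_mult A_closed) auto
  finally show ?thesis .
qed

lemma Cs_mult: assumes x: "x \<in> Cs" and y: "y \<in> Cs" shows "(\<lambda>n. x n * y n) \<in> Cs"
proof -
  obtain K where K: "0 \<le> K" "\<And>n. p (x n) \<le> K" using Cs_bounded[OF x] by metis
  obtain L where L: "0 \<le> L" "\<And>n. p (y n) \<le> L" using Cs_bounded[OF y] by metis
  show ?thesis
  proof (rule Cs_dominated2[OF x y, where K = "K + L"])
    fix m n
    have nn: "0 \<le> p (x m - x n)" "0 \<le> p (y m - y n)"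
      by (simp_all add: p_nonneg A_minus Cs_A[OF x] Cs_A[OF y])
    have "p (x m * y m - x n * y n) \<le> p (x m) * p (y m - y n) + p (x m - x n) * p (y n)"
      by (intro mult_diff_le Cs_A x y)
    also have "\<dots> \<le> K * p (y m - y n) + p (x m - x n) * L"
      using K L nn by (intro add_mono mult_right_mono mult_left_mono) auto
    also have "\<dots> \<le> (K + L) * (p (x m - x n) + p (y m - y n))"
      using K L nn by (simp add: algebra_simps)
    finally show "p (x m * y m - x n * y n) \<le> (K + L) * (p (x m - x n) + p (y m - y n))" .
  qed (intro A_mult Cs_A x y)
qed

lemma Cs_sc: assumes x: "x \<in> Cs" shows "(\<lambda>n. sc c (x n)) \<in> Cs"
  by (rule Cs_dominated[OF x, where K = "cmod c"])
    (auto simp: sc_minus[symmetric] p_sc A_minus Cs_A[OF x] intro: A_sc)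

lemma Cs_st: assumes x: "x \<in> Cs" shows "(\<lambda>n. st (x n)) \<in> Cs"
  by (rule Cs_dominated[OF x, where K = 1])
    (auto simp: st_minus[symmetric] p_st A_minus Cs_A[OF x] intro: A_st)

lemma Cs_uminus: "x \<in> Cs \<Longrightarrow> (\<lambda>n. - x n) \<in> Cs"
  using Cs_sc[of x "-1"] by (simp add: sc_minus_one)

lemma Cs_minus: "\<lbrakk>x \<in> Cs; y \<in> Cs\<rbrakk> \<Longrightarrow> (\<lambda>n. x n - y n) \<in> Cs"
  using Cs_add[OF _ Cs_uminus, of x y] by simp

lemmas Cs_closed = Cs_const Cs_add Cs_mult Cs_sc Cs_st Cs_uminus Cs_minus

definition nul :: "(nat \<Rightarrow> 'r) \<Rightarrow> bool" where
  "nul x \<longleftrightarrow> (\<lambda>n. p (x n)) \<longlonglongrightarrow> 0"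

lemma nul_le: assumes "\<And>n. z n \<in> A" "\<And>n. p (z n) \<le> f n" "f \<longlonglongrightarrow> 0" shows "nul z"
  unfolding nul_def using assms
  by (intro tendsto_sandwich[of "\<lambda>n. 0" "\<lambda>n. p (z n)" sequentially f 0])
    (auto intro!: always_eventually p_nonneg)

lemma nul_triangle:
  assumes "\<And>n. x n \<in> A" "\<And>n. y n \<in> A" "\<And>n. z n \<in> A"
    and "nul (\<lambda>n. x n - y n)" "nul (\<lambda>n. y n - z n)"
  shows "nul (\<lambda>n. x n - z n)"
  by (rule nul_le[where f = "\<lambda>n. p (x n - y n) + p (y n - z n)"])
    (use assms tendsto_add[of "\<lambda>n. p (x n - y n)" 0 sequentially "\<lambda>n. p (y n - z n)" 0]
      in \<open>auto intro!: A_minus p_minus_triangle simp: nul_def\<close>)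

lemma nul_commute: 
  assumes "\<And>n. x n \<in> A" "\<And>n. y n \<in> A" "nul (\<lambda>n. x n - y n)" shows "nul (\<lambda>n. y n - x n)"
  using assms(3) p_minus_commute[OF assms(1,2)] by (simp add: nul_def)

lemma cl_eq_iff: assumes "x \<in> Cs" "y \<in> Cs" shows "cl x = cl y \<longleftrightarrow> nul (\<lambda>n. x n - y n)"
proof
  assume "cl x = cl y"
  moreover have "y \<in> cl y" using assms by (simp add: cauchy_class_def p_zero)
  ultimately have "y \<in> cl x" by simp
  then show "nul (\<lambda>n. x n - y n)" by (simp add: cauchy_class_def nul_def)
next
  assume n: "nul (\<lambda>n. x n - y n)"
  have n': "nul (\<lambda>n. y n - x n)" by (rule nul_commute[OF _ _ n]) (auto intro: Cs_A assms)
  have "z \<in> cl x \<longleftrightarrow> z \<in> cl y" for z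
    unfolding cauchy_class_def nul_def[symmetric]
    using nul_triangle[OF _ _ _ n', of z] nul_triangle[OF _ _ _ n, of z] Cs_A assms by auto
  then show "cl x = cl y" by blast
qed

lemma rep_cl: assumes "x \<in> Cs"
  shows "class_rep (cl x) \<in> Cs" "nul (\<lambda>n. x n - class_rep (cl x) n)"
proof -
  have "x \<in> cl x" using assms by (simp add: cauchy_class_def p_zero)
  then have "class_rep (cl x) \<in> cl x" unfolding class_rep_def by (rule someI[where P = "\<lambda>z. z \<in> cl x"])
  then show "class_rep (cl x) \<in> Cs" "nul (\<lambda>n. x n - class_rep (cl x) n)"
    by (auto simp: cauchy_class_def nul_def)
qed

lemma carrier_D: "carrier D = cl ` Cs"
  by (simp add: cstar_completion_def)

lemma cl_closed: "x \<in> Cs \<Longrightarrow> cl x \<in> carrier D"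
  by (simp add: carrier_D)

lemma zero_D: "\<zero>\<^bsub>D\<^esub> = cl (\<lambda>n. 0)"
  by (simp add: cstar_completion_def)

lemma nul_add:
  assumes "\<And>n. x n \<in> A" "\<And>n. y n \<in> A" "nul x" "nul y" shows "nul (\<lambda>n. x n + y n)"
  by (rule nul_le[where f = "\<lambda>n. p (x n) + p (y n)"])
    (use assms tendsto_add[of "\<lambda>n. p (x n)" 0 sequentially "\<lambda>n. p (y n)" 0]
      in \<open>auto intro!: A_add p_add simp: nul_def\<close>)

lemma add_D: assumes "x \<in> Cs" "y \<in> Cs" shows "cl x \<oplus>\<^bsub>D\<^esub> cl y = cl (\<lambda>n. x n + y n)"
proof -
  have "cl (\<lambda>n. x n + y n) = cl (\<lambda>n. class_rep (cl x) n + class_rep (cl y) n)"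
    using nul_add[OF _ _ rep_cl(2)[OF assms(1)] rep_cl(2)[OF assms(2)]] assms
      Cs_A[OF assms(1)] Cs_A[OF assms(2)] Cs_A[OF rep_cl(1)[OF assms(1)]] Cs_A[OF rep_cl(1)[OF assms(2)]]
    by (subst cl_eq_iff) (auto intro!: Cs_closed rep_cl A_minus simp: algebra_simps)
  then show ?thesis by (simp add: cstar_completion_def)
qed

lemma smult_D: assumes "x \<in> Cs" shows "c \<odot>\<^bsub>D\<^esub> cl x = cl (\<lambda>n. sc c (x n))"
proof -
  have "(\<lambda>n. cmod c * p (x n - class_rep (cl x) n)) \<longlonglongrightarrow> 0"
    using rep_cl(2)[OF assms] by (intro tendsto_mult_right_zero) (simp add: nul_def)
  then have "cl (\<lambda>n. sc c (x n)) = cl (\<lambda>n. sc c (class_rep (cl x) n))"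
    using assms rep_cl(1)[OF assms]
    by (subst cl_eq_iff) (auto intro!: Cs_closed simp: sc_minus[symmetric] p_sc A_minus Cs_A nul_def)
  then show ?thesis by (simp add: cstar_completion_def)
qed

lemma star_D: assumes "x \<in> Cs" shows "star D (cl x) = cl (\<lambda>n. st (x n))"
proof -
  have "cl (\<lambda>n. st (x n)) = cl (\<lambda>n. st (class_rep (cl x) n))"
    using assms rep_cl[OF assms]
    by (subst cl_eq_iff) (auto intro!: Cs_closed simp: st_minus[symmetric] p_st A_minus Cs_A nul_def)
  then show ?thesis by (simp add: cstar_completion_def)
qed

lemma mult_D: assumes x: "x \<in> Cs" and y: "y \<in> Cs" shows "cl x \<otimes>\<^bsub>D\<^esub> cl y = cl (\<lambda>n. x n * y n)"
proof -
  let ?x = "class_rep (cl x)" and ?y = "class_rep (cl y)"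
  note x' = rep_cl[OF x] and y' = rep_cl[OF y]
  obtain K where K: "0 \<le> K" "\<And>n. p (x n) \<le> K" using Cs_bounded[OF x] by metis
  obtain L where L: "0 \<le> L" "\<And>n. p (?y n) \<le> L" using Cs_bounded[OF y'(1)] by metis
  have "nul (\<lambda>n. x n * y n - ?x n * ?y n)"
  proof (rule nul_le[where f = "\<lambda>n. K * p (y n - ?y n) + p (x n - ?x n) * L"])
    fix n
    show "x n * y n - ?x n * ?y n \<in> A" by (intro A_closed Cs_A x y x' y')
    have nn: "0 \<le> p (x n - ?x n)" "0 \<le> p (y n - ?y n)"
      by (simp_all add: p_nonneg A_minus Cs_A[OF x] Cs_A[OF y] Cs_A[OF x'(1)] Cs_A[OF y'(1)])
    have "p (x n * y n - ?x n * ?y n) \<le> p (x n) * p (y n - ?y n) + p (x n - ?x n) * p (?y n)"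
      by (intro mult_diff_le Cs_A x y x' y')
    also have "\<dots> \<le> K * p (y n - ?y n) + p (x n - ?x n) * L"
      using K L nn by (intro add_mono mult_right_mono mult_left_mono) auto
    finally show "p (x n * y n - ?x n * ?y n) \<le> K * p (y n - ?y n) + p (x n - ?x n) * L" .
  next
    show "(\<lambda>n. K * p (y n - ?y n) + p (x n - ?x n) * L) \<longlonglongrightarrow> 0"
      using x'(2) y'(2) unfolding nul_def
      by (intro tendsto_add_zero tendsto_mult_right_zero tendsto_mult_left_zero)
  qed
  then have "cl (\<lambda>n. x n * y n) = cl (\<lambda>n. ?x n * ?y n)"
    by (subst cl_eq_iff) (auto intro!: Cs_closed x y x' y')
  then show ?thesis by (simp add: cstar_completion_def)
qed

lemma cnorm_D: assumes x: "x \<in> Cs" shows "(\<lambda>n. p (x n)) \<longlonglongrightarrow> cnorm D (cl x)"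
proof -
  let ?x = "class_rep (cl x)"
  note x' = rep_cl[OF x]
  have 1: "(\<lambda>n. p (?x n)) \<longlonglongrightarrow> cnorm D (cl x)"
    using Cs_norm_convergent[OF x'(1)] by (simp add: cstar_completion_def convergent_LIMSEQ_iff)
  have "(\<lambda>n. p (x n) - p (?x n)) \<longlonglongrightarrow> 0"
    by (rule Lim_null_comparison[OF _ x'(2)[unfolded nul_def]])
      (auto intro!: always_eventually p_diff_le Cs_A x x')
  from tendsto_add[OF this 1] show ?thesis by simp
qed

lemma cnorm_D_unique: "\<lbrakk>x \<in> Cs; (\<lambda>n. p (x n)) \<longlonglongrightarrow> l\<rbrakk> \<Longrightarrow> cnorm D (cl x) = l"
  using cnorm_D LIMSEQ_unique by blast

lemma carrier_D_E: assumes "U \<in> carrier D" obtains x where "x \<in> Cs" "U = cl x"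
  using assms by (auto simp: carrier_D)

lemma abelian_group_D: "abelian_group D"
proof (rule abelian_groupI)
  show "\<zero>\<^bsub>D\<^esub> \<in> carrier D" by (simp add: zero_D cl_closed Cs_const A_zero)
next
  fix U assume "U \<in> carrier D"
  then obtain x where x: "x \<in> Cs" "U = cl x" by (rule carrier_D_E)
  show "\<zero>\<^bsub>D\<^esub> \<oplus>\<^bsub>D\<^esub> U = U" using x by (simp add: zero_D add_D Cs_const A_zero)
  show "\<exists>V\<in>carrier D. V \<oplus>\<^bsub>D\<^esub> U = \<zero>\<^bsub>D\<^esub>"
    using x by (intro bexI[of _ "cl (\<lambda>n. - x n)"]) (auto simp: zero_D add_D Cs_closed cl_closed)
qed (auto elim!: carrier_D_E simp: add_D cl_closed Cs_closed algebra_simps)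

lemma a_minus_D: assumes "x \<in> Cs" "y \<in> Cs" shows "cl x \<ominus>\<^bsub>D\<^esub> cl y = cl (\<lambda>n. x n - y n)"
proof -
  interpret abelian_group D by (rule abelian_group_D)
  have "\<ominus>\<^bsub>D\<^esub> cl y = cl (\<lambda>n. - y n)"
    using assms by (intro minus_equality) (auto simp: add_D Cs_closed cl_closed zero_D)
  then show ?thesis using assms by (simp add: a_minus_def add_D Cs_closed)
qed

lemma module_D: "module complex_field D"
proof (rule moduleI[OF cring_complex_field abelian_group_D])
  fix c d U assume "U \<in> carrier D"
  then obtain x where x: "x \<in> Cs" "U = cl x" by (rule carrier_D_E)
  show "c \<odot>\<^bsub>D\<^esub> U \<in> carrier D" using x by (simp add: smult_D cl_closed Cs_closed)
  show "(c \<oplus>\<^bsub>complex_field\<^esub> d) \<odot>\<^bsub>D\<^esub> U = c \<odot>\<^bsub>D\<^esub> U \<oplus>\<^bsub>D\<^esub> d \<odot>\<^bsub>D\<^esub> U"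
    using x by (simp add: complex_field_def smult_D add_D Cs_closed sc_add_left)
  show "(c \<otimes>\<^bsub>complex_field\<^esub> d) \<odot>\<^bsub>D\<^esub> U = c \<odot>\<^bsub>D\<^esub> (d \<odot>\<^bsub>D\<^esub> U)"
    using x by (simp add: complex_field_def smult_D Cs_closed sc_sc)
  show "\<one>\<^bsub>complex_field\<^esub> \<odot>\<^bsub>D\<^esub> U = U"
    using x by (simp add: complex_field_def smult_D sc_one)
  fix V assume "V \<in> carrier D"
  then obtain y where y: "y \<in> Cs" "V = cl y" by (rule carrier_D_E)
  show "c \<odot>\<^bsub>D\<^esub> (U \<oplus>\<^bsub>D\<^esub> V) = c \<odot>\<^bsub>D\<^esub> U \<oplus>\<^bsub>D\<^esub> c \<odot>\<^bsub>D\<^esub> V"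
    using x y by (simp add: smult_D add_D Cs_closed sc_add_right)
qed

lemma complete_D:
  assumes f: "\<And>n. f n \<in> carrier D"
    and c: "\<And>e. 0 < e \<Longrightarrow> \<exists>N. \<forall>m\<ge>N. \<forall>n\<ge>N. cnorm D (f m \<ominus>\<^bsub>D\<^esub> f n) < e"
  shows "\<exists>l\<in>carrier D. (\<lambda>n::nat. cnorm D (f n \<ominus>\<^bsub>D\<^esub> l)) \<longlonglongrightarrow> 0"
proof -
  have "\<forall>k. \<exists>x. x \<in> Cs \<and> f k = cl x" using f by (auto simp: carrier_D)
  then obtain x where x: "\<And>k. x k \<in> Cs" "\<And>k. f k = cl (x k)" by metis
  have "\<forall>k. \<exists>N. \<forall>m\<ge>N. \<forall>n\<ge>N. p (x k m - x k n) < 1 / real (Suc k)"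
    using CsD[OF x(1)] by simp
  then obtain N where N: "\<And>k m n. \<lbrakk>m \<ge> N k; n \<ge> N k\<rbrakk> \<Longrightarrow> p (x k m - x k n) < 1 / real (Suc k)"
    by metis
  define z where "z k = x k (N k)" for k
  have zA: "z k \<in> A" for k by (simp add: z_def Cs_A x)
  have near: "cnorm D (f k \<ominus>\<^bsub>D\<^esub> cl (\<lambda>n. z k)) \<le> 1 / real (Suc k)" for k
  proof -
    have "(\<lambda>n. p (x k n - z k)) \<longlonglongrightarrow> cnorm D (cl (\<lambda>n. x k n - z k))"
      by (rule cnorm_D) (intro Cs_closed x zA)
    moreover have "\<forall>n\<ge>N k. p (x k n - z k) \<le> 1 / real (Suc k)"
      using N[of k] by (auto simp: z_def intro!: less_imp_le)
    ultimately have "cnorm D (cl (\<lambda>n. x k n - z k)) \<le> 1 / real (Suc k)"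
      by (intro Lim_bounded) auto
    then show ?thesis by (simp add: x a_minus_D Cs_const zA)
  qed
  have tri: "cnorm D (cl u \<ominus>\<^bsub>D\<^esub> cl w) \<le> cnorm D (cl u \<ominus>\<^bsub>D\<^esub> cl v) + cnorm D (cl v \<ominus>\<^bsub>D\<^esub> cl w)"
    if "u \<in> Cs" "v \<in> Cs" "w \<in> Cs" for u v w
  proof -
    have "(\<lambda>n. p (u n - v n) + p (v n - w n)) \<longlonglongrightarrow>
        cnorm D (cl (\<lambda>n. u n - v n)) + cnorm D (cl (\<lambda>n. v n - w n))"
      using that by (intro tendsto_add cnorm_D Cs_closed)
    moreover have "(\<lambda>n. p (u n - w n)) \<longlonglongrightarrow> cnorm D (cl (\<lambda>n. u n - w n))"
      using that by (intro cnorm_D Cs_closed)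
    ultimately have "cnorm D (cl (\<lambda>n. u n - w n)) \<le>
        cnorm D (cl (\<lambda>n. u n - v n)) + cnorm D (cl (\<lambda>n. v n - w n))"
      by (intro LIMSEQ_le[of _ _ "\<lambda>n. p (u n - v n) + p (v n - w n)"])
        (use that in \<open>auto intro!: p_minus_triangle Cs_A\<close>)
    then show ?thesis using that by (simp add: a_minus_D)
  qed
  have comm: "cnorm D (cl u \<ominus>\<^bsub>D\<^esub> cl v) = cnorm D (cl v \<ominus>\<^bsub>D\<^esub> cl u)" if "u \<in> Cs" "v \<in> Cs" for u v
  proof -
    have "(\<lambda>n. p (u n - v n)) = (\<lambda>n. p (v n - u n))"
      using p_minus_commute that by (auto simp: Cs_A)
    then have "(\<lambda>n. p (v n - u n)) \<longlonglongrightarrow> cnorm D (cl (\<lambda>n. u n - v n))"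
      using cnorm_D[OF Cs_minus[OF that]] by simp
    then have "cnorm D (cl (\<lambda>n. v n - u n)) = cnorm D (cl (\<lambda>n. u n - v n))"
      using that by (intro cnorm_D_unique Cs_minus)
    then show ?thesis using that by (simp add: a_minus_D)
  qed
  have const: "cnorm D (cl (\<lambda>n. a) \<ominus>\<^bsub>D\<^esub> cl (\<lambda>n. b)) = p (a - b)" if "a \<in> A" "b \<in> A" for a b
    using that by (simp add: a_minus_D Cs_const) (rule cnorm_D_unique, auto intro: Cs_const A_minus)
  have small: "\<exists>M. \<forall>k\<ge>M. 1 / real (Suc k) < e" if "0 < e" for e :: real
    using LIMSEQ_D[OF LIMSEQ_inverse_real_of_nat that] by (auto simp: inverse_eq_divide)
  have z: "z \<in> Cs"
  proof (rule CsI[OF zA])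
    fix e :: real assume "0 < e"
    then have e: "0 < e / 3" by simp
    obtain M1 where M1: "\<forall>m\<ge>M1. \<forall>n\<ge>M1. cnorm D (f m \<ominus>\<^bsub>D\<^esub> f n) < e / 3" using c[OF e] by blast
    obtain M2 where M2: "\<forall>k\<ge>M2. 1 / real (Suc k) < e / 3" using small[OF e] by blast
    have "p (z m - z n) < e" if "m \<ge> max M1 M2" "n \<ge> max M1 M2" for m n
    proof -
      have "p (z m - z n) \<le> cnorm D (cl (\<lambda>i. z m) \<ominus>\<^bsub>D\<^esub> f m) + cnorm D (f m \<ominus>\<^bsub>D\<^esub> f n)
          + cnorm D (f n \<ominus>\<^bsub>D\<^esub> cl (\<lambda>i. z n))"
        using tri[of "\<lambda>i. z m" "x m" "\<lambda>i. z n"] tri[of "x m" "x n" "\<lambda>i. z n"]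
        by (simp add: const[symmetric] zA Cs_const x)
      also have "\<dots> < e / 3 + e / 3 + e / 3"
        using M1 M2 that near[of m] near[of n] comm[of "\<lambda>i. z m" "x m"]
        by (intro add_strict_mono) (auto simp: Cs_const zA x intro: le_less_trans)
      finally show ?thesis by simp
    qed
    then show "\<exists>M. \<forall>m\<ge>M. \<forall>n\<ge>M. p (z m - z n) < e" by blast
  qed
  have "(\<lambda>k. cnorm D (f k \<ominus>\<^bsub>D\<^esub> cl z)) \<longlonglongrightarrow> 0"
  proof (rule LIMSEQ_I)
    fix e :: real assume "0 < e"
    then have e: "0 < e / 2" by simp
    obtain M1 where M1: "\<forall>m\<ge>M1. \<forall>n\<ge>M1. p (z m - z n) < e / 2" using CsD[OF z e] by blast
    obtain M2 where M2: "\<forall>k\<ge>M2. 1 / real (Suc k) < e / 2" using small[OF e] by blast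
    have "norm (cnorm D (f k \<ominus>\<^bsub>D\<^esub> cl z) - 0) < e" if k: "k \<ge> max M1 M2" for k
    proof -
      have lim: "(\<lambda>n. p (z k - z n)) \<longlonglongrightarrow> cnorm D (cl (\<lambda>n. z k - z n))"
        by (rule cnorm_D) (intro Cs_closed z zA)
      then have "cnorm D (cl (\<lambda>n. z k - z n)) \<le> e / 2"
        by (rule Lim_bounded[where M = M1]) (use M1 k in \<open>auto intro: less_imp_le\<close>)
      then have "cnorm D (cl (\<lambda>n. z k) \<ominus>\<^bsub>D\<^esub> cl z) \<le> e / 2" by (simp add: a_minus_D Cs_const zA z)
      moreover have "cnorm D (f k \<ominus>\<^bsub>D\<^esub> cl (\<lambda>n. z k)) < e / 2" using near[of k] M2 k by (auto intro: le_less_trans)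
      moreover have "cnorm D (f k \<ominus>\<^bsub>D\<^esub> cl z) \<le>
          cnorm D (f k \<ominus>\<^bsub>D\<^esub> cl (\<lambda>n. z k)) + cnorm D (cl (\<lambda>n. z k) \<ominus>\<^bsub>D\<^esub> cl z)"
        using tri[of "x k" "\<lambda>i. z k" z] by (simp add: x Cs_const zA z)
      ultimately have "cnorm D (f k \<ominus>\<^bsub>D\<^esub> cl z) < e" by simp
      moreover have "0 \<le> cnorm D (f k \<ominus>\<^bsub>D\<^esub> cl z)"
      proof -
        have m: "(\<lambda>n. x k n - z n) \<in> Cs" by (intro Cs_closed x z)
        then show ?thesis
          using LIMSEQ_le_const[OF cnorm_D[OF m], of 0] p_nonneg Cs_A[OF m] by (auto simp: x a_minus_D z)
      qed
      ultimately show ?thesis by simp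
    qed
    then show "\<exists>M. \<forall>k\<ge>M. norm (cnorm D (f k \<ominus>\<^bsub>D\<^esub> cl z) - 0) < e" by blast
  qed
  then show ?thesis using cl_closed[OF z] by blast
qed

lemma cnorm_D_eq_zero: assumes "x \<in> Cs" shows "cnorm D (cl x) = 0 \<longleftrightarrow> cl x = \<zero>\<^bsub>D\<^esub>"
proof -
  have "cl x = \<zero>\<^bsub>D\<^esub> \<longleftrightarrow> (\<lambda>n. p (x n)) \<longlonglongrightarrow> 0"
    using cl_eq_iff[OF assms Cs_const[OF A_zero]] by (simp add: zero_D nul_def)
  then show ?thesis
    using cnorm_D[OF assms] cnorm_D_unique[OF assms, of 0] by metis
qed

theorem cstar_algebra_D: "cstar_algebra D"
proof (intro cstar_algebra.intro module_D cstar_algebra_axioms.intro)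
  fix U V assume "U \<in> carrier D" "V \<in> carrier D"
  then obtain x y where xy: "x \<in> Cs" "U = cl x" "y \<in> Cs" "V = cl y" by (auto elim!: carrier_D_E)
  show "cnorm D (U \<oplus>\<^bsub>D\<^esub> V) \<le> cnorm D U + cnorm D V"
    using xy by (simp add: add_D)
      (rule LIMSEQ_le[OF cnorm_D tendsto_add[OF cnorm_D cnorm_D]]; auto intro!: Cs_closed p_add Cs_A)
  show "cnorm D (U \<otimes>\<^bsub>D\<^esub> V) \<le> cnorm D U * cnorm D V"
    using xy by (simp add: mult_D)
      (rule LIMSEQ_le[OF cnorm_D tendsto_mult[OF cnorm_D cnorm_D]]; auto intro!: Cs_closed p_mult Cs_A)
next
  fix U assume "U \<in> carrier D"
  then obtain x where x: "x \<in> Cs" "U = cl x" by (rule carrier_D_E)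
  show "0 \<le> cnorm D U"
    using LIMSEQ_le_const[OF cnorm_D[OF x(1)], of 0] p_nonneg Cs_A[OF x(1)] x by auto
  show "cnorm D U = 0 \<longleftrightarrow> U = \<zero>\<^bsub>D\<^esub>" using x cnorm_D_eq_zero by simp
  show "cnorm D (c \<odot>\<^bsub>D\<^esub> U) = cmod c * cnorm D U" for c
  proof -
    have "(\<lambda>n. p (sc c (x n))) \<longlonglongrightarrow> cmod c * cnorm D (cl x)"
      using tendsto_mult_left[OF cnorm_D[OF x(1)]] by (simp add: p_sc Cs_A x)
    then show ?thesis using x by (simp add: smult_D cnorm_D_unique Cs_sc)
  qed
  show "cnorm D (star D U \<otimes>\<^bsub>D\<^esub> U) = (cnorm D U)\<^sup>2"
  proof -
    have "(\<lambda>n. p (st (x n) * x n)) \<longlonglongrightarrow> (cnorm D (cl x))\<^sup>2"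
      using tendsto_power[OF cnorm_D[OF x(1)], of 2] by (simp add: p_cstar Cs_A x)
    then show ?thesis using x by (simp add: star_D mult_D cnorm_D_unique Cs_closed)
  qed
qed (rule complete_D; assumption |
     auto elim!: carrier_D_E simp: add_D mult_D smult_D star_D cl_closed Cs_closed algebra_simps
      sc_mult_left sc_mult_right st_st st_add st_mult st_sc)+

definition emb :: "'r \<Rightarrow> (nat \<Rightarrow> 'r) set" where
  "emb a = cl (\<lambda>n. a)"

lemma emb_closed: "a \<in> A \<Longrightarrow> emb a \<in> carrier D"
  by (simp add: emb_def cl_closed Cs_const)

lemma emb_zero: "emb 0 = \<zero>\<^bsub>D\<^esub>"
  and emb_add: "\<lbrakk>a \<in> A; b \<in> A\<rbrakk> \<Longrightarrow> emb (a + b) = emb a \<oplus>\<^bsub>D\<^esub> emb b"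
  and emb_mult: "\<lbrakk>a \<in> A; b \<in> A\<rbrakk> \<Longrightarrow> emb (a * b) = emb a \<otimes>\<^bsub>D\<^esub> emb b"
  and emb_sc: "a \<in> A \<Longrightarrow> emb (sc c a) = c \<odot>\<^bsub>D\<^esub> emb a"
  and emb_st: "a \<in> A \<Longrightarrow> emb (st a) = star D (emb a)"
  by (simp_all add: emb_def zero_D add_D mult_D smult_D star_D Cs_const)

lemma emb_eq_iff: "\<lbrakk>a \<in> A; b \<in> A\<rbrakk> \<Longrightarrow> emb a = emb b \<longleftrightarrow> p (a - b) = 0"
  by (simp add: emb_def cl_eq_iff Cs_const nul_def LIMSEQ_const_iff)

lemma cnorm_emb: "a \<in> A \<Longrightarrow> cnorm D (emb a) = p a"
  unfolding emb_def by (rule cnorm_D_unique) (auto intro: Cs_const)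

lemma emb_dense: assumes x: "x \<in> Cs" shows "(\<lambda>n. cnorm D (emb (x n) \<ominus>\<^bsub>D\<^esub> cl x)) \<longlonglongrightarrow> 0"
proof (rule LIMSEQ_I)
  fix e :: real assume "0 < e"
  then have e: "0 < e / 2" by simp
  obtain M where M: "\<forall>m\<ge>M. \<forall>n\<ge>M. p (x m - x n) < e / 2" using CsD[OF x e] by blast
  have "norm (cnorm D (emb (x k) \<ominus>\<^bsub>D\<^esub> cl x) - 0) < e" if k: "k \<ge> M" for k
  proof -
    have m: "(\<lambda>n. x k - x n) \<in> Cs" by (intro Cs_closed x Cs_A)
    have eq: "emb (x k) \<ominus>\<^bsub>D\<^esub> cl x = cl (\<lambda>n. x k - x n)"
      by (simp add: emb_def a_minus_D Cs_const Cs_A x)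
    have "cnorm D (cl (\<lambda>n. x k - x n)) \<le> e / 2"
      by (rule Lim_bounded[OF cnorm_D[OF m], where M = M]) (use M k in \<open>auto intro: less_imp_le\<close>)
    moreover have "0 \<le> cnorm D (cl (\<lambda>n. x k - x n))"
      using LIMSEQ_le_const[OF cnorm_D[OF m], of 0] p_nonneg Cs_A[OF m] by auto
    ultimately show ?thesis using \<open>0 < e\<close> by (simp add: eq)
  qed
  then show "\<exists>M. \<forall>k\<ge>M. norm (cnorm D (emb (x k) \<ominus>\<^bsub>D\<^esub> cl x) - 0) < e" by blast
qed

end


section \<open>The free *-algebra and the universal C*-seminorm\<close>

lemma word_star_word_star [simp]: "word_star (word_star w) = w"
  by (cases w) (simp add: word_star_def rev_map comp_def split_def)

lemma inj_word_star: "inj word_star"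
  by (metis injI word_star_word_star)

lemma word_star_add: "word_star (v + w) = word_star w + word_star v"
  by (simp add: word_star_def plus_star_word_def)

lemma lookup_free_star: "Poly_Mapping.lookup (free_star a) w = cnj (Poly_Mapping.lookup a (word_star w))"
  by (simp add: free_star_def Poly_Mapping.map_key.rep_eq[OF inj_word_star] Poly_Mapping.map.rep_eq when_def)

lemma lookup_free_scale: "Poly_Mapping.lookup (free_scale c a) w = c * Poly_Mapping.lookup a w"
  by (simp add: free_scale_def mult_map_scale_conv_mult[symmetric] Poly_Mapping.map.rep_eq when_def)

lemma free_star_add: "free_star (a + b) = free_star a + free_star b"
  by (rule poly_mapping_eqI) (simp add: lookup_free_star lookup_add)

lemma free_star_zero: "free_star 0 = 0"
  by (rule poly_mapping_eqI) (simp add: lookup_free_star)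

lemma free_star_star: "free_star (free_star a) = a"
  by (rule poly_mapping_eqI) (simp add: lookup_free_star)

lemma free_star_scale: "free_star (free_scale c a) = free_scale (cnj c) (free_star a)"
  by (rule poly_mapping_eqI) (simp add: lookup_free_star lookup_free_scale)

lemma free_star_single: "free_star (Poly_Mapping.single w c) = Poly_Mapping.single (word_star w) (cnj c)"
  by (rule poly_mapping_eqI) (auto simp: lookup_free_star lookup_single when_def)

lemma free_star_sum: "free_star (sum f I) = (\<Sum>i\<in>I. free_star (f i))"
  by (induction I rule: infinite_finite_induct) (simp_all add: free_star_zero free_star_add)

lemma free_alg_expand: "a = (\<Sum>w\<in>Poly_Mapping.keys a. Poly_Mapping.single w (Poly_Mapping.lookup a w))"
  by (rule poly_mapping_eqI)
    (auto simp: lookup_sum lookup_single when_def sum.delta' in_keys_iff)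

lemma free_star_mult: "free_star (a * b) = free_star b * free_star a"
proof -
  let ?s = "\<lambda>a w. Poly_Mapping.single w (Poly_Mapping.lookup a w)"
  have "free_star (sum (?s a) I * sum (?s b) J) = free_star (sum (?s b) J) * free_star (sum (?s a) I)" for I J
    unfolding sum_product free_star_sum mult_single free_star_single word_star_add complex_cnj_mult
    by (subst sum.swap) (simp add: mult.commute)
  from this[of "Poly_Mapping.keys a" "Poly_Mapping.keys b"] show ?thesis
    by (simp add: free_alg_expand[symmetric])
qed

lemma free_words_add: "\<lbrakk>v \<in> free_words G; w \<in> free_words G\<rbrakk> \<Longrightarrow> v + w \<in> free_words G"
  by (auto simp: free_words_def plus_star_word_def)

lemma free_words_star: "w \<in> free_words G \<Longrightarrow> word_star w \<in> free_words G"
  by (auto simp: free_words_def word_star_def)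

lemma free_zero_closed: "0 \<in> free_star_algebra G"
  by (simp add: free_star_algebra_def)

lemma free_add_closed: "\<lbrakk>a \<in> free_star_algebra G; b \<in> free_star_algebra G\<rbrakk> \<Longrightarrow> a + b \<in> free_star_algebra G"
  using keys_add[of a b] by (auto simp: free_star_algebra_def)

lemma free_mult_closed: "\<lbrakk>a \<in> free_star_algebra G; b \<in> free_star_algebra G\<rbrakk> \<Longrightarrow> a * b \<in> free_star_algebra G"
  using keys_mult[of a b] free_words_add[of _ G] by (fastforce simp: free_star_algebra_def)

lemma free_scale_closed: "a \<in> free_star_algebra G \<Longrightarrow> free_scale c a \<in> free_star_algebra G"
  by (auto simp: free_star_algebra_def in_keys_iff lookup_free_scale subset_iff)

lemma free_star_closed: "a \<in> free_star_algebra G \<Longrightarrow> free_star a \<in> free_star_algebra G"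
  using free_words_star[of "word_star _" G] by (auto simp: free_star_algebra_def in_keys_iff lookup_free_star subset_iff)

lemma free_gen_closed: "g \<in> G \<Longrightarrow> free_gen g \<in> free_star_algebra G"
  by (auto simp: free_star_algebra_def free_gen_def free_words_def)

lemma free_sum_closed: "(\<And>i. i \<in> I \<Longrightarrow> f i \<in> free_star_algebra G) \<Longrightarrow> sum f I \<in> free_star_algebra G"
  by (induction I rule: infinite_finite_induct) (auto intro: free_zero_closed free_add_closed)

lemma free_single_closed: "w \<in> free_words G \<Longrightarrow> Poly_Mapping.single w c \<in> free_star_algebra G"
  by (auto simp: free_star_algebra_def)

lemma cstar_seminormed_free:
  assumes "cstar_seminorm (free_star_algebra G) free_scale free_star p"
  shows "cstar_seminormed (free_star_algebra G) free_scale free_star p"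
proof
  show "free_scale c a * b = free_scale c (a * b)" for c and a b :: "'a free_alg"
    by (simp add: free_scale_def mult.assoc)
  show "a * free_scale c b = free_scale c (a * b)" for c and a b :: "'a free_alg"
  proof -
    have "a * Poly_Mapping.single 0 c = Poly_Mapping.single 0 c * a"
    proof -
      let ?s = "\<lambda>w. Poly_Mapping.single w (Poly_Mapping.lookup a w)"
      have "sum ?s I * Poly_Mapping.single 0 c = Poly_Mapping.single 0 c * sum ?s I" for I
        by (simp add: sum_distrib_left sum_distrib_right mult_single mult.commute)
      from this[of "Poly_Mapping.keys a"] show ?thesis by (simp add: free_alg_expand[symmetric])
    qed
    then show ?thesis by (simp add: free_scale_def mult.assoc[symmetric])
  qed
qed (use assms in \<open>auto intro: free_zero_closed free_add_closed free_mult_closed free_scale_closed free_star_closed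
      poly_mapping_eqI simp: lookup_free_scale lookup_add algebra_simps free_star_star free_star_add
      free_star_mult free_star_scale\<close>)

lemma free_star_algebra_induct [consumes 1, case_names zero gen add mult scale star]:
  assumes a: "a \<in> free_star_algebra G"
    and zero: "P 0"
    and gen: "\<And>g. g \<in> G \<Longrightarrow> P (free_gen g)"
    and add: "\<And>a b. \<lbrakk>a \<in> free_star_algebra G; b \<in> free_star_algebra G; P a; P b\<rbrakk> \<Longrightarrow> P (a + b)"
    and mult: "\<And>a b. \<lbrakk>a \<in> free_star_algebra G; b \<in> free_star_algebra G; P a; P b\<rbrakk> \<Longrightarrow> P (a * b)"
    and scale: "\<And>c a. \<lbrakk>a \<in> free_star_algebra G; P a\<rbrakk> \<Longrightarrow> P (free_scale c a)"
    and star: "\<And>a. \<lbrakk>a \<in> free_star_algebra G; P a\<rbrakk> \<Longrightarrow> P (free_star a)"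
  shows "P a"
proof -
  have letter: "P (Poly_Mapping.single (Word [l]) 1)" if "fst l \<in> G" for l
  proof (cases l)
    case (Pair g b)
    have "Poly_Mapping.single (Word [(g, True)]) 1 = free_star (free_gen g)"
      by (simp add: free_gen_def free_star_single word_star_def)
    then show ?thesis
      using that Pair gen[of g] star[OF free_gen_closed, of g] by (cases b) (simp_all add: free_gen_def)
  qed
  have word: "P (Poly_Mapping.single (Word ls) 1)" if "ls \<noteq> []" "fst ` set ls \<subseteq> G" for ls
    using that
  proof (induction ls rule: list_nonempty_induct)
    case (single l)
    then show ?case using letter by simp
  next
    case (cons l ls)
    have "Poly_Mapping.single (Word (l # ls)) 1 =
        Poly_Mapping.single (Word [l]) 1 * Poly_Mapping.single (Word ls) (1::complex)"
      by (simp add: mult_single plus_star_word_def)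
    moreover have "P (Poly_Mapping.single (Word [l]) 1 * Poly_Mapping.single (Word ls) 1)"
      using cons letter by (intro mult free_single_closed) (auto simp: free_words_def)
    ultimately show ?case by simp
  qed
  have single: "P (Poly_Mapping.single w c)" if "w \<in> free_words G" for w c
  proof -
    have "Poly_Mapping.single w c = free_scale c (Poly_Mapping.single w 1)"
      by (simp add: free_scale_def mult_single)
    then show ?thesis
      using that word[of "letters w"] scale[OF free_single_closed[OF that], of 1 c] by (simp add: free_words_def)
  qed
  have "P (\<Sum>w\<in>K. Poly_Mapping.single w (Poly_Mapping.lookup a w))" if "finite K" "K \<subseteq> free_words G" for K
    using that
    by (induction K rule: finite_induct)
      (auto intro!: zero add single free_sum_closed free_single_closed)
  from this[of "Poly_Mapping.keys a"] show ?thesis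
    using a by (simp add: free_star_algebra_def free_alg_expand[symmetric])
qed

lemma fibre_Mor: "\<alpha> \<in> fibre E F X b \<Longrightarrow> \<alpha> \<in> Mor E"
  by (simp add: fibre_def)

context cat_functor
begin

abbreviation "A \<equiv> free_star_algebra (Mor E)"

lemma free_minus_closed: "\<lbrakk>a \<in> A; b \<in> A\<rbrakk> \<Longrightarrow> a - b \<in> A"
  using cstar_seminormed.A_minus[OF cstar_seminormed_free[of "Mor E" "\<lambda>_. 0"]]
  by (simp add: cstar_seminorm_def)

lemma ck_relators_closed: "ck_relators E B F \<subseteq> A"
  by (auto simp: ck_relators_def fibre_Mor
      intro!: free_minus_closed free_mult_closed free_star_closed free_gen_closed free_sum_closed
        dom.ident_closed dom.comp_closed dom.src_closed)

lemma ck_seminorms_seminormed: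
  "p \<in> ck_seminorms E B F \<Longrightarrow> cstar_seminormed A free_scale free_star p"
  by (simp add: ck_seminorms_def cstar_seminormed_free)

lemma ck_seminorms_zero: "(\<lambda>_. 0) \<in> ck_seminorms E B F"
  by (simp add: ck_seminorms_def cstar_seminorm_def)

lemma ck_seminorms_relator: "\<lbrakk>p \<in> ck_seminorms E B F; a \<in> ck_relators E B F\<rbrakk> \<Longrightarrow> p a = 0"
  by (simp add: ck_seminorms_def)

lemma relator_source: "\<alpha> \<in> Mor E \<Longrightarrow>
    free_star (free_gen \<alpha>) * free_gen \<alpha> - free_gen (ident E (src E \<alpha>)) \<in> ck_relators E B F"
  unfolding ck_relators_def by blast

lemma ck_seminorms_gen_le_1:
  assumes p: "p \<in> ck_seminorms E B F" and \<alpha>: "\<alpha> \<in> Mor E"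
  shows "p (free_gen \<alpha>) \<le> 1"
proof -
  interpret p: cstar_seminormed A free_scale free_star p by (rule ck_seminorms_seminormed[OF p])
  have sq: "(p (free_gen \<beta>))\<^sup>2 = p (free_gen (ident E (src E \<beta>)))" if \<beta>: "\<beta> \<in> Mor E" for \<beta>
  proof -
    have "\<bar>p (free_star (free_gen \<beta>) * free_gen \<beta>) - p (free_gen (ident E (src E \<beta>)))\<bar> \<le> 0"
      using p.p_diff_le[of "free_star (free_gen \<beta>) * free_gen \<beta>" "free_gen (ident E (src E \<beta>))"]
        ck_seminorms_relator[OF p relator_source[OF \<beta>]] \<beta>
      by (simp add: p.A_closed free_gen_closed dom.ident_closed dom.src_closed)
    then show ?thesis using p.p_cstar[OF free_gen_closed[OF \<beta>]] by simp
  qed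
  let ?u = "ident E (src E \<alpha>)"
  have u: "?u \<in> Mor E" "src E ?u = src E \<alpha>"
    using \<alpha> by (simp_all add: dom.ident_closed dom.src_closed dom.src_ident)
  have "p (free_gen ?u) \<le> 1"
    using sq[OF u(1)] by (auto simp: u power2_eq_square)
  then have "(p (free_gen \<alpha>))\<^sup>2 \<le> 1\<^sup>2" using sq[OF \<alpha>] by simp
  then show ?thesis by (rule power2_le_imp_le) simp
qed

lemma ck_seminorms_bounded:
  assumes "a \<in> A" shows "\<exists>K. \<forall>p\<in>ck_seminorms E B F. p a \<le> K"
  using assms
proof (induction a rule: free_star_algebra_induct)
  case zero
  then show ?case
    by (intro exI[of _ 0]) (simp add: cstar_seminormed.p_zero[OF ck_seminorms_seminormed])
next
  case (gen \<alpha>)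
  then show ?case using ck_seminorms_gen_le_1 by blast
next
  case (add a b)
  then obtain K L where "\<forall>p\<in>ck_seminorms E B F. p a \<le> K" "\<forall>p\<in>ck_seminorms E B F. p b \<le> L" by blast
  then show ?case
    using cstar_seminormed.p_add[OF ck_seminorms_seminormed add(1,2)]
    by (intro exI[of _ "K + L"]) (fastforce intro: order_trans)
next
  case (mult a b)
  then obtain K L where KL: "\<forall>p\<in>ck_seminorms E B F. p a \<le> K" "\<forall>p\<in>ck_seminorms E B F. p b \<le> L" by blast
  have "p (a * b) \<le> K * L" if p: "p \<in> ck_seminorms E B F" for p
  proof -
    interpret p: cstar_seminormed A free_scale free_star p by (rule ck_seminorms_seminormed[OF p])
    have "p a * p b \<le> K * L"
      using KL p p.p_nonneg mult(1,2) by (intro mult_mono) (auto intro: order_trans)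
    then show ?thesis using p.p_mult mult(1,2) order_trans by blast
  qed
  then show ?case by blast
next
  case (scale c a)
  then obtain K where "\<forall>p\<in>ck_seminorms E B F. p a \<le> K" by blast
  then show ?case
    by (intro exI[of _ "cmod c * K"] ballI)
      (simp only: cstar_seminormed.p_sc[OF ck_seminorms_seminormed scale(1)] mult_left_mono norm_ge_zero)
next
  case (star a)
  then obtain K where "\<forall>p\<in>ck_seminorms E B F. p a \<le> K" by blast
  then show ?case
    by (intro exI[of _ K] ballI)
      (simp only: cstar_seminormed.p_st[OF ck_seminorms_seminormed star(1)])
qed

lemma ck_norm_upper: assumes "a \<in> A" "p \<in> ck_seminorms E B F" shows "p a \<le> ck_norm E B F a"
proof -
  obtain K where "\<forall>p\<in>ck_seminorms E B F. p a \<le> K" using ck_seminorms_bounded[OF assms(1)] by blast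
  then have "bdd_above ((\<lambda>p. p a) ` ck_seminorms E B F)" by (intro bdd_aboveI2) blast
  with assms(2) show ?thesis unfolding ck_norm_def by (rule cSUP_upper)
qed

lemma ck_norm_least: assumes "\<And>p. p \<in> ck_seminorms E B F \<Longrightarrow> p a \<le> K" shows "ck_norm E B F a \<le> K"
  unfolding ck_norm_def using ck_seminorms_zero assms by (intro cSUP_least) auto

lemma ck_norm_nonneg: "a \<in> A \<Longrightarrow> 0 \<le> ck_norm E B F a"
  using ck_norm_upper[OF _ ck_seminorms_zero] by simp

lemma cstar_seminorm_ck_norm: "cstar_seminorm A free_scale free_star (ck_norm E B F)"
  unfolding cstar_seminorm_def
proof (intro conjI ballI allI)
  let ?N = "ck_norm E B F"
  note sn = ck_seminorms_seminormed
  fix a assume a: "a \<in> A"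
  show "0 \<le> ?N a" using a by (rule ck_norm_nonneg)
  show "?N (free_scale c a) = cmod c * ?N a" for c
  proof (rule antisym)
    show "?N (free_scale c a) \<le> cmod c * ?N a"
      using ck_norm_upper[OF a] by (intro ck_norm_least) (simp add: cstar_seminormed.p_sc[OF sn] a mult_left_mono)
    show "cmod c * ?N a \<le> ?N (free_scale c a)"
    proof (cases "c = 0")
      case False
      have "?N a \<le> ?N (free_scale c a) / cmod c"
        using ck_norm_upper[OF free_scale_closed[OF a], of _ c] False
        by (intro ck_norm_least) (simp add: cstar_seminormed.p_sc[OF sn] a field_simps)
      then show ?thesis using False by (simp add: field_simps)
    qed (use ck_norm_nonneg free_scale_closed a in auto)
  qed
  show "?N (free_star a * a) = (?N a)\<^sup>2"
  proof (rule antisym)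
    show "?N (free_star a * a) \<le> (?N a)\<^sup>2"
      using ck_norm_upper[OF a]
      by (intro ck_norm_least) (simp add: cstar_seminormed.p_cstar[OF sn] cstar_seminormed.p_nonneg[OF sn] a power_mono)
    have "?N a \<le> sqrt (?N (free_star a * a))"
      using ck_norm_upper[OF free_mult_closed[OF free_star_closed[OF a] a]]
      by (intro ck_norm_least real_le_rsqrt) (simp add: cstar_seminormed.p_cstar[OF sn] a)
    then show "(?N a)\<^sup>2 \<le> ?N (free_star a * a)"
      using ck_norm_nonneg a free_mult_closed[OF free_star_closed[OF a] a]
      by (metis power_mono real_sqrt_pow2)
  qed
  fix b assume b: "b \<in> A"
  show "?N (a + b) \<le> ?N a + ?N b"
    using ck_norm_upper[OF a] ck_norm_upper[OF b] cstar_seminormed.p_add[OF sn a b]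
    by (intro ck_norm_least) (fastforce intro: order_trans)
  show "?N (a * b) \<le> ?N a * ?N b"
  proof (rule ck_norm_least)
    fix p assume p: "p \<in> ck_seminorms E B F"
    have "p (a * b) \<le> p a * p b" by (rule cstar_seminormed.p_mult[OF sn[OF p] a b])
    also have "\<dots> \<le> ?N a * ?N b"
      using ck_norm_upper[OF a p] ck_norm_upper[OF b p] ck_norm_nonneg[OF a]
        cstar_seminormed.p_nonneg[OF sn[OF p] b] by (intro mult_mono)
    finally show "p (a * b) \<le> ?N a * ?N b" .
  qed
qed

lemma ck_norm_relator: "a \<in> ck_relators E B F \<Longrightarrow> ck_norm E B F a = 0"
  using ck_norm_least[of a 0] ck_norm_nonneg[of a] ck_seminorms_relator[of _ a] ck_relators_closed by force

end

sublocale cat_functor \<subseteq> univ: cstar_seminormed "free_star_algebra (Mor E)" free_scale free_star "ck_norm E B F"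
  by (rule cstar_seminormed_free) (rule cstar_seminorm_ck_norm)


section \<open>Calculus in a C*-algebra\<close>

context cstar_algebra
begin

lemma neg_smult: "x \<in> carrier D \<Longrightarrow> \<ominus>\<^bsub>D\<^esub> x = (-1) \<odot>\<^bsub>D\<^esub> x"
proof -
  assume x: "x \<in> carrier D"
  have "(-1) \<odot>\<^bsub>D\<^esub> x \<oplus>\<^bsub>D\<^esub> x = \<zero>\<^bsub>D\<^esub>"
    using smult_l_distr[of "-1" 1 x] smult_one[of x] smult_l_null[of x] x
    by (simp add: complex_field_def)
  then show ?thesis using x smult_closed[of "-1" x] by (intro M.minus_equality) (auto simp: complex_field_def)
qed

lemma smult_in: "x \<in> carrier D \<Longrightarrow> c \<odot>\<^bsub>D\<^esub> x \<in> carrier D"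
  using smult_closed[of c x] by (simp add: complex_field_def)

lemma smult_add: "\<lbrakk>x \<in> carrier D; y \<in> carrier D\<rbrakk> \<Longrightarrow> c \<odot>\<^bsub>D\<^esub> (x \<oplus>\<^bsub>D\<^esub> y) = c \<odot>\<^bsub>D\<^esub> x \<oplus>\<^bsub>D\<^esub> c \<odot>\<^bsub>D\<^esub> y"
  using smult_r_distr[of c x y] by (simp add: complex_field_def)

lemma add_smult: "x \<in> carrier D \<Longrightarrow> (c + d) \<odot>\<^bsub>D\<^esub> x = c \<odot>\<^bsub>D\<^esub> x \<oplus>\<^bsub>D\<^esub> d \<odot>\<^bsub>D\<^esub> x"
  using smult_l_distr[of c d x] by (simp add: complex_field_def)

lemma smult_smult: "x \<in> carrier D \<Longrightarrow> c \<odot>\<^bsub>D\<^esub> (d \<odot>\<^bsub>D\<^esub> x) = (c * d) \<odot>\<^bsub>D\<^esub> x"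
  using smult_assoc1[of c d x] by (simp add: complex_field_def)

lemma one_smult: "x \<in> carrier D \<Longrightarrow> 1 \<odot>\<^bsub>D\<^esub> x = x"
  using smult_one[of x] by (simp add: complex_field_def)

lemma zero_smult: "x \<in> carrier D \<Longrightarrow> 0 \<odot>\<^bsub>D\<^esub> x = \<zero>\<^bsub>D\<^esub>"
  using smult_l_null[of x] by (simp add: complex_field_def)

lemma smult_zero: "c \<odot>\<^bsub>D\<^esub> \<zero>\<^bsub>D\<^esub> = \<zero>\<^bsub>D\<^esub>"
  using smult_r_null[of c] by (simp add: complex_field_def)

lemma mult_zero_left: "x \<in> carrier D \<Longrightarrow> \<zero>\<^bsub>D\<^esub> \<otimes>\<^bsub>D\<^esub> x = \<zero>\<^bsub>D\<^esub>"
  using smult_mult_left[of x x 0] by (simp add: zero_smult mult_closed)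

lemma mult_zero_right: "x \<in> carrier D \<Longrightarrow> x \<otimes>\<^bsub>D\<^esub> \<zero>\<^bsub>D\<^esub> = \<zero>\<^bsub>D\<^esub>"
  using smult_mult_right[of x x 0] by (simp add: zero_smult mult_closed)

lemma star_zero: "star D \<zero>\<^bsub>D\<^esub> = \<zero>\<^bsub>D\<^esub>"
  using star_smult[of "\<zero>\<^bsub>D\<^esub>" 0] by (simp add: zero_smult star_closed)

lemma diff_closed: "\<lbrakk>x \<in> carrier D; y \<in> carrier D\<rbrakk> \<Longrightarrow> x \<ominus>\<^bsub>D\<^esub> y \<in> carrier D"
  by (rule M.minus_closed)

lemma diff_smult: "\<lbrakk>x \<in> carrier D; y \<in> carrier D\<rbrakk> \<Longrightarrow> x \<ominus>\<^bsub>D\<^esub> y = x \<oplus>\<^bsub>D\<^esub> (-1) \<odot>\<^bsub>D\<^esub> y"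
  by (simp add: a_minus_def neg_smult)

lemma diff_self: "x \<in> carrier D \<Longrightarrow> x \<ominus>\<^bsub>D\<^esub> x = \<zero>\<^bsub>D\<^esub>"
  by (simp add: a_minus_def M.r_neg)

lemma diff_eq_zero: "\<lbrakk>x \<in> carrier D; y \<in> carrier D\<rbrakk> \<Longrightarrow> x \<ominus>\<^bsub>D\<^esub> y = \<zero>\<^bsub>D\<^esub> \<longleftrightarrow> x = y"
proof
  assume "x \<in> carrier D" "y \<in> carrier D" and 0: "x \<ominus>\<^bsub>D\<^esub> y = \<zero>\<^bsub>D\<^esub>"
  then have "x = (x \<oplus>\<^bsub>D\<^esub> \<ominus>\<^bsub>D\<^esub> y) \<oplus>\<^bsub>D\<^esub> y" by (simp add: M.a_assoc M.l_neg)
  also have "\<dots> = y" using 0 \<open>y \<in> carrier D\<close> by (simp add: a_minus_def)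
  finally show "x = y" .
qed (simp add: diff_self)

lemma cnorm_zero: "cnorm D \<zero>\<^bsub>D\<^esub> = 0"
  using cnorm_eq_zero[of "\<zero>\<^bsub>D\<^esub>"] by simp

lemma cnorm_diff_eq_zero: "\<lbrakk>x \<in> carrier D; y \<in> carrier D\<rbrakk> \<Longrightarrow> cnorm D (x \<ominus>\<^bsub>D\<^esub> y) = 0 \<longleftrightarrow> x = y"
  by (simp add: cnorm_eq_zero diff_closed diff_eq_zero)

lemma diff_commute: "\<lbrakk>x \<in> carrier D; y \<in> carrier D\<rbrakk> \<Longrightarrow> x \<ominus>\<^bsub>D\<^esub> y = (-1) \<odot>\<^bsub>D\<^esub> (y \<ominus>\<^bsub>D\<^esub> x)"
  by (simp add: diff_smult smult_add smult_in smult_smult one_smult M.a_comm)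

lemma cnorm_diff_commute: "\<lbrakk>x \<in> carrier D; y \<in> carrier D\<rbrakk> \<Longrightarrow> cnorm D (x \<ominus>\<^bsub>D\<^esub> y) = cnorm D (y \<ominus>\<^bsub>D\<^esub> x)"
  by (simp add: diff_commute[of x y] cnorm_smult diff_closed)

lemma diff_split: "\<lbrakk>x \<in> carrier D; y \<in> carrier D; z \<in> carrier D\<rbrakk>
    \<Longrightarrow> x \<ominus>\<^bsub>D\<^esub> z = (x \<ominus>\<^bsub>D\<^esub> y) \<oplus>\<^bsub>D\<^esub> (y \<ominus>\<^bsub>D\<^esub> z)"
  by (simp add: a_minus_def M.a_assoc M.r_neg1 M.r_neg2)

lemma cnorm_diff_triangle: "\<lbrakk>x \<in> carrier D; y \<in> carrier D; z \<in> carrier D\<rbrakk>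
    \<Longrightarrow> cnorm D (x \<ominus>\<^bsub>D\<^esub> z) \<le> cnorm D (x \<ominus>\<^bsub>D\<^esub> y) + cnorm D (y \<ominus>\<^bsub>D\<^esub> z)"
  using cnorm_triangle[of "x \<ominus>\<^bsub>D\<^esub> y" "y \<ominus>\<^bsub>D\<^esub> z"] by (simp add: diff_split[of x y z] diff_closed)

lemma cnorm_star_le: assumes x: "x \<in> carrier D" shows "cnorm D x \<le> cnorm D (star D x)"
proof (cases "cnorm D x = 0")
  case False
  have "cnorm D x * cnorm D x \<le> cnorm D (star D x) * cnorm D x"
    using cstar_identity[OF x] cnorm_mult[OF star_closed[OF x] x] by (simp add: power2_eq_square)
  then show ?thesis using False cnorm_nonneg[OF x] by simp
qed (use cnorm_nonneg star_closed x in auto)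

lemma cnorm_star: "x \<in> carrier D \<Longrightarrow> cnorm D (star D x) = cnorm D x"
  using cnorm_star_le[of x] cnorm_star_le[of "star D x"] by (simp add: star_closed star_star)

lemma add_diff_add: "\<lbrakk>x \<in> carrier D; y \<in> carrier D; z \<in> carrier D; w \<in> carrier D\<rbrakk>
    \<Longrightarrow> (x \<oplus>\<^bsub>D\<^esub> y) \<ominus>\<^bsub>D\<^esub> (z \<oplus>\<^bsub>D\<^esub> w) = (x \<ominus>\<^bsub>D\<^esub> z) \<oplus>\<^bsub>D\<^esub> (y \<ominus>\<^bsub>D\<^esub> w)"
  by (simp add: diff_smult smult_add smult_in M.a_ac)

lemma smult_diff: "\<lbrakk>x \<in> carrier D; y \<in> carrier D\<rbrakk> \<Longrightarrow> c \<odot>\<^bsub>D\<^esub> (x \<ominus>\<^bsub>D\<^esub> y) = c \<odot>\<^bsub>D\<^esub> x \<ominus>\<^bsub>D\<^esub> c \<odot>\<^bsub>D\<^esub> y"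
  by (simp add: diff_smult smult_add smult_in smult_smult)

lemma star_diff: "\<lbrakk>x \<in> carrier D; y \<in> carrier D\<rbrakk> \<Longrightarrow> star D (x \<ominus>\<^bsub>D\<^esub> y) = star D x \<ominus>\<^bsub>D\<^esub> star D y"
  by (simp add: diff_smult star_add star_smult star_closed smult_in)

lemma mult_diff_left: "\<lbrakk>x \<in> carrier D; y \<in> carrier D; z \<in> carrier D\<rbrakk>
    \<Longrightarrow> (x \<ominus>\<^bsub>D\<^esub> y) \<otimes>\<^bsub>D\<^esub> z = x \<otimes>\<^bsub>D\<^esub> z \<ominus>\<^bsub>D\<^esub> y \<otimes>\<^bsub>D\<^esub> z"
  by (simp add: diff_smult mult_distl smult_mult_left smult_in mult_closed)

lemma mult_diff_right: "\<lbrakk>x \<in> carrier D; y \<in> carrier D; z \<in> carrier D\<rbrakk>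
    \<Longrightarrow> z \<otimes>\<^bsub>D\<^esub> (x \<ominus>\<^bsub>D\<^esub> y) = z \<otimes>\<^bsub>D\<^esub> x \<ominus>\<^bsub>D\<^esub> z \<otimes>\<^bsub>D\<^esub> y"
  by (simp add: diff_smult mult_distr smult_mult_right smult_in mult_closed)

lemma cnorm_diff_mult:
  assumes "x \<in> carrier D" "y \<in> carrier D" "z \<in> carrier D" "w \<in> carrier D"
  shows "cnorm D (x \<otimes>\<^bsub>D\<^esub> y \<ominus>\<^bsub>D\<^esub> z \<otimes>\<^bsub>D\<^esub> w)
    \<le> cnorm D x * cnorm D (y \<ominus>\<^bsub>D\<^esub> w) + cnorm D (x \<ominus>\<^bsub>D\<^esub> z) * cnorm D w"
proof -
  have "cnorm D (x \<otimes>\<^bsub>D\<^esub> y \<ominus>\<^bsub>D\<^esub> z \<otimes>\<^bsub>D\<^esub> w)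
      \<le> cnorm D (x \<otimes>\<^bsub>D\<^esub> (y \<ominus>\<^bsub>D\<^esub> w)) + cnorm D ((x \<ominus>\<^bsub>D\<^esub> z) \<otimes>\<^bsub>D\<^esub> w)"
    using cnorm_diff_triangle[of "x \<otimes>\<^bsub>D\<^esub> y" "x \<otimes>\<^bsub>D\<^esub> w" "z \<otimes>\<^bsub>D\<^esub> w"] assms
    by (simp add: mult_diff_left mult_diff_right mult_closed)
  also have "\<dots> \<le> cnorm D x * cnorm D (y \<ominus>\<^bsub>D\<^esub> w) + cnorm D (x \<ominus>\<^bsub>D\<^esub> z) * cnorm D w"
    by (intro add_mono cnorm_mult diff_closed assms)
  finally show ?thesis .
qed

definition conv :: "(nat \<Rightarrow> 'a) \<Rightarrow> 'a \<Rightarrow> bool" where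
  "conv f l \<longleftrightarrow> (\<forall>n. f n \<in> carrier D) \<and> l \<in> carrier D \<and> (\<lambda>n. cnorm D (f n \<ominus>\<^bsub>D\<^esub> l)) \<longlonglongrightarrow> 0"

lemma convD: "conv f l \<Longrightarrow> f n \<in> carrier D" "conv f l \<Longrightarrow> l \<in> carrier D"
  "conv f l \<Longrightarrow> (\<lambda>n. cnorm D (f n \<ominus>\<^bsub>D\<^esub> l)) \<longlonglongrightarrow> 0"
  by (auto simp: conv_def)

lemma convI_le:
  assumes "\<And>n. f n \<in> carrier D" "l \<in> carrier D" "\<And>n. cnorm D (f n \<ominus>\<^bsub>D\<^esub> l) \<le> g n" "g \<longlonglongrightarrow> 0"
  shows "conv f l"
  unfolding conv_def using assms
  by (auto intro!: tendsto_sandwich[of "\<lambda>n. 0" "\<lambda>n. cnorm D (f n \<ominus>\<^bsub>D\<^esub> l)" sequentially g 0]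
      always_eventually cnorm_nonneg diff_closed)

lemma conv_unique: assumes "conv f l" "conv f m" shows "l = m"
proof -
  have "(\<lambda>n. cnorm D (f n \<ominus>\<^bsub>D\<^esub> l) + cnorm D (f n \<ominus>\<^bsub>D\<^esub> m)) \<longlonglongrightarrow> 0"
    using assms by (intro tendsto_add_zero) (simp_all add: conv_def)
  moreover have "cnorm D (l \<ominus>\<^bsub>D\<^esub> m) \<le> cnorm D (f n \<ominus>\<^bsub>D\<^esub> l) + cnorm D (f n \<ominus>\<^bsub>D\<^esub> m)" for n
    using cnorm_diff_triangle[of l "f n" m] cnorm_diff_commute[of l "f n"] assms by (simp add: convD)
  ultimately have "cnorm D (l \<ominus>\<^bsub>D\<^esub> m) \<le> 0"
    by (intro LIMSEQ_le_const) auto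
  then have "cnorm D (l \<ominus>\<^bsub>D\<^esub> m) = 0"
    using cnorm_nonneg[of "l \<ominus>\<^bsub>D\<^esub> m"] assms by (simp add: convD diff_closed)
  then show ?thesis using assms by (simp add: convD cnorm_diff_eq_zero)
qed

lemma conv_const: "l \<in> carrier D \<Longrightarrow> conv (\<lambda>n. l) l"
  by (simp add: conv_def diff_self cnorm_zero)

lemma conv_add: assumes "conv f l" "conv g m" shows "conv (\<lambda>n. f n \<oplus>\<^bsub>D\<^esub> g n) (l \<oplus>\<^bsub>D\<^esub> m)"
proof (rule convI_le)
  show "(\<lambda>n. cnorm D (f n \<ominus>\<^bsub>D\<^esub> l) + cnorm D (g n \<ominus>\<^bsub>D\<^esub> m)) \<longlonglongrightarrow> 0"
    using assms by (intro tendsto_add_zero) (simp_all add: conv_def)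
qed (use assms in \<open>auto simp: convD add_diff_add intro!: cnorm_triangle diff_closed\<close>)

lemma conv_smult: assumes "conv f l" shows "conv (\<lambda>n. c \<odot>\<^bsub>D\<^esub> f n) (c \<odot>\<^bsub>D\<^esub> l)"
proof (rule convI_le)
  show "(\<lambda>n. cmod c * cnorm D (f n \<ominus>\<^bsub>D\<^esub> l)) \<longlonglongrightarrow> 0"
    using assms by (intro tendsto_mult_right_zero) (simp_all add: conv_def)
qed (use assms in \<open>auto simp: convD smult_in smult_diff[symmetric] cnorm_smult diff_closed\<close>)

lemma conv_star: assumes "conv f l" shows "conv (\<lambda>n. star D (f n)) (star D l)"
  using assms by (auto simp: conv_def star_closed star_diff[symmetric] cnorm_star diff_closed)

lemma conv_cnorm: assumes "conv f l" shows "(\<lambda>n. cnorm D (f n)) \<longlonglongrightarrow> cnorm D l"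
proof -
  have le: "cnorm D x - cnorm D y \<le> cnorm D (x \<ominus>\<^bsub>D\<^esub> y)" if "x \<in> carrier D" "y \<in> carrier D" for x y
    using cnorm_diff_triangle[of x y "\<zero>\<^bsub>D\<^esub>"] that by (simp add: diff_smult[of _ "\<zero>\<^bsub>D\<^esub>"] smult_zero)
  have "(\<lambda>n. cnorm D (f n) - cnorm D l) \<longlonglongrightarrow> 0"
  proof (rule Lim_null_comparison[OF _ convD(3)[OF assms]])
    have "\<bar>cnorm D (f n) - cnorm D l\<bar> \<le> cnorm D (f n \<ominus>\<^bsub>D\<^esub> l)" for n
      using le[of "f n" l] le[of l "f n"] cnorm_diff_commute[of l "f n"] assms by (simp add: convD abs_le_iff)
    then show "\<forall>\<^sub>F n in sequentially. norm (cnorm D (f n) - cnorm D l) \<le> cnorm D (f n \<ominus>\<^bsub>D\<^esub> l)" by simp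
  qed
  from tendsto_add[OF this tendsto_const[of "cnorm D l"]] show ?thesis by simp
qed

lemma conv_mult: assumes f: "conv f l" and g: "conv g m" shows "conv (\<lambda>n. f n \<otimes>\<^bsub>D\<^esub> g n) (l \<otimes>\<^bsub>D\<^esub> m)"
proof (rule convI_le)
  have "(\<lambda>n. cnorm D (f n) * cnorm D (g n \<ominus>\<^bsub>D\<^esub> m) + cnorm D (f n \<ominus>\<^bsub>D\<^esub> l) * cnorm D m)
      \<longlonglongrightarrow> cnorm D l * 0 + 0 * cnorm D m"
    by (intro tendsto_intros conv_cnorm convD(3) f g)
  then show "(\<lambda>n. cnorm D (f n) * cnorm D (g n \<ominus>\<^bsub>D\<^esub> m) + cnorm D (f n \<ominus>\<^bsub>D\<^esub> l) * cnorm D m) \<longlonglongrightarrow> 0" by simp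
qed (auto intro!: mult_closed cnorm_diff_mult convD(1)[OF f] convD(2)[OF f] convD(1)[OF g] convD(2)[OF g])

lemma conv_close:
  assumes f: "conv f l" and g: "\<And>n. g n \<in> carrier D" and d: "(\<lambda>n. cnorm D (g n \<ominus>\<^bsub>D\<^esub> f n)) \<longlonglongrightarrow> 0"
  shows "conv g l"
proof (rule convI_le)
  show "(\<lambda>n. cnorm D (g n \<ominus>\<^bsub>D\<^esub> f n) + cnorm D (f n \<ominus>\<^bsub>D\<^esub> l)) \<longlonglongrightarrow> 0"
    using d convD(3)[OF f] by (intro tendsto_add_zero)
qed (auto intro!: g cnorm_diff_triangle convD(1)[OF f] convD(2)[OF f])

end

lemma finsum_additive:
  assumes D: "abelian_group D" "abelian_group D'"
    and h: "\<And>x. x \<in> carrier D \<Longrightarrow> h x \<in> carrier D'" "h \<zero>\<^bsub>D\<^esub> = \<zero>\<^bsub>D'\<^esub>"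
      "\<And>x y. \<lbrakk>x \<in> carrier D; y \<in> carrier D\<rbrakk> \<Longrightarrow> h (x \<oplus>\<^bsub>D\<^esub> y) = h x \<oplus>\<^bsub>D'\<^esub> h y"
    and f: "\<And>i. i \<in> I \<Longrightarrow> f i \<in> carrier D"
  shows "h (finsum D f I) = finsum D' (\<lambda>i. h (f i)) I"
proof -
  interpret D: abelian_group D by (rule D(1))
  interpret D': abelian_group D' by (rule D(2))
  show ?thesis
    using f
  proof (induction I rule: infinite_finite_induct)
    case (infinite I)
    then show ?case by (simp add: D.add.finprod_infinite D'.add.finprod_infinite finsum_def finprod_def h)
  next
    case empty
    then show ?case by (simp add: h)
  next
    case (insert i I)
    then show ?case
      by (simp add: Pi_def h D.finsum_closed)
  qed
qed

section \<open>Evaluating the free *-algebra in a C*-algebra\<close>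

locale free_eval = cstar_algebra D for D :: "('a, 'z) cstar_struct_scheme" (structure) +
  fixes G :: "'g set" and T :: "'g \<Rightarrow> 'a"
  assumes T_closed: "g \<in> G \<Longrightarrow> T g \<in> carrier D"
begin

definition ev_letter :: "'g \<times> bool \<Rightarrow> 'a" where
  "ev_letter l = (if snd l then star D (T (fst l)) else T (fst l))"

fun ev_list :: "('g \<times> bool) list \<Rightarrow> 'a" where
  "ev_list [] = \<zero>\<^bsub>D\<^esub>"
| "ev_list [l] = ev_letter l"
| "ev_list (l # m # ls) = ev_letter l \<otimes>\<^bsub>D\<^esub> ev_list (m # ls)"

definition ev :: "'g free_alg \<Rightarrow> 'a" where
  "ev a = finsum D (\<lambda>w. Poly_Mapping.lookup a w \<odot>\<^bsub>D\<^esub> ev_list (letters w)) (Poly_Mapping.keys a)"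

lemma ev_letter_closed: "fst l \<in> G \<Longrightarrow> ev_letter l \<in> carrier D"
  by (simp add: ev_letter_def T_closed star_closed)

lemma ev_list_closed: "fst ` set ls \<subseteq> G \<Longrightarrow> ev_list ls \<in> carrier D"
  by (induction ls rule: ev_list.induct) (auto intro: ev_letter_closed mult_closed)

lemma ev_list_Cons: "ls \<noteq> [] \<Longrightarrow> ev_list (l # ls) = ev_letter l \<otimes>\<^bsub>D\<^esub> ev_list ls"
  by (cases ls) auto

lemma ev_list_append:
  "\<lbrakk>us \<noteq> []; vs \<noteq> []; fst ` set us \<subseteq> G; fst ` set vs \<subseteq> G\<rbrakk> \<Longrightarrow> ev_list (us @ vs) = ev_list us \<otimes>\<^bsub>D\<^esub> ev_list vs"
proof (induction us rule: list_nonempty_induct)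
  case (single l)
  then show ?case by (simp add: ev_list_Cons)
next
  case (cons l us)
  then show ?case
    by (simp add: ev_list_Cons mult_assoc ev_letter_closed ev_list_closed)
qed

lemma ev_list_star:
  "\<lbrakk>ls \<noteq> []; fst ` set ls \<subseteq> G\<rbrakk> \<Longrightarrow> ev_list (rev (map (\<lambda>(g, b). (g, \<not> b)) ls)) = star D (ev_list ls)"
proof (induction ls rule: list_nonempty_induct)
  case (single l)
  then show ?case by (cases l) (auto simp: ev_letter_def star_star T_closed)
next
  case (cons l ls)
  have l: "ev_letter (case l of (g, b) \<Rightarrow> (g, \<not> b)) = star D (ev_letter l)"
    using cons by (cases l) (auto simp: ev_letter_def star_star T_closed)
  have "fst (case l of (g, b) \<Rightarrow> (g, \<not> b)) \<in> G" using cons by (cases l) auto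
  moreover have "fst ` set (rev (map (\<lambda>(g, b). (g, \<not> b)) ls)) \<subseteq> G" using cons by force
  ultimately show ?case
    using cons l by (simp add: ev_list_append ev_list_Cons star_mult ev_letter_closed ev_list_closed)
qed

lemma ev_word_closed: "w \<in> free_words G \<Longrightarrow> ev_list (letters w) \<in> carrier D"
  by (simp add: free_words_def ev_list_closed)

lemma ev_superset:
  assumes "finite K" "Poly_Mapping.keys a \<subseteq> K" "K \<subseteq> free_words G"
  shows "ev a = finsum D (\<lambda>w. Poly_Mapping.lookup a w \<odot>\<^bsub>D\<^esub> ev_list (letters w)) K"
  unfolding ev_def using assms
  by (intro M.add.finprod_mono_neutral_cong_left[folded finsum_def])
    (auto simp: in_keys_iff zero_smult ev_word_closed smult_in subset_iff)

lemma ev_closed: "a \<in> free_star_algebra G \<Longrightarrow> ev a \<in> carrier D"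
  unfolding ev_def free_star_algebra_def by (auto intro!: M.finsum_closed smult_in ev_word_closed)

lemma ev_zero: "ev 0 = \<zero>\<^bsub>D\<^esub>"
  by (simp add: ev_def)

lemma ev_add:
  assumes "a \<in> free_star_algebra G" "b \<in> free_star_algebra G" shows "ev (a + b) = ev a \<oplus>\<^bsub>D\<^esub> ev b"
proof -
  let ?K = "Poly_Mapping.keys a \<union> Poly_Mapping.keys b"
  have K: "finite ?K" "?K \<subseteq> free_words G" using assms by (auto simp: free_star_algebra_def)
  have w: "ev_list (letters w) \<in> carrier D" if "w \<in> ?K" for w using that K ev_word_closed by blast
  have "ev a \<oplus>\<^bsub>D\<^esub> ev b =
      finsum D (\<lambda>w. Poly_Mapping.lookup a w \<odot>\<^bsub>D\<^esub> ev_list (letters w) \<oplus>\<^bsub>D\<^esub>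
        Poly_Mapping.lookup b w \<odot>\<^bsub>D\<^esub> ev_list (letters w)) ?K"
    unfolding ev_superset[OF K(1) Un_upper1 K(2)] ev_superset[OF K(1) Un_upper2 K(2)]
    using w by (intro M.finsum_addf[symmetric] Pi_I smult_in)
  also have "\<dots> = finsum D (\<lambda>w. Poly_Mapping.lookup (a + b) w \<odot>\<^bsub>D\<^esub> ev_list (letters w)) ?K"
    using w by (intro M.finsum_cong' Pi_I) (simp_all add: lookup_add add_smult smult_in)
  also have "\<dots> = ev (a + b)" using K keys_add[of a b] by (intro ev_superset[symmetric])
  finally show ?thesis by simp
qed

lemma ev_single: "w \<in> free_words G \<Longrightarrow> ev (Poly_Mapping.single w c) = c \<odot>\<^bsub>D\<^esub> ev_list (letters w)"
  using ev_superset[of "{w}" "Poly_Mapping.single w c"] by (simp add: ev_word_closed smult_in)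

lemma ev_scale: assumes "a \<in> free_star_algebra G" shows "ev (free_scale c a) = c \<odot>\<^bsub>D\<^esub> ev a"
proof -
  have K: "Poly_Mapping.keys (free_scale c a) \<subseteq> Poly_Mapping.keys a" "Poly_Mapping.keys a \<subseteq> free_words G"
    using assms by (auto simp: in_keys_iff lookup_free_scale free_star_algebra_def)
  have w: "ev_list (letters w) \<in> carrier D" if "w \<in> Poly_Mapping.keys a" for w
    using that K ev_word_closed by blast
  have "c \<odot>\<^bsub>D\<^esub> ev a = finsum D (\<lambda>w. c \<odot>\<^bsub>D\<^esub> (Poly_Mapping.lookup a w \<odot>\<^bsub>D\<^esub> ev_list (letters w))) (Poly_Mapping.keys a)"
    unfolding ev_def using w
    by (intro finsum_additive[OF M.abelian_group_axioms M.abelian_group_axioms])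
      (auto simp: smult_in smult_zero smult_add)
  also have "\<dots> = finsum D (\<lambda>w. Poly_Mapping.lookup (free_scale c a) w \<odot>\<^bsub>D\<^esub> ev_list (letters w)) (Poly_Mapping.keys a)"
    using w by (intro M.finsum_cong') (auto simp: lookup_free_scale smult_smult smult_in)
  also have "\<dots> = ev (free_scale c a)" using K by (intro ev_superset[symmetric]) auto
  finally show ?thesis by simp
qed

lemma free_expand_induct [consumes 1, case_names zero add]:
  assumes a: "a \<in> free_star_algebra G" and zero: "P 0"
    and add: "\<And>w c a. \<lbrakk>w \<in> free_words G; a \<in> free_star_algebra G; P a\<rbrakk> \<Longrightarrow> P (Poly_Mapping.single w c + a)"
  shows "P a"
proof -
  have "P (\<Sum>w\<in>K. Poly_Mapping.single w (Poly_Mapping.lookup a w))" if "finite K" "K \<subseteq> free_words G" for K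
    using that
    by (induction K rule: finite_induct) (auto intro!: zero add free_sum_closed free_single_closed)
  from this[of "Poly_Mapping.keys a"] show ?thesis
    using a by (simp add: free_star_algebra_def free_alg_expand[symmetric])
qed

lemma ev_mult_single:
  assumes v: "v \<in> free_words G" and b: "b \<in> free_star_algebra G"
  shows "ev (Poly_Mapping.single v c * b) = ev (Poly_Mapping.single v c) \<otimes>\<^bsub>D\<^esub> ev b"
  using b
proof (induction b rule: free_expand_induct)
  case zero
  then show ?case by (simp add: ev_zero mult_zero_right ev_closed free_single_closed v)
next
  case (add w d b)
  have "ev (Poly_Mapping.single v c * Poly_Mapping.single w d) =
      ev (Poly_Mapping.single v c) \<otimes>\<^bsub>D\<^esub> ev (Poly_Mapping.single w d)"
    using v add(1)
    by (simp add: mult_single ev_single free_words_add smult_mult_left smult_mult_right ev_word_closed smult_in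
        smult_smult mult_closed)
      (simp add: plus_star_word_def free_words_def ev_list_append mult.commute)
  then show ?case
    using v add
    by (simp add: distrib_left ev_add free_mult_closed free_single_closed mult_distr ev_closed)
qed

lemma ev_mult:
  assumes a: "a \<in> free_star_algebra G" and b: "b \<in> free_star_algebra G"
  shows "ev (a * b) = ev a \<otimes>\<^bsub>D\<^esub> ev b"
  using a
proof (induction a rule: free_expand_induct)
  case zero
  then show ?case by (simp add: ev_zero mult_zero_left ev_closed b)
next
  case (add w d a)
  then show ?case
    by (simp add: distrib_right ev_add free_mult_closed free_single_closed mult_distl ev_closed b ev_mult_single)
qed

lemma ev_star:
  assumes a: "a \<in> free_star_algebra G" shows "ev (free_star a) = star D (ev a)"
  using a
proof (induction a rule: free_expand_induct)
  case zero
  then show ?case by (simp add: ev_zero star_zero free_star_zero)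
next
  case (add w d a)
  have "ev (free_star (Poly_Mapping.single w d)) = star D (ev (Poly_Mapping.single w d))"
    using add(1) by (simp add: free_star_single ev_single free_words_star star_smult ev_word_closed)
      (simp add: word_star_def free_words_def ev_list_star)
  then show ?case
    using add
    by (simp add: free_star_add ev_add free_single_closed star_add ev_closed free_star_closed)
qed

lemma ev_gen: "g \<in> G \<Longrightarrow> ev (free_gen g) = T g"
  unfolding free_gen_def by (subst ev_single) (auto simp: free_words_def ev_letter_def one_smult T_closed)

lemma ev_minus:
  assumes "a \<in> free_star_algebra G" "b \<in> free_star_algebra G" shows "ev (a - b) = ev a \<ominus>\<^bsub>D\<^esub> ev b"
proof -
  have eq: "a - b = a + free_scale (-1) b"
    by (rule poly_mapping_eqI) (simp add: lookup_add lookup_minus lookup_free_scale)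
  show ?thesis
    using assms by (simp add: eq ev_add ev_scale free_scale_closed diff_smult ev_closed)
qed

lemma ev_sum:
  assumes "\<And>i. i \<in> I \<Longrightarrow> f i \<in> free_star_algebra G"
  shows "ev (sum f I) = finsum D (\<lambda>i. ev (f i)) I"
  using assms
proof (induction I rule: infinite_finite_induct)
  case (insert i I)
  then show ?case by (simp add: ev_add free_sum_closed Pi_def ev_closed)
qed (auto simp: ev_zero finsum_def finprod_def)

lemma cstar_seminorm_ev: "cstar_seminorm (free_star_algebra G) free_scale free_star (\<lambda>a. cnorm D (ev a))"
  unfolding cstar_seminorm_def
  by (auto simp: ev_add ev_scale ev_mult ev_star free_star_closed ev_closed cnorm_smult cstar_identity
      intro: cnorm_nonneg cnorm_triangle cnorm_mult)

end


section \<open>The universal property\<close>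

context cat_functor
begin

lemma cstar_of_eq: "cstar_of E B F = univ.D"
  by (simp add: cstar_of_def)

lemma cstar_gen_eq: "cstar_gen E B F \<alpha> = univ.emb (free_gen \<alpha>)"
  by (simp add: cstar_gen_def univ.emb_def)

theorem cstar_algebra_cstar_of: "cstar_algebra (cstar_of E B F)"
  unfolding cstar_of_eq by (rule univ.cstar_algebra_D)

lemma emb_relator: assumes "a - b \<in> ck_relators E B F" "a \<in> A" "b \<in> A" shows "univ.emb a = univ.emb b"
  using assms by (simp add: univ.emb_eq_iff ck_norm_relator)

lemma emb_sum:
  assumes "\<And>i. i \<in> I \<Longrightarrow> f i \<in> A" shows "univ.emb (sum f I) = finsum univ.D (\<lambda>i. univ.emb (f i)) I"
proof -
  interpret abelian_group univ.D by (rule univ.abelian_group_D)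
  show ?thesis
    using assms
  proof (induction I rule: infinite_finite_induct)
    case (insert i I)
    then show ?case by (simp add: univ.emb_add free_sum_closed Pi_def univ.emb_closed)
  qed (auto simp: univ.emb_zero finsum_def finprod_def)
qed

theorem cuntz_krieger_system_cstar_of:
  "cuntz_krieger_system E B F (cstar_of E B F) (\<lambda>X. cstar_gen E B F (ident E X)) (cstar_gen E B F)"
proof -
  interpret C: cstar_algebra univ.D by (rule univ.cstar_algebra_D)
  let ?e = univ.emb and ?g = "free_gen :: _ \<Rightarrow> 'm1 free_alg"
  have g: "?g \<alpha> \<in> A" if "\<alpha> \<in> Mor E" for \<alpha> using that by (rule free_gen_closed)
  have gs: "free_star (?g \<alpha>) \<in> A" if "\<alpha> \<in> Mor E" for \<alpha> using that by (intro free_star_closed g)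
  have i: "ident E X \<in> Mor E" if "X \<in> Obj E" for X using that by (rule dom.ident_closed)
  have orth: "?e (?g (ident E X)) \<otimes>\<^bsub>univ.D\<^esub> ?e (?g (ident E Y)) = \<zero>\<^bsub>univ.D\<^esub>"
    if "X \<in> Obj E" "Y \<in> Obj E" "X \<noteq> Y" for X Y
  proof -
    have "?g (ident E X) * ?g (ident E Y) - 0 \<in> ck_relators E B F"
      unfolding ck_relators_def diff_zero using that by blast
    from emb_relator[OF this] show ?thesis using that
      by (simp add: g i free_mult_closed free_zero_closed univ.emb_mult univ.emb_zero)
  qed
  have mult: "?e (?g (\<alpha> \<cdot>\<^bsub>E\<^esub> \<beta>)) = ?e (?g \<alpha>) \<otimes>\<^bsub>univ.D\<^esub> ?e (?g \<beta>)"
    if "\<alpha> \<in> Mor E" "\<beta> \<in> Mor E" "src E \<alpha> = rng E \<beta>" for \<alpha> \<beta>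
  proof -
    have "?g (\<alpha> \<cdot>\<^bsub>E\<^esub> \<beta>) - ?g \<alpha> * ?g \<beta> \<in> ck_relators E B F"
      unfolding ck_relators_def using that by blast
    from emb_relator[OF this] show ?thesis using that
      by (simp add: g dom.comp_closed free_mult_closed univ.emb_mult)
  qed
  have self: "star univ.D (?e (?g (ident E X))) = ?e (?g (ident E X))" if "X \<in> Obj E" for X
  proof -
    have "free_star (?g (ident E X)) - ?g (ident E X) \<in> ck_relators E B F"
      unfolding ck_relators_def using that by blast
    from emb_relator[OF this] show ?thesis using that by (simp add: g gs i univ.emb_st)
  qed
  have src: "star univ.D (?e (?g \<alpha>)) \<otimes>\<^bsub>univ.D\<^esub> ?e (?g \<alpha>) = ?e (?g (ident E (src E \<alpha>)))"
    if "\<alpha> \<in> Mor E" for \<alpha>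
    using emb_relator[OF relator_source[OF that]] that
    by (simp add: g gs i dom.src_closed free_mult_closed univ.emb_mult univ.emb_st)
  have disj: "star univ.D (?e (?g \<beta>)) \<otimes>\<^bsub>univ.D\<^esub> ?e (?g \<alpha>) = \<zero>\<^bsub>univ.D\<^esub>"
    if "\<alpha> \<in> Mor E" "\<beta> \<in> Mor E" "fmor F \<alpha> = fmor F \<beta>" "\<alpha> \<noteq> \<beta>" for \<alpha> \<beta>
  proof -
    have "free_star (?g \<beta>) * ?g \<alpha> - 0 \<in> ck_relators E B F"
      unfolding ck_relators_def diff_zero using that by blast
    from emb_relator[OF this] show ?thesis using that
      by (simp add: g gs free_mult_closed free_zero_closed univ.emb_mult univ.emb_zero univ.emb_st)
  qed
  have sum: "finsum univ.D (\<lambda>\<alpha>. ?e (?g \<alpha>) \<otimes>\<^bsub>univ.D\<^esub> star univ.D (?e (?g \<alpha>))) (fibre E F X b) = ?e (?g (ident E X))"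
    if "X \<in> Obj E" "b \<in> Mor B" "rng B b = fobj F X" for X b
  proof -
    have m: "\<alpha> \<in> Mor E" if "\<alpha> \<in> fibre E F X b" for \<alpha> using that by (rule fibre_Mor)
    have "(\<Sum>\<alpha>\<in>fibre E F X b. ?g \<alpha> * free_star (?g \<alpha>)) - ?g (ident E X) \<in> ck_relators E B F"
      unfolding ck_relators_def using that by blast
    then have "?e (\<Sum>\<alpha>\<in>fibre E F X b. ?g \<alpha> * free_star (?g \<alpha>)) = ?e (?g (ident E X))"
      by (rule emb_relator) (use that m in \<open>auto intro!: free_sum_closed free_mult_closed g gs i\<close>)
    moreover have "?e (\<Sum>\<alpha>\<in>fibre E F X b. ?g \<alpha> * free_star (?g \<alpha>)) =
        finsum univ.D (\<lambda>\<alpha>. ?e (?g \<alpha> * free_star (?g \<alpha>))) (fibre E F X b)"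
      by (rule emb_sum) (use m in \<open>auto intro!: free_mult_closed g gs\<close>)
    moreover have "\<dots> = finsum univ.D (\<lambda>\<alpha>. ?e (?g \<alpha>) \<otimes>\<^bsub>univ.D\<^esub> star univ.D (?e (?g \<alpha>))) (fibre E F X b)"
      by (rule C.M.finsum_cong')
        (use m in \<open>auto simp: g gs univ.emb_mult univ.emb_st intro!: C.mult_closed C.star_closed univ.emb_closed\<close>)
    ultimately show ?thesis by simp
  qed
  have idem: "?e (?g (ident E X)) \<otimes>\<^bsub>univ.D\<^esub> ?e (?g (ident E X)) = ?e (?g (ident E X))" if "X \<in> Obj E" for X
    using src[OF i[OF that]] self[OF that] that by (simp add: dom.src_ident)
  have proj: "is_projection univ.D (?e (?g (ident E X)))" if "X \<in> Obj E" for X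
    using that by (simp add: is_projection_def self idem univ.emb_closed g i)
  have pi: "is_partial_isometry univ.D (?e (?g \<alpha>))" if a: "\<alpha> \<in> Mor E" for \<alpha>
  proof -
    have "?e (?g \<alpha>) \<otimes>\<^bsub>univ.D\<^esub> star univ.D (?e (?g \<alpha>)) \<otimes>\<^bsub>univ.D\<^esub> ?e (?g \<alpha>) =
        ?e (?g \<alpha>) \<otimes>\<^bsub>univ.D\<^esub> ?e (?g (ident E (src E \<alpha>)))"
      using a by (simp add: C.mult_assoc univ.emb_closed g C.star_closed src)
    also have "\<dots> = ?e (?g (\<alpha> \<cdot>\<^bsub>E\<^esub> ident E (src E \<alpha>)))"
      using a by (intro mult[symmetric]) (simp_all add: i dom.src_closed dom.rng_ident)
    finally show ?thesis using a by (simp add: is_partial_isometry_def univ.emb_closed g dom.ident_right)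
  qed
  show ?thesis
    unfolding cuntz_krieger_system_def cstar_of_eq cstar_gen_eq
    using orth mult self src disj sum proj pi by (intro conjI ballI impI) simp_all
qed

theorem cstar_of_generated:
  assumes H: "closed_star_subalgebra (cstar_of E B F) H" and gen: "\<And>\<alpha>. \<alpha> \<in> Mor E \<Longrightarrow> cstar_gen E B F \<alpha> \<in> H"
  shows "H = carrier (cstar_of E B F)"
proof
  show "H \<subseteq> carrier (cstar_of E B F)" using H by (simp add: closed_star_subalgebra_def)
  have H0: "\<zero>\<^bsub>univ.D\<^esub> \<in> H"
    using H unfolding closed_star_subalgebra_def cstar_of_eq by blast
  have H1: "x \<oplus>\<^bsub>univ.D\<^esub> y \<in> H" "x \<otimes>\<^bsub>univ.D\<^esub> y \<in> H" if "x \<in> H" "y \<in> H" for x y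
    using H that unfolding closed_star_subalgebra_def cstar_of_eq by blast+
  have H2: "star univ.D x \<in> H" "c \<odot>\<^bsub>univ.D\<^esub> x \<in> H" if "x \<in> H" for x c
    using H that unfolding closed_star_subalgebra_def cstar_of_eq by blast+
  have H3: "l \<in> H" if "\<And>n::nat. f n \<in> H" "l \<in> carrier univ.D"
    "(\<lambda>n. cnorm univ.D (f n \<ominus>\<^bsub>univ.D\<^esub> l)) \<longlonglongrightarrow> 0" for f l
    using H that unfolding closed_star_subalgebra_def cstar_of_eq by blast
  have emb: "univ.emb a \<in> H" if "a \<in> A" for a
    using that
  proof (induction a rule: free_star_algebra_induct)
    case zero
    show ?case using H0 by (simp add: univ.emb_zero)
  next
    case (gen \<alpha>)
    then show ?case using assms(2) by (simp add: cstar_gen_eq)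
  qed (simp_all add: univ.emb_add univ.emb_mult univ.emb_sc univ.emb_st H1 H2)
  show "carrier (cstar_of E B F) \<subseteq> H"
  proof
    fix U assume U: "U \<in> carrier (cstar_of E B F)"
    then obtain x where x: "x \<in> univ.Cs" "U = univ.cl x" unfolding cstar_of_eq by (rule univ.carrier_D_E)
    show "U \<in> H"
    proof (rule H3)
      show "univ.emb (x n) \<in> H" for n by (intro emb univ.Cs_A x(1))
      show "U \<in> carrier univ.D" using U by (simp add: cstar_of_eq)
      show "(\<lambda>n. cnorm univ.D (univ.emb (x n) \<ominus>\<^bsub>univ.D\<^esub> U)) \<longlonglongrightarrow> 0"
        unfolding x(2) by (rule univ.emb_dense[OF x(1)])
    qed
  qed
qed

text \<open>A *-homomorphism of C*-algebras is automatically norm-decreasing, so the norm condition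
  does not weaken the uniqueness claim; it is included so that no spectral theory is needed.\<close>

theorem cstar_of_universal:
  fixes D :: "('a, 'z) cstar_struct_scheme"
  assumes D: "cstar_algebra D" and QT: "cuntz_krieger_system E B F D Q T"
  shows "\<exists>!\<phi>. \<phi> \<in> extensional (carrier (cstar_of E B F)) \<and> star_hom (cstar_of E B F) D \<phi> \<and>
    (\<forall>x\<in>carrier (cstar_of E B F). cnorm D (\<phi> x) \<le> cnorm (cstar_of E B F) x) \<and>
    (\<forall>\<alpha>\<in>Mor E. \<phi> (cstar_gen E B F \<alpha>) = T \<alpha>)"
    (is "\<exists>!\<phi>. ?P \<phi>")
proof -
  note ck = QT[unfolded cuntz_krieger_system_def]
  note ck1 = ck[THEN conjunct1] and ck2 = ck[THEN conjunct2, THEN conjunct1]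
    and ck_rest = ck[THEN conjunct2, THEN conjunct2]
  note ck3 = ck_rest[THEN conjunct1] and ck_rest = ck_rest[THEN conjunct2]
  note ck4 = ck_rest[THEN conjunct1] and ck_rest = ck_rest[THEN conjunct2]
  note ck5 = ck_rest[THEN conjunct1] and ck_rest = ck_rest[THEN conjunct2]
  note ck6 = ck_rest[THEN conjunct1] and ck_rest = ck_rest[THEN conjunct2]
  note ck7 = ck_rest[THEN conjunct1] and ck8 = ck_rest[THEN conjunct2]
  have T: "T \<alpha> \<in> carrier D" if "\<alpha> \<in> Mor E" for \<alpha>
    using bspec[OF ck2 that] by (simp add: is_partial_isometry_def)
  have ident: "T (ident E X) = Q X" if "X \<in> Obj E" for X
    using bspec[OF ck5 that] by simp
  have Qc: "Q X \<in> carrier D" and Qs: "star D (Q X) = Q X" if "X \<in> Obj E" for X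
    using bspec[OF ck1 that] by (simp_all add: is_projection_def)
  have orth: "Q X \<otimes>\<^bsub>D\<^esub> Q Y = \<zero>\<^bsub>D\<^esub>" if "X \<in> Obj E" "Y \<in> Obj E" "X \<noteq> Y" for X Y
    using ck3 that by blast
  have mult: "T (\<alpha> \<cdot>\<^bsub>E\<^esub> \<beta>) = T \<alpha> \<otimes>\<^bsub>D\<^esub> T \<beta>" if "\<alpha> \<in> Mor E" "\<beta> \<in> Mor E" "src E \<alpha> = rng E \<beta>" for \<alpha> \<beta>
    using ck4 that by blast
  have source: "star D (T \<alpha>) \<otimes>\<^bsub>D\<^esub> T \<alpha> = Q (src E \<alpha>)" if "\<alpha> \<in> Mor E" for \<alpha>
    using ck6 that by blast
  have disj: "star D (T \<beta>) \<otimes>\<^bsub>D\<^esub> T \<alpha> = \<zero>\<^bsub>D\<^esub>"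
    if "\<alpha> \<in> Mor E" "\<beta> \<in> Mor E" "fmor F \<alpha> = fmor F \<beta>" "\<alpha> \<noteq> \<beta>" for \<alpha> \<beta>
    using ck7 that by blast
  have sum: "finsum D (\<lambda>\<alpha>. T \<alpha> \<otimes>\<^bsub>D\<^esub> star D (T \<alpha>)) (fibre E F X b) = Q X"
    if "X \<in> Obj E" "b \<in> Mor B" "rng B b = fobj F X" for X b
    using ck8 that by blast
  interpret D: cstar_algebra D by (rule D)
  interpret R: free_eval D "Mor E" T by unfold_locales (rule T)
  interpret C: cstar_algebra univ.D by (rule univ.cstar_algebra_D)
  note cl = free_gen_closed free_star_closed free_mult_closed free_sum_closed
    dom.ident_closed dom.src_closed dom.comp_closed
  have "R.ev a = \<zero>\<^bsub>D\<^esub>" if a: "a \<in> ck_relators E B F" for a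
  proof -
    have ss: "star D (T \<alpha>) \<in> carrier D" "T \<alpha> \<otimes>\<^bsub>D\<^esub> star D (T \<alpha>) \<in> carrier D" if "\<alpha> \<in> Mor E" for \<alpha>
      using T[OF that] by (auto intro: D.star_closed D.mult_closed)
    show ?thesis
      using a unfolding ck_relators_def
    proof (elim UnE CollectE exE conjE)
      fix X Y assume "X \<in> Obj E" "Y \<in> Obj E" "X \<noteq> Y" "a = free_gen (ident E X) * free_gen (ident E Y)"
      then show ?thesis by (simp add: cl R.ev_mult R.ev_gen ident orth)
    next
      fix \<alpha> \<beta> assume "\<alpha> \<in> Mor E" "\<beta> \<in> Mor E" "src E \<alpha> = rng E \<beta>"
        "a = free_gen (\<alpha> \<cdot>\<^bsub>E\<^esub> \<beta>) - free_gen \<alpha> * free_gen \<beta>"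
      then show ?thesis
        by (simp add: cl R.ev_mult R.ev_gen R.ev_minus D.diff_self D.mult_closed T mult)
    next
      fix X assume "X \<in> Obj E" "a = free_star (free_gen (ident E X)) - free_gen (ident E X)"
      then show ?thesis by (simp add: cl R.ev_star R.ev_gen R.ev_minus ident Qs D.diff_self Qc)
    next
      fix \<alpha> assume "\<alpha> \<in> Mor E" "a = free_star (free_gen \<alpha>) * free_gen \<alpha> - free_gen (ident E (src E \<alpha>))"
      then show ?thesis
        by (simp add: cl R.ev_star R.ev_mult R.ev_gen R.ev_minus ident source D.diff_self Qc)
    next
      fix \<alpha> \<beta> assume "\<alpha> \<in> Mor E" "\<beta> \<in> Mor E" "fmor F \<alpha> = fmor F \<beta>" "\<alpha> \<noteq> \<beta>"
        "a = free_star (free_gen \<beta>) * free_gen \<alpha>"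
      then show ?thesis by (simp add: cl R.ev_star R.ev_mult R.ev_gen disj)
    next
      fix X b assume X: "X \<in> Obj E" "b \<in> Mor B" "rng B b = fobj F X"
        and a: "a = (\<Sum>\<alpha>\<in>fibre E F X b. free_gen \<alpha> * free_star (free_gen \<alpha>)) - free_gen (ident E X)"
      have mem: "free_gen \<alpha> * free_star (free_gen \<alpha>) \<in> A" if "\<alpha> \<in> fibre E F X b" for \<alpha>
        by (intro free_mult_closed free_star_closed free_gen_closed fibre_Mor[OF that])
      have "R.ev (\<Sum>\<alpha>\<in>fibre E F X b. free_gen \<alpha> * free_star (free_gen \<alpha>)) =
          finsum D (\<lambda>\<alpha>. R.ev (free_gen \<alpha> * free_star (free_gen \<alpha>))) (fibre E F X b)"
        by (intro R.ev_sum mem)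
      also have "\<dots> = finsum D (\<lambda>\<alpha>. T \<alpha> \<otimes>\<^bsub>D\<^esub> star D (T \<alpha>)) (fibre E F X b)"
      proof (rule D.M.finsum_cong')
        show "(\<lambda>\<alpha>. T \<alpha> \<otimes>\<^bsub>D\<^esub> star D (T \<alpha>)) \<in> fibre E F X b \<rightarrow> carrier D"
          by (intro Pi_I ss fibre_Mor)
        show "R.ev (free_gen \<alpha> * free_star (free_gen \<alpha>)) = T \<alpha> \<otimes>\<^bsub>D\<^esub> star D (T \<alpha>)"
          if "\<alpha> \<in> fibre E F X b" for \<alpha>
          using fibre_Mor[OF that] by (simp add: cl R.ev_star R.ev_mult R.ev_gen)
      qed simp
      also have "\<dots> = Q X" using X by (intro sum)
      finally have e: "R.ev (\<Sum>\<alpha>\<in>fibre E F X b. free_gen \<alpha> * free_star (free_gen \<alpha>)) = Q X" .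
      have "(\<Sum>\<alpha>\<in>fibre E F X b. free_gen \<alpha> * free_star (free_gen \<alpha>)) \<in> A"
        by (intro free_sum_closed mem)
      then have "R.ev a = R.ev (\<Sum>\<alpha>\<in>fibre E F X b. free_gen \<alpha> * free_star (free_gen \<alpha>))
          \<ominus>\<^bsub>D\<^esub> R.ev (free_gen (ident E X))"
        unfolding a by (rule R.ev_minus) (intro free_gen_closed dom.ident_closed X(1))
      also have "\<dots> = Q X \<ominus>\<^bsub>D\<^esub> Q X"
        unfolding e R.ev_gen[OF dom.ident_closed[OF X(1)]] ident[OF X(1)] ..
      also have "\<dots> = \<zero>\<^bsub>D\<^esub>" by (rule D.diff_self[OF Qc[OF X(1)]])
      finally show ?thesis .
    qed
  qed
  then have "(\<lambda>a. cnorm D (R.ev a)) \<in> ck_seminorms E B F"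
    by (simp add: ck_seminorms_def R.cstar_seminorm_ev D.cnorm_zero)
  then have le: "cnorm D (R.ev a) \<le> ck_norm E B F a" if "a \<in> A" for a
    using ck_norm_upper[OF that] by blast
  have le_diff: "cnorm D (R.ev a \<ominus>\<^bsub>D\<^esub> R.ev b) \<le> ck_norm E B F (a - b)" if "a \<in> A" "b \<in> A" for a b
    using le[OF free_minus_closed[OF that]] that by (simp add: R.ev_minus)
  have ex: "\<exists>l. D.conv (\<lambda>n. R.ev (x n)) l" if x: "x \<in> univ.Cs" for x
  proof -
    have "\<exists>l\<in>carrier D. (\<lambda>n. cnorm D (R.ev (x n) \<ominus>\<^bsub>D\<^esub> l)) \<longlonglongrightarrow> 0"
    proof (rule D.complete)
      show "R.ev (x n) \<in> carrier D" for n using univ.Cs_A[OF x] by (rule R.ev_closed)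
      fix e :: real assume "0 < e"
      from univ.CsD[OF x this] show "\<exists>N. \<forall>m\<ge>N. \<forall>n\<ge>N. cnorm D (R.ev (x m) \<ominus>\<^bsub>D\<^esub> R.ev (x n)) < e"
        using le_diff univ.Cs_A[OF x] le_less_trans by meson
    qed
    then show ?thesis using univ.Cs_A[OF x] R.ev_closed unfolding D.conv_def by blast
  qed
  define \<phi> where "\<phi> = restrict (\<lambda>U. THE l. D.conv (\<lambda>n. R.ev (class_rep U n)) l) (carrier univ.D)"
  have \<phi>I: "\<phi> (univ.cl x) = l" if x: "x \<in> univ.Cs" and l: "D.conv (\<lambda>n. R.ev (x n)) l" for x l
  proof -
    let ?r = "class_rep (univ.cl x)"
    note r = univ.rep_cl[OF x]
    have "D.conv (\<lambda>n. R.ev (?r n)) l"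
    proof (rule D.conv_close[OF l])
      show "R.ev (?r n) \<in> carrier D" for n using univ.Cs_A[OF r(1)] by (rule R.ev_closed)
      have n: "univ.nul (\<lambda>n. ?r n - x n)"
        by (rule univ.nul_commute[OF _ _ r(2)]) (auto intro: univ.Cs_A r x)
      show "(\<lambda>n. cnorm D (R.ev (?r n) \<ominus>\<^bsub>D\<^esub> R.ev (x n))) \<longlonglongrightarrow> 0"
      proof (rule Lim_null_comparison[OF _ n[unfolded univ.nul_def]], rule always_eventually, rule allI)
        fix n
        have "cnorm D (R.ev (?r n) \<ominus>\<^bsub>D\<^esub> R.ev (x n)) \<le> ck_norm E B F (?r n - x n)"
          by (intro le_diff univ.Cs_A r x)
        then show "norm (cnorm D (R.ev (?r n) \<ominus>\<^bsub>D\<^esub> R.ev (x n))) \<le> ck_norm E B F (?r n - x n)"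
          using D.cnorm_nonneg[OF D.diff_closed[OF R.ev_closed R.ev_closed], of "?r n" "x n"]
            univ.Cs_A[OF r(1)] univ.Cs_A[OF x] by simp
      qed
    qed
    then have "(THE l. D.conv (\<lambda>n. R.ev (?r n)) l) = l" using D.conv_unique by blast
    then show ?thesis by (simp add: \<phi>_def univ.cl_closed x)
  qed
  have conv: "D.conv (\<lambda>n. R.ev (x n)) (\<phi> (univ.cl x))" if "x \<in> univ.Cs" for x
    using ex[OF that] \<phi>I[OF that] by metis
  note A = univ.Cs_A
  have P: "?P \<phi>"
    unfolding cstar_of_eq star_hom_def
  proof (intro conjI ballI allI funcsetI)
    show "\<phi> \<in> extensional (carrier univ.D)" by (simp add: \<phi>_def)
    fix U assume "U \<in> carrier univ.D"
    then obtain x where x: "x \<in> univ.Cs" "U = univ.cl x" by (rule univ.carrier_D_E)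
    show "\<phi> U \<in> carrier D" using D.convD(2)[OF conv[OF x(1)]] x by simp
    show "\<phi> (c \<odot>\<^bsub>univ.D\<^esub> U) = c \<odot>\<^bsub>D\<^esub> \<phi> U" for c
      using D.conv_smult[OF conv[OF x(1)], of c] x
      by (simp add: univ.smult_D) (rule \<phi>I, simp_all add: univ.Cs_sc R.ev_scale A)
    show "\<phi> (star univ.D U) = star D (\<phi> U)"
      using D.conv_star[OF conv[OF x(1)]] x
      by (simp add: univ.star_D) (rule \<phi>I, simp_all add: univ.Cs_st R.ev_star A)
    show "cnorm D (\<phi> U) \<le> cnorm univ.D U"
      unfolding x(2) using D.conv_cnorm[OF conv[OF x(1)]] univ.cnorm_D[OF x(1)]
      by (rule LIMSEQ_le) (use le A[OF x(1)] in blast)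
    fix V assume "V \<in> carrier univ.D"
    then obtain y where y: "y \<in> univ.Cs" "V = univ.cl y" by (rule univ.carrier_D_E)
    show "\<phi> (U \<oplus>\<^bsub>univ.D\<^esub> V) = \<phi> U \<oplus>\<^bsub>D\<^esub> \<phi> V"
      using D.conv_add[OF conv[OF x(1)] conv[OF y(1)]] x y
      by (simp add: univ.add_D) (rule \<phi>I, simp_all add: univ.Cs_add R.ev_add A)
    show "\<phi> (U \<otimes>\<^bsub>univ.D\<^esub> V) = \<phi> U \<otimes>\<^bsub>D\<^esub> \<phi> V"
      using D.conv_mult[OF conv[OF x(1)] conv[OF y(1)]] x y
      by (simp add: univ.mult_D) (rule \<phi>I, simp_all add: univ.Cs_mult R.ev_mult A)
  next
    fix \<alpha> assume a: "\<alpha> \<in> Mor E"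
    show "\<phi> (cstar_gen E B F \<alpha>) = T \<alpha>"
      unfolding cstar_gen_eq univ.emb_def
      using D.conv_const[OF T[OF a]] a by (intro \<phi>I) (simp_all add: univ.Cs_const free_gen_closed R.ev_gen)
  qed
  have unique: "\<psi> = \<phi>'" if 1: "?P \<psi>" and 2: "?P \<phi>'" for \<psi> \<phi>'
  proof -
    let ?H = "{x \<in> carrier univ.D. \<psi> x = \<phi>' x}"
    have hc: "h x \<in> carrier D" and hs: "h (c \<odot>\<^bsub>univ.D\<^esub> x) = c \<odot>\<^bsub>D\<^esub> h x"
      and hst: "h (star univ.D x) = star D (h x)" and hn: "cnorm D (h x) \<le> cnorm univ.D x"
      if "?P h" "x \<in> carrier univ.D" for h c x
      using that unfolding star_hom_def cstar_of_eq by blast+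
    have ha: "h (x \<oplus>\<^bsub>univ.D\<^esub> y) = h x \<oplus>\<^bsub>D\<^esub> h y" and hm: "h (x \<otimes>\<^bsub>univ.D\<^esub> y) = h x \<otimes>\<^bsub>D\<^esub> h y"
      if "?P h" "x \<in> carrier univ.D" "y \<in> carrier univ.D" for h x y
      using that unfolding star_hom_def cstar_of_eq by blast+
    have lim: "D.conv (\<lambda>n. h (f n)) (h l)"
      if h: "?P h" and f: "\<And>n. f n \<in> carrier univ.D" and l: "l \<in> carrier univ.D"
        and z: "(\<lambda>n. cnorm univ.D (f n \<ominus>\<^bsub>univ.D\<^esub> l)) \<longlonglongrightarrow> 0" for h f l
    proof (rule D.convI_le[OF _ _ _ z])
      show "h (f n) \<in> carrier D" "h l \<in> carrier D" for n by (intro hc h f l)+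
      have "h (f n \<ominus>\<^bsub>univ.D\<^esub> l) = h (f n) \<ominus>\<^bsub>D\<^esub> h l" for n
        by (simp only: C.diff_smult[OF f l] D.diff_smult[OF hc[OF h f] hc[OF h l]]
          ha[OF h f C.smult_in[OF l]] hs[OF h l])
      then show "cnorm D (h (f n) \<ominus>\<^bsub>D\<^esub> h l) \<le> cnorm univ.D (f n \<ominus>\<^bsub>univ.D\<^esub> l)" for n
        using hn[OF h C.diff_closed[OF f l], of n] by metis
    qed
    have zero: "h \<zero>\<^bsub>univ.D\<^esub> = \<zero>\<^bsub>D\<^esub>" if h: "?P h" for h
    proof -
      show ?thesis
        using hs[OF h C.M.zero_closed, of 0] hc[OF h C.M.zero_closed] by (simp add: C.smult_zero D.zero_smult)
    qed
    have "closed_star_subalgebra (cstar_of E B F) ?H"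
      unfolding closed_star_subalgebra_def cstar_of_eq
    proof (intro conjI allI impI ballI)
      fix f l assume a: "(\<forall>n::nat. f n \<in> ?H) \<and> l \<in> carrier univ.D \<and>
        (\<lambda>n. cnorm univ.D (f n \<ominus>\<^bsub>univ.D\<^esub> l)) \<longlonglongrightarrow> 0"
      then have f: "\<And>n. f n \<in> carrier univ.D" and l: "l \<in> carrier univ.D"
        and z: "(\<lambda>n. cnorm univ.D (f n \<ominus>\<^bsub>univ.D\<^esub> l)) \<longlonglongrightarrow> 0"
        and eq: "(\<lambda>n. \<psi> (f n)) = (\<lambda>n. \<phi>' (f n))" by auto
      have "\<psi> l = \<phi>' l"
        using lim[OF 1 f l z] lim[OF 2 f l z] unfolding eq by (rule D.conv_unique)
      then show "l \<in> ?H" using l by blast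
    next
      show "\<zero>\<^bsub>univ.D\<^esub> \<in> ?H" by (simp only: mem_Collect_eq zero[OF 1] zero[OF 2] C.M.zero_closed simp_thms)
    next
      fix x y assume "x \<in> ?H" "y \<in> ?H"
      then have x: "x \<in> carrier univ.D" "\<psi> x = \<phi>' x" and y: "y \<in> carrier univ.D" "\<psi> y = \<phi>' y" by blast+
      show "x \<oplus>\<^bsub>univ.D\<^esub> y \<in> ?H"
        by (simp only: mem_Collect_eq ha[OF 1 x(1) y(1)] ha[OF 2 x(1) y(1)] x y C.M.a_closed simp_thms)
      show "x \<otimes>\<^bsub>univ.D\<^esub> y \<in> ?H"
        by (simp only: mem_Collect_eq hm[OF 1 x(1) y(1)] hm[OF 2 x(1) y(1)] x y C.mult_closed simp_thms)
    next
      fix x c assume "x \<in> ?H"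
      then have x: "x \<in> carrier univ.D" "\<psi> x = \<phi>' x" by blast+
      show "star univ.D x \<in> ?H"
        by (simp only: mem_Collect_eq hst[OF 1 x(1)] hst[OF 2 x(1)] x C.star_closed simp_thms)
      show "c \<odot>\<^bsub>univ.D\<^esub> x \<in> ?H"
        by (simp only: mem_Collect_eq hs[OF 1 x(1)] hs[OF 2 x(1)] x C.smult_in simp_thms)
    qed blast
    moreover have "cstar_gen E B F \<alpha> \<in> ?H" if "\<alpha> \<in> Mor E" for \<alpha>
    proof -
      have "\<psi> (cstar_gen E B F \<alpha>) = T \<alpha>" "\<phi>' (cstar_gen E B F \<alpha>) = T \<alpha>" using that 1 2 by blast+
      then show ?thesis using that by (simp add: cstar_gen_eq univ.emb_closed free_gen_closed)
    qed
    ultimately have "?H = carrier (cstar_of E B F)" by (rule cstar_of_generated)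
    then have "\<psi> x = \<phi>' x" if "x \<in> carrier (cstar_of E B F)" for x using that by blast
    moreover have "\<psi> \<in> extensional (carrier (cstar_of E B F))" "\<phi>' \<in> extensional (carrier (cstar_of E B F))"
      using 1 2 by blast+
    ultimately show ?thesis by (intro extensionalityI[of _ "carrier (cstar_of E B F)"])
  qed
  show ?thesis by (rule ex1I[of ?P, OF P]) (rule unique[OF _ P])
qed

end

end

theory Submission
  imports Defs
begin

text \<open>The norm of \<open>C\<^sup>*(F)\<close> is the largest C*-seminorm on the free *-algebra that kills the
  Cuntz-Krieger relators, so it suffices to produce one such seminorm that does not vanish on the
  generator \<open>Id\<^sub>X\<close> of some object \<open>X\<close>. It comes from a representation on infinite paths.

  An infinite path at \<open>X\<close> is a coherent choice of lifts \<open>x(b)\<close> with range \<open>X\<close> of all morphisms \<open>b\<close>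
  with range \<open>F(X)\<close>; equivalently, a functorial section of \<open>\<E>/X \<rightarrow> \<B>/F(X)\<close>. Local splitting says
  exactly that there is a path at every object (\<open>path_exists\<close>). A morphism \<open>\<alpha>: Y \<rightarrow> X\<close> transports a
  path \<open>y\<close> at \<open>Y\<close> to the path \<open>\<alpha>y\<close> at \<open>X\<close> determined by \<open>(\<alpha>y)(F(\<alpha>)c) = \<alpha> y(c)\<close>. This prescribes
  \<open>\<alpha>y\<close> only on multiples of \<open>F(\<alpha>)\<close>. For an arbitrary \<open>m\<close> the Ore condition gives \<open>mp = F(\<alpha>)q\<close>, and
  \<open>(\<alpha>y)(m)\<close> has to be the first factor in the factorization of \<open>\<alpha> y(q)\<close> over \<open>mp\<close>; the strong Ore
  condition makes it independent of \<open>p\<close> and \<open>q\<close> (\<open>act_prefix\<close>). Conversely a path \<open>x\<close> with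
  \<open>x(F(\<alpha>)) = \<alpha>\<close> can be shortened by \<open>\<alpha>\<close> (\<open>act_shift\<close>). Hence \<open>\<alpha>\<close> acts as a bijection from the
  paths at \<open>Y\<close> onto the paths \<open>x\<close> at \<open>X\<close> with \<open>x(F(\<alpha>)) = \<alpha>\<close>. The Cuntz-Krieger relations are
  read off from this (\<open>rep_relator\<close>): for fixed \<open>X\<close> and \<open>b\<close>, each path \<open>x\<close> at \<open>X\<close> lies in the image of
  exactly one \<open>\<alpha>\<close> over \<open>b\<close>, namely \<open>\<alpha> = x(b)\<close>.

  Partial bijections of a set and their inverses act on the finitely supported functions on it by
  contractions that are adjoint to each other. The operator norm of a representation by bounded
  adjointable operators satisfies the C*-identity already on an inner product space
  (\<open>cstar_seminorm_op_seminorm\<close>), so no Hilbert space has to be completed. Finally \<open>Id\<^sub>X\<close> fixes the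
  delta function of any path at \<open>X\<close>, so its seminorm is not zero.\<close>


section \<open>Finitely supported functions\<close>

definition finsupp :: "('p \<Rightarrow> complex) set" where
  "finsupp = {f. finite {x. f x \<noteq> 0}}"

definition fnorm :: "('p \<Rightarrow> complex) \<Rightarrow> real" where
  "fnorm f = L2_set (\<lambda>x. cmod (f x)) {x. f x \<noteq> 0}"

definition finner :: "('p \<Rightarrow> complex) \<Rightarrow> ('p \<Rightarrow> complex) \<Rightarrow> complex" where
  "finner f g = (\<Sum>x | f x \<noteq> 0. f x * cnj (g x))"

lemma finsupp_scaled: "f \<in> finsupp \<Longrightarrow> (\<lambda>x. c * f x) \<in> finsupp"
  unfolding finsupp_def by (auto elim!: rev_finite_subset)

lemma finsupp_sum:
  assumes "\<And>i. i \<in> I \<Longrightarrow> f i \<in> finsupp"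
  shows "(\<lambda>x. \<Sum>i\<in>I. f i x) \<in> finsupp"
proof (cases "finite I")
  case True
  have "{x. (\<Sum>i\<in>I. f i x) \<noteq> 0} \<subseteq> (\<Union>i\<in>I. {x. f i x \<noteq> 0})"
    by (auto intro: ccontr sum.neutral)
  with True assms show ?thesis
    by (auto simp: finsupp_def intro: finite_subset[of _ "\<Union>i\<in>I. {x. f i x \<noteq> 0}"])
qed (simp add: finsupp_def)

lemma fnorm_superset:
  assumes "finite S" "{x. f x \<noteq> 0} \<subseteq> S"
  shows "fnorm f = L2_set (\<lambda>x. cmod (f x)) S"
  unfolding fnorm_def L2_set_def
  by (rule arg_cong[where f = sqrt], rule sum.mono_neutral_left) (use assms in auto)

lemma finner_superset:
  assumes "finite S" "{x. f x \<noteq> 0} \<subseteq> S"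
  shows "finner f g = (\<Sum>x\<in>S. f x * cnj (g x))"
  unfolding finner_def by (rule sum.mono_neutral_left) (use assms in auto)

lemma fnorm_nonneg: "0 \<le> fnorm f"
  by (simp add: fnorm_def)

lemma fnorm_zero: "fnorm (\<lambda>x. 0) = 0"
  by (simp add: fnorm_def)

lemma fnorm_eq_0: "f \<in> finsupp \<Longrightarrow> fnorm f = 0 \<longleftrightarrow> f = (\<lambda>x. 0)"
  by (auto simp: fnorm_def finsupp_def L2_set_eq_0_iff)

lemma fnorm_scaled:
  assumes "f \<in> finsupp"
  shows "fnorm (\<lambda>x. c * f x) = cmod c * fnorm f"
proof -
  have "fnorm (\<lambda>x. c * f x) = L2_set (\<lambda>x. cmod c * cmod (f x)) {x. f x \<noteq> 0}"
    using assms by (subst fnorm_superset[of "{x. f x \<noteq> 0}"]) (auto simp: finsupp_def norm_mult)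
  then show ?thesis by (simp add: L2_set_right_distrib fnorm_def)
qed

lemma fnorm_add:
  assumes "f \<in> finsupp" "g \<in> finsupp"
  shows "fnorm (\<lambda>x. f x + g x) \<le> fnorm f + fnorm g"
proof -
  define S where "S = {x. f x \<noteq> 0} \<union> {x. g x \<noteq> 0}"
  have S: "finite S" using assms by (simp add: S_def finsupp_def)
  have "fnorm (\<lambda>x. f x + g x) = L2_set (\<lambda>x. cmod (f x + g x)) S"
    by (rule fnorm_superset[OF S]) (auto simp: S_def)
  also have "\<dots> \<le> L2_set (\<lambda>x. cmod (f x) + cmod (g x)) S"
    by (rule L2_set_mono) (auto simp: norm_triangle_ineq)
  also have "\<dots> \<le> L2_set (\<lambda>x. cmod (f x)) S + L2_set (\<lambda>x. cmod (g x)) S"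
    by (rule L2_set_triangle_ineq)
  also have "\<dots> = fnorm f + fnorm g"
    by (subst (1 2) fnorm_superset[OF S]) (auto simp: S_def)
  finally show ?thesis .
qed

lemma fnorm_sum:
  assumes "\<And>i. i \<in> I \<Longrightarrow> f i \<in> finsupp"
  shows "fnorm (\<lambda>x. \<Sum>i\<in>I. f i x) \<le> (\<Sum>i\<in>I. fnorm (f i))"
  using assms
proof (induction I rule: infinite_finite_induct)
  case (insert i I)
  have "fnorm (\<lambda>x. f i x + (\<Sum>i\<in>I. f i x)) \<le> fnorm (f i) + fnorm (\<lambda>x. \<Sum>i\<in>I. f i x)"
    using insert.prems by (intro fnorm_add finsupp_sum) auto
  with insert show ?case by auto
qed (simp_all add: fnorm_zero)

lemma finner_self: "finner f f = of_real ((fnorm f)\<^sup>2)"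
  by (simp add: finner_def fnorm_def L2_set_def sum_nonneg complex_norm_square del: of_real_power)

lemma finner_sum:
  assumes "\<And>i. i \<in> I \<Longrightarrow> f i \<in> finsupp" "finite I"
  shows "finner (\<lambda>x. \<Sum>i\<in>I. c i * f i x) g = (\<Sum>i\<in>I. c i * finner (f i) g)"
proof -
  define S where "S = (\<Union>i\<in>I. {x. f i x \<noteq> 0})"
  have S: "finite S" using assms by (auto simp: S_def finsupp_def)
  have "finner (\<lambda>x. \<Sum>i\<in>I. c i * f i x) g = (\<Sum>x\<in>S. (\<Sum>i\<in>I. c i * f i x) * cnj (g x))"
    by (rule finner_superset[OF S]) (auto simp: S_def intro: ccontr sum.neutral)
  also have "\<dots> = (\<Sum>i\<in>I. c i * (\<Sum>x\<in>S. f i x * cnj (g x)))"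
    unfolding sum_distrib_left sum_distrib_right by (subst sum.swap) (simp add: mult.assoc)
  also have "\<dots> = (\<Sum>i\<in>I. c i * finner (f i) g)"
    by (intro sum.cong refl, subst finner_superset[OF S]) (auto simp: S_def)
  finally show ?thesis .
qed

lemma finner_commute:
  assumes "f \<in> finsupp" "g \<in> finsupp"
  shows "finner g f = cnj (finner f g)"
proof -
  define S where "S = {x. f x \<noteq> 0} \<union> {x. g x \<noteq> 0}"
  have S: "finite S" using assms by (simp add: S_def finsupp_def)
  have "finner g f = (\<Sum>x\<in>S. g x * cnj (f x))" "finner f g = (\<Sum>x\<in>S. f x * cnj (g x))"
    by (rule finner_superset[OF S]; auto simp: S_def)+
  then show ?thesis by (simp add: mult.commute)
qed

lemma finner_Cauchy_Schwarz:
  assumes "f \<in> finsupp" "g \<in> finsupp"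
  shows "cmod (finner f g) \<le> fnorm f * fnorm g"
proof -
  define S where "S = {x. f x \<noteq> 0} \<union> {x. g x \<noteq> 0}"
  have S: "finite S" using assms by (simp add: S_def finsupp_def)
  have "finner f g = (\<Sum>x\<in>S. f x * cnj (g x))"
    by (rule finner_superset[OF S]) (auto simp: S_def)
  then have "cmod (finner f g) \<le> (\<Sum>x\<in>S. \<bar>cmod (f x)\<bar> * \<bar>cmod (g x)\<bar>)"
    by (simp add: sum_norm_le norm_mult)
  also have "\<dots> \<le> L2_set (\<lambda>x. cmod (f x)) S * L2_set (\<lambda>x. cmod (g x)) S"
    by (rule L2_set_mult_ineq)
  also have "\<dots> = fnorm f * fnorm g"
    by (subst (1 2) fnorm_superset[OF S]) (auto simp: S_def)
  finally show ?thesis .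
qed


section \<open>Operators induced by partial bijections\<close>

text \<open>The operator with matrix \<open>R\<close>. If \<open>R\<close> is single-valued then the sum has at most one term, and
  \<open>pull R f\<close> is \<open>f\<close> composed with the partial function \<open>R\<close>, extended by zero.\<close>

definition pull :: "'p rel \<Rightarrow> ('p \<Rightarrow> complex) \<Rightarrow> 'p \<Rightarrow> complex" where
  "pull R f x = (\<Sum>y\<in>R `` {x}. f y)"

definition partial_bijection :: "'p rel \<Rightarrow> bool" where
  "partial_bijection R \<longleftrightarrow> single_valued R \<and> single_valued (R\<inverse>)"

lemma pull_eq: "\<lbrakk>single_valued R; (x, y) \<in> R\<rbrakk> \<Longrightarrow> pull R f x = f y"
proof -
  assume "single_valued R" "(x, y) \<in> R"
  then have "R `` {x} = {y}" by (auto dest: single_valuedD)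
  then show ?thesis by (simp add: pull_def)
qed

lemma pull_outside: "x \<notin> Domain R \<Longrightarrow> pull R f x = 0"
proof -
  assume "x \<notin> Domain R"
  then have "R `` {x} = {}" by auto
  then show ?thesis by (simp add: pull_def)
qed

lemma pull_linear: "pull R (\<lambda>x. \<Sum>i\<in>I. c i * f i x) = (\<lambda>x. \<Sum>i\<in>I. c i * pull R (f i) x)"
  unfolding pull_def sum_distrib_left by (subst sum.swap) simp

lemma pull_relcomp:
  assumes "single_valued R" "single_valued S"
  shows "pull (R O S) f = pull R (pull S f)"
proof
  fix x
  have RS: "single_valued (R O S)" using assms by (rule single_valued_relcomp)
  show "pull (R O S) f x = pull R (pull S f) x"
  proof (cases "x \<in> Domain R")
    case True
    then obtain y where y: "(x, y) \<in> R" by blast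
    show ?thesis
    proof (cases "y \<in> Domain S")
      case True
      then obtain z where "(y, z) \<in> S" by blast
      with y show ?thesis
        by (metis pull_eq RS assms relcompI)
    next
      case False
      have "x \<notin> Domain (R O S)" using False y assms(1) by (auto dest: single_valuedD)
      then show ?thesis using y False by (simp add: pull_outside pull_eq[OF assms(1) y])
    qed
  next
    case False
    then have "x \<notin> Domain (R O S)" by auto
    with False show ?thesis by (simp add: pull_outside)
  qed
qed

lemma pull_support: "{x. pull R f x \<noteq> 0} \<subseteq> R\<inverse> `` {y. f y \<noteq> 0}"
proof
  fix x assume "x \<in> {x. pull R f x \<noteq> 0}"
  then obtain y where "y \<in> R `` {x}" "f y \<noteq> 0"
    unfolding pull_def mem_Collect_eq by (rule sum.not_neutral_contains_not_neutral)
  then show "x \<in> R\<inverse> `` {y. f y \<noteq> 0}" by blast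
qed

lemma finite_Image_single_valued: "\<lbrakk>single_valued R; finite S\<rbrakk> \<Longrightarrow> finite (R `` S)"
proof -
  assume R: "single_valued R" and S: "finite S"
  have "R `` S \<subseteq> (\<lambda>x. THE y. (x, y) \<in> R) ` S"
  proof
    fix y assume "y \<in> R `` S"
    then obtain x where x: "x \<in> S" "(x, y) \<in> R" by blast
    then have "(THE y. (x, y) \<in> R) = y" using R by (auto dest: single_valuedD)
    with x show "y \<in> (\<lambda>x. THE y. (x, y) \<in> R) ` S" by blast
  qed
  then show ?thesis using S by (rule finite_surj[rotated])
qed

lemma pull_finsupp: "\<lbrakk>partial_bijection R; f \<in> finsupp\<rbrakk> \<Longrightarrow> pull R f \<in> finsupp"
  unfolding finsupp_def partial_bijection_def
  using pull_support[of R f] finite_Image_single_valued[of "R\<inverse>"] by (auto intro: finite_subset)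

text \<open>Summing over a superset of the support of \<open>f\<close>, which does not depend on \<open>x\<close>, makes it possible
  to interchange sums in the next lemma.\<close>

lemma pull_expand:
  assumes "single_valued R" "finite S" "{y. f y \<noteq> 0} \<subseteq> S"
  shows "pull R f x = (\<Sum>y\<in>S. if (x, y) \<in> R then f y else 0)"
proof -
  have fin: "finite (R `` {x})" using assms(1) by (intro finite_Image_single_valued) auto
  have "(\<Sum>y\<in>S. if (x, y) \<in> R then f y else 0) = (\<Sum>y\<in>S \<union> R `` {x}. if (x, y) \<in> R then f y else 0)"
    using assms fin by (intro sum.mono_neutral_left) auto
  also have "\<dots> = (\<Sum>y\<in>R `` {x}. if (x, y) \<in> R then f y else 0)"
    using assms fin by (intro sum.mono_neutral_right) auto
  also have "\<dots> = pull R f x" by (auto simp: pull_def intro: sum.cong)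
  finally show ?thesis ..
qed

lemma pull_adjoint:
  assumes R: "partial_bijection R" and f: "f \<in> finsupp" and g: "g \<in> finsupp"
  shows "finner (pull R f) g = finner f (pull (R\<inverse>) g)"
proof -
  define S where "S = {y. f y \<noteq> 0}"
  define T where "T = {x. g x \<noteq> 0} \<union> {x. pull R f x \<noteq> 0}"
  have S: "finite S" "{y. f y \<noteq> 0} \<subseteq> S" using f by (auto simp: S_def finsupp_def)
  have T: "finite T" "{x. pull R f x \<noteq> 0} \<subseteq> T" "{x. g x \<noteq> 0} \<subseteq> T"
    using g pull_finsupp[OF R f] by (auto simp: T_def finsupp_def)
  have R': "single_valued R" "single_valued (R\<inverse>)" using R by (auto simp: partial_bijection_def)
  have "finner (pull R f) g = (\<Sum>x\<in>T. \<Sum>y\<in>S. if (x, y) \<in> R then f y * cnj (g x) else 0)"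
    unfolding finner_superset[OF T(1,2)] pull_expand[OF R'(1) S] sum_distrib_right
    by (intro sum.cong refl) auto
  also have "\<dots> = (\<Sum>y\<in>S. \<Sum>x\<in>T. if (x, y) \<in> R then f y * cnj (g x) else 0)"
    by (rule sum.swap)
  also have "\<dots> = finner f (pull (R\<inverse>) g)"
    unfolding finner_superset[OF S] pull_expand[OF R'(2) T(1,3)] cnj_sum sum_distrib_left
    by (intro sum.cong refl) auto
  finally show ?thesis .
qed

text \<open>The values of \<open>pull R f\<close> on its support are values of \<open>f\<close> at distinct points, since the
  converse of \<open>R\<close> is single-valued too.\<close>

lemma fnorm_pull_le:
  assumes R: "partial_bijection R" and f: "f \<in> finsupp"
  shows "fnorm (pull R f) \<le> fnorm f"
proof -
  define S where "S = {x. pull R f x \<noteq> 0}"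
  define h where "h x = (THE y. (x, y) \<in> R)" for x
  have R': "single_valued R" "single_valued (R\<inverse>)" using R by (auto simp: partial_bijection_def)
  have h: "(x, h x) \<in> R" if "x \<in> S" for x
  proof -
    have "x \<in> Domain R" using that pull_outside[of x R f] by (auto simp: S_def)
    then obtain y where y: "(x, y) \<in> R" by blast
    then have "h x = y" unfolding h_def using R'(1) by (auto dest: single_valuedD)
    with y show ?thesis by simp
  qed
  have fh: "pull R f x = f (h x)" if "x \<in> S" for x by (rule pull_eq[OF R'(1) h[OF that]])
  have inj: "inj_on h S" using h R'(2) by (auto simp: inj_on_def dest: single_valuedD) (metis converseI single_valuedD)
  have "(\<Sum>x\<in>S. (cmod (pull R f x))\<^sup>2) = (\<Sum>x\<in>S. (cmod (f (h x)))\<^sup>2)"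
    by (simp add: fh)
  also have "\<dots> = (\<Sum>y\<in>h ` S. (cmod (f y))\<^sup>2)" by (simp add: sum.reindex[OF inj])
  also have "\<dots> \<le> (\<Sum>y | f y \<noteq> 0. (cmod (f y))\<^sup>2)"
    using f fh by (intro sum_mono2) (auto simp: finsupp_def S_def)
  finally show ?thesis by (simp add: fnorm_def L2_set_def S_def)
qed

lemma partial_bijection_Id: "partial_bijection Id"
  and partial_bijection_converse: "partial_bijection R \<Longrightarrow> partial_bijection (R\<inverse>)"
  and partial_bijection_relcomp:
    "\<lbrakk>partial_bijection R; partial_bijection S\<rbrakk> \<Longrightarrow> partial_bijection (R O S)"
  by (auto simp: partial_bijection_def converse_relcomp single_valued_relcomp)


lemma pull_Id_on: "pull (Id_on S) f x = (if x \<in> S then f x else 0)"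
proof (cases "x \<in> S")
  case True
  then have "pull (Id_on S) f x = f x" by (intro pull_eq) (auto simp: single_valued_def)
  with True show ?thesis by simp
qed (simp add: pull_outside)

lemma converse_relcomp_self: "single_valued R \<Longrightarrow> R\<inverse> O R = Id_on (Range R)"
  by (auto dest: single_valuedD)


section \<open>The C*-seminorm of a family of partial bijections\<close>

locale partial_bijections =
  fixes R :: "'g \<Rightarrow> 'p rel"
  assumes bij: "partial_bijection (R g)"
begin

text \<open>Products of letters become composed relations, and the adjoint of a letter becomes the
  converse relation.\<close>

definition letter_rel :: "'g \<times> bool \<Rightarrow> 'p rel" where
  "letter_rel l = (if snd l then (R (fst l))\<inverse> else R (fst l))"

definition word_rel :: "'g star_word \<Rightarrow> 'p rel" where
  "word_rel w = foldr (\<lambda>l. (O) (letter_rel l)) (letters w) Id"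

lemma word_rel_add: "word_rel (v + w) = word_rel v O word_rel w"
proof -
  have "foldr (\<lambda>l. (O) (letter_rel l)) ls (word_rel w) =
      foldr (\<lambda>l. (O) (letter_rel l)) ls Id O word_rel w" for ls
    by (induction ls) (simp_all add: O_assoc)
  then show ?thesis by (simp add: word_rel_def plus_star_word_def)
qed

lemma word_rel_letter: "word_rel (Word [l]) = letter_rel l"
  by (simp add: word_rel_def)

lemma word_rel_star: "word_rel (word_star w) = (word_rel w)\<inverse>"
proof -
  have "word_rel (word_star (Word ls)) = (word_rel (Word ls))\<inverse>" for ls
  proof (induction ls)
    case Nil
    show ?case by (simp add: word_rel_def word_star_def)
  next
    case (Cons l ls)
    have W: "Word (l # ls) = Word [l] + Word ls" by (simp add: plus_star_word_def)
    have "word_rel (word_star (Word [l])) = (letter_rel l)\<inverse>"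
      by (auto simp: word_star_def word_rel_def letter_rel_def split_def)
    then show ?case
      unfolding W word_star_add word_rel_add Cons word_rel_letter converse_relcomp by simp
  qed
  from this[of "letters w"] show ?thesis by simp
qed

lemma word_rel_bij: "partial_bijection (word_rel w)"
proof -
  have "partial_bijection (foldr (\<lambda>l. (O) (letter_rel l)) ls Id)" for ls
    by (induction ls)
      (auto intro: partial_bijection_Id partial_bijection_relcomp simp: letter_rel_def bij
        partial_bijection_converse)
  then show ?thesis by (simp add: word_rel_def)
qed

lemma word_rel_single_valued: "single_valued (word_rel w)"
  using word_rel_bij by (simp add: partial_bijection_def)

definition rep :: "'g free_alg \<Rightarrow> ('p \<Rightarrow> complex) \<Rightarrow> 'p \<Rightarrow> complex" where
  "rep a f x = (\<Sum>w\<in>Poly_Mapping.keys a. Poly_Mapping.lookup a w * pull (word_rel w) f x)"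

lemma rep_superset:
  assumes "finite K" "Poly_Mapping.keys a \<subseteq> K"
  shows "rep a f x = (\<Sum>w\<in>K. Poly_Mapping.lookup a w * pull (word_rel w) f x)"
  unfolding rep_def by (rule sum.mono_neutral_left) (use assms in \<open>auto simp: in_keys_iff\<close>)

lemma rep_zero: "rep 0 f = (\<lambda>x. 0)"
  by (simp add: rep_def fun_eq_iff)

lemma rep_add: "rep (a + b) f = (\<lambda>x. rep a f x + rep b f x)"
proof
  fix x
  let ?K = "Poly_Mapping.keys a \<union> Poly_Mapping.keys b"
  have "rep c f x = (\<Sum>w\<in>?K. Poly_Mapping.lookup c w * pull (word_rel w) f x)"
    if "Poly_Mapping.keys c \<subseteq> ?K" for c using that by (intro rep_superset) auto
  then show "rep (a + b) f x = rep a f x + rep b f x"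
    by (simp add: Poly_Mapping.keys_add lookup_add sum.distrib algebra_simps)
qed

lemma rep_sum: "rep (\<Sum>i\<in>I. a i) f = (\<lambda>x. \<Sum>i\<in>I. rep (a i) f x)"
  by (induction I rule: infinite_finite_induct) (simp_all add: rep_zero rep_add)

lemma rep_single: "rep (Poly_Mapping.single w c) f = (\<lambda>x. c * pull (word_rel w) f x)"
  by (cases "c = 0") (simp_all add: rep_def fun_eq_iff)

lemma rep_scale: "rep (free_scale c a) f = (\<lambda>x. c * rep a f x)"
proof
  fix x
  have "rep (free_scale c a) f x =
      (\<Sum>w\<in>Poly_Mapping.keys a. Poly_Mapping.lookup (free_scale c a) w * pull (word_rel w) f x)"
    by (intro rep_superset) (auto simp: in_keys_iff lookup_free_scale)
  then show "rep (free_scale c a) f x = c * rep a f x"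
    by (simp add: lookup_free_scale rep_def sum_distrib_left mult.assoc)
qed

lemma rep_minus: "rep (a - b) f = (\<lambda>x. rep a f x - rep b f x)"
  using rep_add[of "a - b" b f] by (simp add: fun_eq_iff algebra_simps)

lemma rep_mult: "rep (a * b) f = rep a (rep b f)"
proof -
  let ?s = "\<lambda>a w. Poly_Mapping.single w (Poly_Mapping.lookup a w)"
  have "rep (a * b) f = rep ((\<Sum>v\<in>Poly_Mapping.keys a. ?s a v) * (\<Sum>w\<in>Poly_Mapping.keys b. ?s b w)) f"
    by (simp add: free_alg_expand[symmetric])
  also have "\<dots> = (\<lambda>x. \<Sum>v\<in>Poly_Mapping.keys a. \<Sum>w\<in>Poly_Mapping.keys b.
      Poly_Mapping.lookup a v * Poly_Mapping.lookup b w * pull (word_rel v) (pull (word_rel w) f) x)"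
    by (simp add: sum_product mult_single rep_sum rep_single word_rel_add
        pull_relcomp[OF word_rel_single_valued word_rel_single_valued])
  also have "\<dots> = rep a (rep b f)"
  proof -
    have "rep b f = (\<lambda>x. \<Sum>w\<in>Poly_Mapping.keys b. Poly_Mapping.lookup b w * pull (word_rel w) f x)"
      by (simp add: rep_def fun_eq_iff)
    then show ?thesis
      by (intro ext) (simp add: rep_def[of a] pull_linear sum_distrib_left mult.assoc)
  qed
  finally show ?thesis .
qed

lemma rep_gen: "rep (free_gen g) f = pull (R g) f"
  by (simp add: free_gen_def rep_single word_rel_letter letter_rel_def)

lemma rep_star_gen: "rep (free_star (free_gen g)) f = pull ((R g)\<inverse>) f"
  by (simp add: free_gen_def free_star_single rep_single word_rel_star word_rel_letter letter_rel_def)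

lemma pull_word_finsupp: "f \<in> finsupp \<Longrightarrow> pull (word_rel w) f \<in> finsupp"
  by (rule pull_finsupp[OF word_rel_bij])

lemma rep_finsupp: "f \<in> finsupp \<Longrightarrow> rep a f \<in> finsupp"
  unfolding rep_def[abs_def] by (intro finsupp_sum finsupp_scaled pull_word_finsupp)

lemma rep_bounded: "\<exists>K\<ge>0. \<forall>f\<in>finsupp. fnorm (rep a f) \<le> K * fnorm f"
proof (intro exI conjI ballI)
  let ?K = "\<Sum>w\<in>Poly_Mapping.keys a. cmod (Poly_Mapping.lookup a w)"
  show "0 \<le> ?K" by (simp add: sum_nonneg)
  fix f :: "'p \<Rightarrow> complex" assume f: "f \<in> finsupp"
  have "fnorm (rep a f) \<le>
      (\<Sum>w\<in>Poly_Mapping.keys a. fnorm (\<lambda>x. Poly_Mapping.lookup a w * pull (word_rel w) f x))"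
    unfolding rep_def[abs_def] by (intro fnorm_sum finsupp_scaled pull_word_finsupp f)
  also have "\<dots> \<le> (\<Sum>w\<in>Poly_Mapping.keys a. cmod (Poly_Mapping.lookup a w) * fnorm f)"
    by (intro sum_mono)
      (simp add: fnorm_scaled pull_word_finsupp f mult_left_mono fnorm_pull_le[OF word_rel_bij f])
  finally show "fnorm (rep a f) \<le> ?K * fnorm f" by (simp add: sum_distrib_right)
qed

text \<open>Both sides are linear combinations over the words of \<open>a\<close>, so this is the adjointness of a
  partial bijection and its converse.\<close>

lemma rep_adjoint:
  assumes f: "f \<in> finsupp" and g: "g \<in> finsupp"
  shows "finner (rep a f) g = finner f (rep (free_star a) g)"
proof -
  let ?K = "Poly_Mapping.keys a"
  let ?l = "Poly_Mapping.lookup a"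
  have "rep (free_star a) g = rep (\<Sum>w\<in>?K. free_star (Poly_Mapping.single w (?l w))) g"
    by (simp add: free_star_sum[symmetric] free_alg_expand[symmetric])
  also have "\<dots> = (\<lambda>x. \<Sum>w\<in>?K. cnj (?l w) * pull ((word_rel w)\<inverse>) g x)"
    by (simp add: rep_sum free_star_single rep_single word_rel_star)
  finally have star: "rep (free_star a) g = (\<lambda>x. \<Sum>w\<in>?K. cnj (?l w) * pull ((word_rel w)\<inverse>) g x)" .
  have pg: "pull ((word_rel w)\<inverse>) g \<in> finsupp" for w
    by (intro pull_finsupp partial_bijection_converse word_rel_bij g)
  have "finner (rep a f) g = (\<Sum>w\<in>?K. ?l w * finner (pull (word_rel w) f) g)"
    unfolding rep_def[abs_def] by (rule finner_sum) (auto intro: pull_word_finsupp f)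
  also have "\<dots> = (\<Sum>w\<in>?K. cnj (cnj (?l w) * finner (pull ((word_rel w)\<inverse>) g) f))"
    by (simp add: pull_adjoint[OF word_rel_bij f g] finner_commute[OF pg f])
  also have "\<dots> = cnj (finner (rep (free_star a) g) f)"
    unfolding star by (subst finner_sum) (auto intro: pg)
  also have "\<dots> = finner f (rep (free_star a) g)"
    by (rule finner_commute[symmetric]) (intro rep_finsupp f g)+
  finally show ?thesis .
qed

text \<open>The operator norm, as the least bound rather than as a supremum over the unit ball: upper
  estimates then need no normalization.\<close>

definition op_seminorm :: "'g free_alg \<Rightarrow> real" where
  "op_seminorm a = Inf {K. 0 \<le> K \<and> (\<forall>f\<in>finsupp. fnorm (rep a f) \<le> K * fnorm f)}"

lemma op_seminorm_least:
  "\<lbrakk>0 \<le> K; \<And>f. f \<in> finsupp \<Longrightarrow> fnorm (rep a f) \<le> K * fnorm f\<rbrakk> \<Longrightarrow> op_seminorm a \<le> K"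
  unfolding op_seminorm_def by (rule cInf_lower) (auto intro: bdd_belowI[of _ 0])

lemma op_seminorm_nonneg: "0 \<le> op_seminorm a"
  unfolding op_seminorm_def using rep_bounded[of a] by (intro cInf_greatest) auto

lemma op_seminorm_bound:
  assumes f: "f \<in> finsupp"
  shows "fnorm (rep a f) \<le> op_seminorm a * fnorm f"
proof (cases "fnorm f = 0")
  case True
  obtain K where "\<forall>f\<in>finsupp. fnorm (rep a f) \<le> K * fnorm f" using rep_bounded by blast
  with f have "fnorm (rep a f) \<le> K * fnorm f" by blast
  with True show ?thesis by simp
next
  case False
  then have pos: "0 < fnorm f" using fnorm_nonneg[of f] by simp
  have "fnorm (rep a f) / fnorm f \<le> op_seminorm a"
    unfolding op_seminorm_def using rep_bounded[of a] f pos
    by (intro cInf_greatest) (auto simp: divide_le_eq)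
  with pos show ?thesis by (simp add: divide_le_eq)
qed

text \<open>The upper estimate is immediate; applied to \<open>inverse c\<close> it gives the lower one.\<close>

lemma op_seminorm_scale: "op_seminorm (free_scale c a) = cmod c * op_seminorm a"
proof -
  have le: "op_seminorm (free_scale c a) \<le> cmod c * op_seminorm a" for c a
  proof (rule op_seminorm_least)
    fix f :: "'p \<Rightarrow> complex" assume f: "f \<in> finsupp"
    show "fnorm (rep (free_scale c a) f) \<le> cmod c * op_seminorm a * fnorm f"
      using mult_left_mono[OF op_seminorm_bound[OF f, of a], of "cmod c"]
      by (simp add: rep_scale fnorm_scaled rep_finsupp f mult.assoc)
  qed (simp add: op_seminorm_nonneg)
  show ?thesis
  proof (cases "c = 0")
    case True
    then show ?thesis using le[of 0 a] op_seminorm_nonneg[of "free_scale 0 a"] by simp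
  next
    case False
    have "free_scale (inverse c) (free_scale c a) = a"
      using False by (intro poly_mapping_eqI) (simp add: lookup_free_scale)
    then have "op_seminorm a \<le> op_seminorm (free_scale c a) / cmod c"
      using le[of "inverse c" "free_scale c a"] by (simp add: norm_inverse divide_inverse mult.commute)
    then show ?thesis using le[of c a] False by (simp add: field_simps)
  qed
qed

lemma op_seminorm_add: "op_seminorm (a + b) \<le> op_seminorm a + op_seminorm b"
proof (rule op_seminorm_least)
  fix f :: "'p \<Rightarrow> complex" assume f: "f \<in> finsupp"
  have "fnorm (rep (a + b) f) \<le> fnorm (rep a f) + fnorm (rep b f)"
    unfolding rep_add by (intro fnorm_add rep_finsupp f)
  then show "fnorm (rep (a + b) f) \<le> (op_seminorm a + op_seminorm b) * fnorm f"
    using op_seminorm_bound[OF f, of a] op_seminorm_bound[OF f, of b] by (simp add: algebra_simps)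
qed (simp add: op_seminorm_nonneg)

lemma op_seminorm_mult: "op_seminorm (a * b) \<le> op_seminorm a * op_seminorm b"
proof (rule op_seminorm_least)
  fix f :: "'p \<Rightarrow> complex" assume f: "f \<in> finsupp"
  have "fnorm (rep (a * b) f) \<le> op_seminorm a * fnorm (rep b f)"
    unfolding rep_mult by (intro op_seminorm_bound rep_finsupp f)
  also have "\<dots> \<le> op_seminorm a * (op_seminorm b * fnorm f)"
    by (intro mult_left_mono op_seminorm_bound f op_seminorm_nonneg)
  finally show "fnorm (rep (a * b) f) \<le> op_seminorm a * op_seminorm b * fnorm f"
    by (simp add: mult.assoc)
qed (simp add: op_seminorm_nonneg)

text \<open>The half of the C*-identity that needs the inner product:
  \<open>\<parallel>af\<parallel>\<^sup>2 = \<langle>f, a\<^sup>*af\<rangle> \<le> \<parallel>a\<^sup>*a\<parallel> \<parallel>f\<parallel>\<^sup>2\<close>. It implies \<open>\<parallel>a\<parallel> \<le> \<parallel>a\<^sup>*\<parallel>\<close>, hence equality, and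
  then the other half follows from submultiplicativity.\<close>

lemma op_seminorm_star_mult_ge: "(op_seminorm a)\<^sup>2 \<le> op_seminorm (free_star a * a)"
proof -
  have "op_seminorm a \<le> sqrt (op_seminorm (free_star a * a))"
  proof (rule op_seminorm_least)
    fix f :: "'p \<Rightarrow> complex" assume f: "f \<in> finsupp"
    have "of_real ((fnorm (rep a f))\<^sup>2) = finner f (rep (free_star a * a) f)"
      unfolding finner_self[symmetric] rep_mult by (intro rep_adjoint rep_finsupp f)
    then have "(fnorm (rep a f))\<^sup>2 = cmod (finner f (rep (free_star a * a) f))"
      by (metis norm_of_real abs_power2)
    also have "\<dots> \<le> fnorm f * fnorm (rep (free_star a * a) f)"
      by (intro finner_Cauchy_Schwarz rep_finsupp f)
    also have "\<dots> \<le> fnorm f * (op_seminorm (free_star a * a) * fnorm f)"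
      by (intro mult_left_mono op_seminorm_bound f fnorm_nonneg)
    finally have sq: "(fnorm (rep a f))\<^sup>2 \<le> op_seminorm (free_star a * a) * (fnorm f)\<^sup>2"
      by (simp add: power2_eq_square algebra_simps)
    show "fnorm (rep a f) \<le> sqrt (op_seminorm (free_star a * a)) * fnorm f"
      using real_sqrt_le_mono[OF sq] by (simp add: real_sqrt_mult fnorm_nonneg)
  qed (simp add: op_seminorm_nonneg)
  then show ?thesis
    using power_mono[of "op_seminorm a" "sqrt (op_seminorm (free_star a * a))" 2]
    by (simp add: op_seminorm_nonneg)
qed

lemma op_seminorm_le_star: "op_seminorm a \<le> op_seminorm (free_star a)"
proof (cases "op_seminorm a = 0")
  case False
  have "op_seminorm a * op_seminorm a \<le> op_seminorm (free_star a) * op_seminorm a"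
    using op_seminorm_star_mult_ge[of a] op_seminorm_mult[of "free_star a" a]
    by (simp add: power2_eq_square)
  then show ?thesis using False op_seminorm_nonneg[of a] by simp
qed (simp add: op_seminorm_nonneg)

lemma op_seminorm_cstar: "op_seminorm (free_star a * a) = (op_seminorm a)\<^sup>2"
proof (rule antisym)
  have "op_seminorm (free_star a) = op_seminorm a"
    using op_seminorm_le_star[of a] op_seminorm_le_star[of "free_star a"] by (simp add: free_star_star)
  then show "op_seminorm (free_star a * a) \<le> (op_seminorm a)\<^sup>2"
    using op_seminorm_mult[of "free_star a" a] by (simp add: power2_eq_square)
qed (rule op_seminorm_star_mult_ge)

theorem cstar_seminorm_op_seminorm: "cstar_seminorm (free_star_algebra G) free_scale free_star op_seminorm"
  by (simp add: cstar_seminorm_def op_seminorm_nonneg op_seminorm_add op_seminorm_scale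
      op_seminorm_mult op_seminorm_cstar)

lemma op_seminorm_eq_0: "(\<And>f. rep a f = (\<lambda>x. 0)) \<Longrightarrow> op_seminorm a = 0"
  using op_seminorm_least[of 0 a] op_seminorm_nonneg[of a] by (simp add: fnorm_zero)

text \<open>The generator sends the delta function at \<open>y\<close> to a function with value 1 at \<open>x\<close>.\<close>

lemma op_seminorm_gen_nonzero:
  assumes "(x, y) \<in> R g"
  shows "op_seminorm (free_gen g) \<noteq> 0"
proof
  assume "op_seminorm (free_gen g) = 0"
  define f where "f z = (if z = y then 1 else 0 :: complex)" for z
  have f: "f \<in> finsupp" by (simp add: finsupp_def f_def)
  have "fnorm (rep (free_gen g) f) = 0"
    using op_seminorm_bound[OF f, of "free_gen g"] fnorm_nonneg[of "rep (free_gen g) f"]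
      \<open>op_seminorm (free_gen g) = 0\<close> by simp
  then have "pull (R g) f x = 0"
    using fnorm_eq_0[OF rep_finsupp[OF f, of "free_gen g"]] by (simp add: rep_gen)
  moreover have "pull (R g) f x = f y"
    by (rule pull_eq[OF _ assms]) (use bij in \<open>auto simp: partial_bijection_def\<close>)
  ultimately show False by (simp add: f_def)
qed

end


section \<open>Lifting factorizations and the Ore conditions\<close>

locale kumjian_pask = cat_functor E B F
  for E :: "('o1, 'm1) cat" and B :: "('o2, 'm2) cat"
  and F :: "('o1, 'm1, 'o2, 'm2) cat_map" +
  assumes kp: "kumjian_pask_fibration E B F"
begin

lemma factor_exists:
  assumes "\<phi> \<in> Mor E" "\<rho> \<in> Mor B" "\<kappa> \<in> Mor B" "src B \<rho> = rng B \<kappa>" "fmor F \<phi> = \<rho> \<cdot>\<^bsub>B\<^esub> \<kappa>"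
  obtains \<rho>' \<kappa>' where "\<rho>' \<in> Mor E" "\<kappa>' \<in> Mor E" "src E \<rho>' = rng E \<kappa>'" "\<phi> = \<rho>' \<cdot>\<^bsub>E\<^esub> \<kappa>'"
    "fmor F \<rho>' = \<rho>" "fmor F \<kappa>' = \<kappa>" "rng E \<rho>' = rng E \<phi>"
proof -
  have "\<exists>!(\<rho>', \<kappa>'). \<rho>' \<in> Mor E \<and> \<kappa>' \<in> Mor E \<and> src E \<rho>' = rng E \<kappa>' \<and> \<phi> = \<rho>' \<cdot>\<^bsub>E\<^esub> \<kappa>' \<and>
      fmor F \<rho>' = \<rho> \<and> fmor F \<kappa>' = \<kappa>"
    using kp assms unfolding kumjian_pask_fibration_def discrete_conduche_fibration_def by blast
  then obtain \<rho>' \<kappa>' where "\<rho>' \<in> Mor E" "\<kappa>' \<in> Mor E" "src E \<rho>' = rng E \<kappa>'" "\<phi> = \<rho>' \<cdot>\<^bsub>E\<^esub> \<kappa>'"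
    "fmor F \<rho>' = \<rho>" "fmor F \<kappa>' = \<kappa>" by blast
  then show thesis using that dom.rng_comp by metis
qed

lemma factor_unique:
  assumes "\<rho> \<in> Mor E" "\<kappa> \<in> Mor E" "src E \<rho> = rng E \<kappa>"
    and "\<rho>' \<in> Mor E" "\<kappa>' \<in> Mor E" "src E \<rho>' = rng E \<kappa>'"
    and "\<rho> \<cdot>\<^bsub>E\<^esub> \<kappa> = \<rho>' \<cdot>\<^bsub>E\<^esub> \<kappa>'" "fmor F \<rho> = fmor F \<rho>'" "fmor F \<kappa> = fmor F \<kappa>'"
  shows "\<rho> = \<rho>'" "\<kappa> = \<kappa>'"
proof -
  let ?P = "\<lambda>(r, k). r \<in> Mor E \<and> k \<in> Mor E \<and> src E r = rng E k \<and> \<rho> \<cdot>\<^bsub>E\<^esub> \<kappa> = r \<cdot>\<^bsub>E\<^esub> k \<and>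
      fmor F r = fmor F \<rho> \<and> fmor F k = fmor F \<kappa>"
  have "src B (fmor F \<rho>) = rng B (fmor F \<kappa>)" using assms by (simp add: fmor_src fmor_rng)
  then have "\<exists>!rk. ?P rk"
    using kp assms(1-3) dom.comp_closed fmor_closed fmor_comp
    unfolding kumjian_pask_fibration_def discrete_conduche_fibration_def by blast
  moreover have "?P (\<rho>, \<kappa>)" "?P (\<rho>', \<kappa>')" using assms by simp_all
  ultimately have "(\<rho>, \<kappa>) = (\<rho>', \<kappa>')" by blast
  then show "\<rho> = \<rho>'" "\<kappa> = \<kappa>'" by simp_all
qed

text \<open>Discrete Conduche fibrations reflect identities: the two trivial factorizations of \<open>\<alpha>\<close>, with an
  identity on the right and on the left, lie over the same factorization.\<close>

lemma fmor_identD: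
  assumes a: "\<alpha> \<in> Mor E" and i: "fmor F \<alpha> = ident B (fobj F (rng E \<alpha>))"
  shows "\<alpha> = ident E (rng E \<alpha>)"
proof -
  let ?r = "rng E \<alpha>" and ?s = "src E \<alpha>"
  have o: "?r \<in> Obj E" "?s \<in> Obj E" using a dom.rng_closed dom.src_closed by auto
  have "fobj F ?s = fobj F ?r"
    using fmor_src[OF a] i o by (simp add: cod.src_ident fobj_closed)
  then have "fmor F \<alpha> = ident B (fobj F ?s)" using i by simp
  note e = this i
  show ?thesis
    by (rule factor_unique(1)[of \<alpha> "ident E ?s" "ident E ?r" \<alpha>])
      (use a e o in \<open>simp_all add: dom.ident_closed dom.ident_left dom.ident_right dom.rng_ident
        dom.src_ident fmor_ident\<close>)
qed

lemma right_Ore: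
  assumes "m \<in> Mor B" "n \<in> Mor B" "rng B m = rng B n"
  obtains p q where "p \<in> Mor B" "q \<in> Mor B" "src B m = rng B p" "src B n = rng B q"
    "m \<cdot>\<^bsub>B\<^esub> p = n \<cdot>\<^bsub>B\<^esub> q"
proof -
  have "\<exists>p\<in>Mor B. \<exists>q\<in>Mor B. src B m = rng B p \<and> src B n = rng B q \<and> m \<cdot>\<^bsub>B\<^esub> p = n \<cdot>\<^bsub>B\<^esub> q"
    using kp assms unfolding kumjian_pask_fibration_def strongly_right_Ore_def right_Ore_def by blast
  then show thesis using that by blast
qed

lemma strong_Ore:
  assumes "m \<in> Mor B" "n \<in> Mor B" "rng B m = rng B n"
    and "p1 \<in> Mor B" "q1 \<in> Mor B" "src B m = rng B p1" "src B n = rng B q1"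
    and "m \<cdot>\<^bsub>B\<^esub> p1 = n \<cdot>\<^bsub>B\<^esub> q1"
    and "p2 \<in> Mor B" "q2 \<in> Mor B" "src B m = rng B p2" "src B n = rng B q2"
    and "m \<cdot>\<^bsub>B\<^esub> p2 = n \<cdot>\<^bsub>B\<^esub> q2"
  obtains a b where "a \<in> Mor B" "b \<in> Mor B" "src B p1 = rng B a" "src B p2 = rng B b"
    "p1 \<cdot>\<^bsub>B\<^esub> a = p2 \<cdot>\<^bsub>B\<^esub> b" "src B q1 = rng B a" "src B q2 = rng B b" "q1 \<cdot>\<^bsub>B\<^esub> a = q2 \<cdot>\<^bsub>B\<^esub> b"
proof -
  have "\<exists>a\<in>Mor B. \<exists>b\<in>Mor B.
      src B p1 = rng B a \<and> src B p2 = rng B b \<and> p1 \<cdot>\<^bsub>B\<^esub> a = p2 \<cdot>\<^bsub>B\<^esub> b \<and>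
      src B q1 = rng B a \<and> src B q2 = rng B b \<and> q1 \<cdot>\<^bsub>B\<^esub> a = q2 \<cdot>\<^bsub>B\<^esub> b"
    using kp assms unfolding kumjian_pask_fibration_def strongly_right_Ore_def by blast
  then show thesis using that by blast
qed


section \<open>Infinite paths\<close>

text \<open>A functorial section of \<open>\<E>/X \<rightarrow> \<B>/F(X)\<close>, given by its values on objects only: the value on
  a morphism \<open>(b, c)\<close> is \<open>(x b, \<gamma>)\<close> with \<open>\<gamma>\<close> over \<open>c\<close>, and unique factorization determines that \<open>\<gamma>\<close>.
  Extensionality makes a path determined by its values on the morphisms with range \<open>F(X)\<close>.\<close>

definition is_path :: "'o1 \<Rightarrow> ('m2 \<Rightarrow> 'm1) \<Rightarrow> bool" where
  "is_path X x \<longleftrightarrow> x \<in> extensional {b \<in> Mor B. rng B b = fobj F X} \<and>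
    (\<forall>b\<in>Mor B. rng B b = fobj F X \<longrightarrow> x b \<in> fibre E F X b) \<and>
    (\<forall>b\<in>Mor B. \<forall>c\<in>Mor B. rng B b = fobj F X \<and> rng B c = src B b \<longrightarrow>
      (\<exists>\<gamma>\<in>Mor E. rng E \<gamma> = src E (x b) \<and> fmor F \<gamma> = c \<and> x (b \<cdot>\<^bsub>B\<^esub> c) = x b \<cdot>\<^bsub>E\<^esub> \<gamma>))"

lemma pathD:
  assumes "is_path X x" "b \<in> Mor B" "rng B b = fobj F X"
  shows "x b \<in> Mor E" "rng E (x b) = X" "fmor F (x b) = b"
  using assms unfolding is_path_def fibre_def by blast+

lemma path_extend:
  assumes "is_path X x" "b \<in> Mor B" "rng B b = fobj F X" "c \<in> Mor B" "rng B c = src B b"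
  obtains \<gamma> where "\<gamma> \<in> Mor E" "rng E \<gamma> = src E (x b)" "fmor F \<gamma> = c" "x (b \<cdot>\<^bsub>B\<^esub> c) = x b \<cdot>\<^bsub>E\<^esub> \<gamma>"
  using assms unfolding is_path_def by blast

lemma path_eqI:
  assumes "is_path X x" "is_path X y"
    and "\<And>b. \<lbrakk>b \<in> Mor B; rng B b = fobj F X\<rbrakk> \<Longrightarrow> x b = y b"
  shows "x = y"
  by (rule extensionalityI[of _ "{b \<in> Mor B. rng B b = fobj F X}"])
    (use assms in \<open>auto simp: is_path_def\<close>)

lemma path_exists:
  assumes X: "X \<in> Obj E"
  obtains x where "is_path X x"
proof -
  let ?B = "slice B (fobj F X)" and ?E = "slice E X"
  obtain s where s: "cat_functor ?B ?E s"
    and so: "\<And>b. b \<in> Obj ?B \<Longrightarrow> fobj (slice_map F) (fobj s b) = b"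
    and sm: "\<And>m. m \<in> Mor ?B \<Longrightarrow> fmor (slice_map F) (fmor s m) = m"
    using kp X unfolding kumjian_pask_fibration_def locally_split_def by blast
  interpret s: cat_functor ?B ?E s by (rule s)
  define x where "x = restrict (fobj s) {b \<in> Mor B. rng B b = fobj F X}"
  have x: "x b \<in> fibre E F X b" if "b \<in> Mor B" "rng B b = fobj F X" for b
  proof -
    have b: "b \<in> Obj ?B" using that by (simp add: slice_def)
    show ?thesis
      using s.fobj_closed[OF b] so[OF b] that by (simp add: x_def fibre_def slice_map_def slice_def)
  qed
  have ext: "\<exists>\<gamma>\<in>Mor E. rng E \<gamma> = src E (x b) \<and> fmor F \<gamma> = c \<and> x (b \<cdot>\<^bsub>B\<^esub> c) = x b \<cdot>\<^bsub>E\<^esub> \<gamma>"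
    if b: "b \<in> Mor B" "rng B b = fobj F X" and c: "c \<in> Mor B" "rng B c = src B b" for b c
  proof -
    have m: "(b, c) \<in> Mor ?B" using b c by (simp add: slice_def)
    obtain \<alpha> \<gamma> where ag: "fmor s (b, c) = (\<alpha>, \<gamma>)" by fastforce
    have mor: "\<gamma> \<in> Mor E" "rng E \<gamma> = src E \<alpha>"
      using s.fmor_closed[OF m] ag by (simp_all add: slice_def)
    have "\<alpha> = x b" using s.fmor_rng[OF m] ag b by (simp add: slice_def x_def)
    moreover have "x (b \<cdot>\<^bsub>B\<^esub> c) = \<alpha> \<cdot>\<^bsub>E\<^esub> \<gamma>"
      using s.fmor_src[OF m] ag b c by (simp add: slice_def x_def cod.comp_closed cod.rng_comp)
    moreover have "fmor F \<gamma> = c" using sm[OF m] ag by (simp add: slice_map_def)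
    ultimately show ?thesis using mor by blast
  qed
  have "is_path X x"
    unfolding is_path_def using x ext by (auto simp: x_def)
  then show thesis by (rule that)
qed


section \<open>The action of morphisms on paths\<close>

text \<open>The graph of \<open>y \<mapsto> \<alpha>y\<close>, with the image as the first component, so that \<open>pull (act \<alpha>)\<close> sends
  the delta function of \<open>y\<close> to that of \<open>\<alpha>y\<close>. Paths carry their object, so that paths at
  different objects are different points.\<close>

definition act :: "'m1 \<Rightarrow> ('o1 \<times> ('m2 \<Rightarrow> 'm1)) rel" where
  "act \<alpha> = {((X, x), (Y, y)). \<alpha> \<in> Mor E \<and> X = rng E \<alpha> \<and> Y = src E \<alpha> \<and> is_path X x \<and> is_path Y y \<and>
    (\<forall>c\<in>Mor B. rng B c = fobj F Y \<longrightarrow> x (fmor F \<alpha> \<cdot>\<^bsub>B\<^esub> c) = \<alpha> \<cdot>\<^bsub>E\<^esub> y c)}"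

lemma actD:
  assumes "((X, x), (Y, y)) \<in> act \<alpha>"
  shows "\<alpha> \<in> Mor E" "X = rng E \<alpha>" "Y = src E \<alpha>" "is_path X x" "is_path Y y"
    "\<And>c. \<lbrakk>c \<in> Mor B; rng B c = fobj F Y\<rbrakk> \<Longrightarrow> x (fmor F \<alpha> \<cdot>\<^bsub>B\<^esub> c) = \<alpha> \<cdot>\<^bsub>E\<^esub> y c"
  using assms unfolding act_def by auto

lemma actI:
  assumes "\<alpha> \<in> Mor E" "is_path (rng E \<alpha>) x" "is_path (src E \<alpha>) y"
    "\<And>c. \<lbrakk>c \<in> Mor B; rng B c = fobj F (src E \<alpha>)\<rbrakk> \<Longrightarrow> x (fmor F \<alpha> \<cdot>\<^bsub>B\<^esub> c) = \<alpha> \<cdot>\<^bsub>E\<^esub> y c"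
  shows "((rng E \<alpha>, x), (src E \<alpha>, y)) \<in> act \<alpha>"
  using assms unfolding act_def by auto

text \<open>Given \<open>b\<close>, complete it to a square \<open>b p = F(\<alpha>) q\<close>. The value of \<open>\<alpha>y\<close> at this morphism is
  \<open>\<alpha> y(q)\<close>, and \<open>(\<alpha>y)(b)\<close> is its first factor over \<open>b p\<close>, which unique factorization determines.\<close>

lemma act_left_unique:
  assumes 1: "((X, x), (Y, y)) \<in> act \<alpha>" and 2: "((X', x'), (Y, y)) \<in> act \<alpha>"
  shows "X = X' \<and> x = x'"
proof -
  note d = actD[OF 1] and d' = actD[OF 2]
  have XX: "X' = X" using d d' by simp
  have "x b = x' b" if b: "b \<in> Mor B" "rng B b = fobj F X" for b
  proof -
    have Fa: "fmor F \<alpha> \<in> Mor B" "rng B b = rng B (fmor F \<alpha>)" "src B (fmor F \<alpha>) = fobj F Y"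
      using d b by (simp_all add: fmor_closed fmor_rng fmor_src)
    obtain p q where pq: "p \<in> Mor B" "q \<in> Mor B" "src B b = rng B p" "src B (fmor F \<alpha>) = rng B q"
      "b \<cdot>\<^bsub>B\<^esub> p = fmor F \<alpha> \<cdot>\<^bsub>B\<^esub> q" using right_Ore[OF b(1) Fa(1,2)] by blast
    have "rng B q = fobj F Y" using pq Fa by simp
    then have same: "x (b \<cdot>\<^bsub>B\<^esub> p) = x' (b \<cdot>\<^bsub>B\<^esub> p)" using d(6) d'(6) pq by metis
    have px': "is_path X x'" using d'(4) XX by simp
    obtain \<gamma> where g: "\<gamma> \<in> Mor E" "rng E \<gamma> = src E (x b)" "fmor F \<gamma> = p" "x (b \<cdot>\<^bsub>B\<^esub> p) = x b \<cdot>\<^bsub>E\<^esub> \<gamma>"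
      using path_extend[OF d(4) b pq(1) pq(3)[symmetric]] by blast
    obtain \<gamma>' where g': "\<gamma>' \<in> Mor E" "rng E \<gamma>' = src E (x' b)" "fmor F \<gamma>' = p" "x' (b \<cdot>\<^bsub>B\<^esub> p) = x' b \<cdot>\<^bsub>E\<^esub> \<gamma>'"
      using path_extend[OF px' b pq(1) pq(3)[symmetric]] by blast
    show ?thesis
      by (rule factor_unique(1)[of "x b" \<gamma> "x' b" \<gamma>'])
        (use pathD[OF d(4) b] pathD[OF px' b] g g' same in simp_all)
  qed
  then have "x = x'" by (intro path_eqI[of X]) (use d(4) d'(4) XX in auto)
  with XX show ?thesis by simp
qed

text \<open>Here \<open>y(c)\<close> is the second factor of \<open>x(F(\<alpha>)c)\<close> over \<open>F(\<alpha>)c\<close>.\<close>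

lemma act_right_unique:
  assumes 1: "((X, x), (Y, y)) \<in> act \<alpha>" and 2: "((X, x), (Y', y')) \<in> act \<alpha>"
  shows "Y = Y' \<and> y = y'"
proof -
  note d = actD[OF 1] and d' = actD[OF 2]
  have YY: "Y' = Y" using d d' by simp
  have py': "is_path Y y'" using d'(5) YY by simp
  have "y c = y' c" if c: "c \<in> Mor B" "rng B c = fobj F Y" for c
    by (rule factor_unique(2)[of \<alpha> _ \<alpha>])
      (use d(1,3) d(6)[OF c] d'(6) c YY pathD[OF d(5) c] pathD[OF py' c] in simp_all)
  then have "y = y'" by (intro path_eqI[of Y]) (use d(5) py' in auto)
  with YY show ?thesis by simp
qed

lemma act_bij: "partial_bijection (act \<alpha>)"
  unfolding partial_bijection_def single_valued_def
  using act_left_unique act_right_unique by fast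

text \<open>The case where \<open>c\<close> is an identity: its lift \<open>y(c)\<close> is an identity as well.\<close>

lemma act_value:
  assumes "((X, x), (Y, y)) \<in> act \<alpha>"
  shows "x (fmor F \<alpha>) = \<alpha>"
proof -
  note d = actD[OF assms]
  have Y: "Y \<in> Obj E" using d dom.src_closed by simp
  let ?i = "ident B (fobj F Y)"
  have i: "?i \<in> Mor B" "rng B ?i = fobj F Y"
    using Y by (simp_all add: fobj_closed cod.ident_closed cod.rng_ident)
  note yi = pathD[OF d(5) i]
  have "y ?i = ident E Y" using fmor_identD[OF yi(1)] yi by simp
  then have "x (fmor F \<alpha> \<cdot>\<^bsub>B\<^esub> ?i) = \<alpha>" using d(6)[OF i] d(1,3) by (simp add: dom.ident_right)
  moreover have "fmor F \<alpha> \<cdot>\<^bsub>B\<^esub> ?i = fmor F \<alpha>"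
    using cod.ident_right[OF fmor_closed[OF d(1)]] d(1,3) by (simp add: fmor_src)
  ultimately show ?thesis by simp
qed

text \<open>The coherence of \<open>x\<close> yields, for every \<open>c\<close>, a morphism \<open>y(c)\<close> over \<open>c\<close> with
  \<open>x(F(\<alpha>)c) = \<alpha> y(c)\<close>. Coherence of \<open>y\<close> follows by cancelling \<open>\<alpha>\<close>, which unique factorization allows
  between morphisms with the same image under \<open>F\<close>.\<close>

lemma act_shift:
  assumes a: "\<alpha> \<in> Mor E" and x: "is_path (rng E \<alpha>) x" and xa: "x (fmor F \<alpha>) = \<alpha>"
  obtains y where "((rng E \<alpha>, x), (src E \<alpha>, y)) \<in> act \<alpha>"
proof -
  let ?S = "{c \<in> Mor B. rng B c = fobj F (src E \<alpha>)}"
  have Fa: "fmor F \<alpha> \<in> Mor B" "rng B (fmor F \<alpha>) = fobj F (rng E \<alpha>)" "src B (fmor F \<alpha>) = fobj F (src E \<alpha>)"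
    using a by (simp_all add: fmor_closed fmor_rng fmor_src)
  have "\<forall>c\<in>?S. \<exists>\<gamma>. \<gamma> \<in> Mor E \<and> rng E \<gamma> = src E \<alpha> \<and> fmor F \<gamma> = c \<and> x (fmor F \<alpha> \<cdot>\<^bsub>B\<^esub> c) = \<alpha> \<cdot>\<^bsub>E\<^esub> \<gamma>"
    using path_extend[OF x Fa(1,2)] xa Fa(3) by (smt (verit) mem_Collect_eq)
  then obtain y0 where y0: "\<forall>c\<in>?S. y0 c \<in> Mor E \<and> rng E (y0 c) = src E \<alpha> \<and> fmor F (y0 c) = c \<and>
      x (fmor F \<alpha> \<cdot>\<^bsub>B\<^esub> c) = \<alpha> \<cdot>\<^bsub>E\<^esub> y0 c" by (rule bchoice[THEN exE])
  define y where "y = restrict y0 ?S"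
  have y: "y c \<in> Mor E" "rng E (y c) = src E \<alpha>" "fmor F (y c) = c" "x (fmor F \<alpha> \<cdot>\<^bsub>B\<^esub> c) = \<alpha> \<cdot>\<^bsub>E\<^esub> y c"
    if "c \<in> Mor B" "rng B c = fobj F (src E \<alpha>)" for c
    using y0 that by (simp_all add: y_def)
  have "\<exists>\<gamma>\<in>Mor E. rng E \<gamma> = src E (y b) \<and> fmor F \<gamma> = c \<and> y (b \<cdot>\<^bsub>B\<^esub> c) = y b \<cdot>\<^bsub>E\<^esub> \<gamma>"
    if b: "b \<in> Mor B" "rng B b = fobj F (src E \<alpha>)" and c: "c \<in> Mor B" "rng B c = src B b" for b c
  proof -
    have bc: "b \<cdot>\<^bsub>B\<^esub> c \<in> Mor B" "rng B (b \<cdot>\<^bsub>B\<^esub> c) = fobj F (src E \<alpha>)"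
      using b c by (simp_all add: cod.comp_closed cod.rng_comp)
    have ab: "fmor F \<alpha> \<cdot>\<^bsub>B\<^esub> b \<in> Mor B" "rng B (fmor F \<alpha> \<cdot>\<^bsub>B\<^esub> b) = fobj F (rng E \<alpha>)"
      "src B (fmor F \<alpha> \<cdot>\<^bsub>B\<^esub> b) = src B b"
      using b Fa by (simp_all add: cod.comp_closed cod.rng_comp cod.src_comp)
    obtain \<gamma> where g: "\<gamma> \<in> Mor E" "rng E \<gamma> = src E (x (fmor F \<alpha> \<cdot>\<^bsub>B\<^esub> b))" "fmor F \<gamma> = c"
      "x (fmor F \<alpha> \<cdot>\<^bsub>B\<^esub> b \<cdot>\<^bsub>B\<^esub> c) = x (fmor F \<alpha> \<cdot>\<^bsub>B\<^esub> b) \<cdot>\<^bsub>E\<^esub> \<gamma>"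
      using path_extend[OF x ab(1,2) c(1)] c(2) ab(3) by metis
    note yb = y[OF b] and ybc = y[OF bc]
    have s: "rng E \<gamma> = src E (y b)" using g(2) yb a by (simp add: dom.src_comp)
    have "\<alpha> \<cdot>\<^bsub>E\<^esub> y (b \<cdot>\<^bsub>B\<^esub> c) = \<alpha> \<cdot>\<^bsub>E\<^esub> (y b \<cdot>\<^bsub>E\<^esub> \<gamma>)"
      using g(4) ybc(4) yb s a b c Fa by (simp add: cod.comp_assoc dom.comp_assoc g(1))
    then have "y (b \<cdot>\<^bsub>B\<^esub> c) = y b \<cdot>\<^bsub>E\<^esub> \<gamma>"
      by (rule factor_unique(2)[of \<alpha> _ \<alpha>, rotated 6])
        (use a ybc(1-3) yb(1-3) g(1-3) s in \<open>simp_all add: dom.comp_closed dom.rng_comp fmor_comp\<close>)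
    with g s show ?thesis by blast
  qed
  then have "is_path (src E \<alpha>) y"
    unfolding is_path_def fibre_def using y by (auto simp: y_def)
  then show thesis using y(4) by (intro that actI a x)
qed

text \<open>The construction of \<open>\<alpha>y\<close>, the only place where the strong Ore condition enters.\<close>

lemma act_prefix:
  assumes a: "\<alpha> \<in> Mor E" and y: "is_path (src E \<alpha>) y"
  obtains x where "((rng E \<alpha>, x), (src E \<alpha>, y)) \<in> act \<alpha>"
proof -
  let ?a = "fmor F \<alpha>"
  let ?S = "{m \<in> Mor B. rng B m = fobj F (rng E \<alpha>)}"
  have Fa: "?a \<in> Mor B" "rng B ?a = fobj F (rng E \<alpha>)" "src B ?a = fobj F (src E \<alpha>)"
    using a by (simp_all add: fmor_closed fmor_rng fmor_src)
  \<comment> \<open>\<open>fac m p q \<mu>\<close> says that \<open>\<mu>\<close> is the value at \<open>m\<close> dictated by the square \<open>m p = F(\<alpha>) q\<close>.\<close>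
  define sq where "sq m p q \<longleftrightarrow> p \<in> Mor B \<and> q \<in> Mor B \<and> src B m = rng B p \<and> src B ?a = rng B q \<and>
    m \<cdot>\<^bsub>B\<^esub> p = ?a \<cdot>\<^bsub>B\<^esub> q" for m p q
  define fac where "fac m p q \<mu> \<longleftrightarrow> \<mu> \<in> Mor E \<and> rng E \<mu> = rng E \<alpha> \<and> fmor F \<mu> = m \<and>
    (\<exists>\<pi>\<in>Mor E. rng E \<pi> = src E \<mu> \<and> fmor F \<pi> = p \<and> \<alpha> \<cdot>\<^bsub>E\<^esub> y q = \<mu> \<cdot>\<^bsub>E\<^esub> \<pi>)" for m p q \<mu>
  have yq: "y q \<in> Mor E" "rng E (y q) = src E \<alpha>" "fmor F (y q) = q"
    "\<alpha> \<cdot>\<^bsub>E\<^esub> y q \<in> Mor E" "rng E (\<alpha> \<cdot>\<^bsub>E\<^esub> y q) = rng E \<alpha>" "fmor F (\<alpha> \<cdot>\<^bsub>E\<^esub> y q) = ?a \<cdot>\<^bsub>B\<^esub> q"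
    if "q \<in> Mor B" "rng B q = fobj F (src E \<alpha>)" for q
    using pathD[OF y that] a by (simp_all add: dom.comp_closed dom.rng_comp fmor_comp)
  have fac_ex: "\<exists>\<mu>. fac m p q \<mu>" if m: "m \<in> ?S" and s: "sq m p q" for m p q
  proof -
    have q: "q \<in> Mor B" "rng B q = fobj F (src E \<alpha>)" using s Fa by (simp_all add: sq_def)
    obtain \<mu> \<pi> where "\<mu> \<in> Mor E" "\<pi> \<in> Mor E" "src E \<mu> = rng E \<pi>" "\<alpha> \<cdot>\<^bsub>E\<^esub> y q = \<mu> \<cdot>\<^bsub>E\<^esub> \<pi>"
      "fmor F \<mu> = m" "fmor F \<pi> = p" "rng E \<mu> = rng E (\<alpha> \<cdot>\<^bsub>E\<^esub> y q)"
      by (rule factor_exists[of "\<alpha> \<cdot>\<^bsub>E\<^esub> y q" m p]) (use s m yq[OF q] in \<open>auto simp: sq_def\<close>)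
    then show ?thesis using yq[OF q] unfolding fac_def by metis
  qed
  have fac_unique: "\<mu> = \<mu>'"
    if m: "m \<in> ?S" and s: "sq m p q" and s': "sq m p' q'" and f: "fac m p q \<mu>" and f': "fac m p' q' \<mu>'"
    for m p q p' q' \<mu> \<mu>'
  proof -
    have "m \<in> Mor B" "rng B m = rng B ?a" using m Fa by simp_all
    then obtain u v where uv: "u \<in> Mor B" "v \<in> Mor B" "src B p = rng B u" "src B p' = rng B v"
      "p \<cdot>\<^bsub>B\<^esub> u = p' \<cdot>\<^bsub>B\<^esub> v" "src B q = rng B u" "src B q' = rng B v" "q \<cdot>\<^bsub>B\<^esub> u = q' \<cdot>\<^bsub>B\<^esub> v"
      using strong_Ore[of m ?a p q p' q'] Fa(1) s s' unfolding sq_def by blast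
    \<comment> \<open>Enlarging a square by \<open>u\<close> does not change the value it dictates. The strong Ore condition
      provides a common enlargement of the two squares.\<close>
    have ext: "\<exists>\<tau>\<in>Mor E. rng E \<tau> = src E \<mu> \<and> fmor F \<tau> = p \<cdot>\<^bsub>B\<^esub> u \<and> \<alpha> \<cdot>\<^bsub>E\<^esub> y (q \<cdot>\<^bsub>B\<^esub> u) = \<mu> \<cdot>\<^bsub>E\<^esub> \<tau>"
      if s: "sq m p q" and f: "fac m p q \<mu>" and u: "u \<in> Mor B" "src B p = rng B u" "src B q = rng B u"
      for p q \<mu> u
    proof -
      have q: "q \<in> Mor B" "rng B q = fobj F (src E \<alpha>)" using s Fa by (simp_all add: sq_def)
      obtain \<pi> where p: "\<mu> \<in> Mor E" "\<pi> \<in> Mor E" "rng E \<pi> = src E \<mu>" "fmor F \<pi> = p" "\<alpha> \<cdot>\<^bsub>E\<^esub> y q = \<mu> \<cdot>\<^bsub>E\<^esub> \<pi>"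
        using f unfolding fac_def by blast
      obtain \<gamma> where g: "\<gamma> \<in> Mor E" "rng E \<gamma> = src E (y q)" "fmor F \<gamma> = u" "y (q \<cdot>\<^bsub>B\<^esub> u) = y q \<cdot>\<^bsub>E\<^esub> \<gamma>"
        using path_extend[OF y q u(1) u(3)[symmetric]] by blast
      have c: "src E \<pi> = rng E \<gamma>"
        using dom.src_comp[OF p(1,2) p(3)[symmetric]] dom.src_comp[OF a yq(1)[OF q]] yq(2)[OF q] p(5) g(2)
        by simp
      have "\<alpha> \<cdot>\<^bsub>E\<^esub> y (q \<cdot>\<^bsub>B\<^esub> u) = (\<alpha> \<cdot>\<^bsub>E\<^esub> y q) \<cdot>\<^bsub>E\<^esub> \<gamma>"
        unfolding g(4) using yq[OF q] g a by (simp add: dom.comp_assoc)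
      also have "\<dots> = \<mu> \<cdot>\<^bsub>E\<^esub> (\<pi> \<cdot>\<^bsub>E\<^esub> \<gamma>)" unfolding p(5) using p g c by (simp add: dom.comp_assoc)
      finally show ?thesis
        using p g c by (intro bexI[of _ "\<pi> \<cdot>\<^bsub>E\<^esub> \<gamma>"])
          (simp_all add: dom.comp_closed dom.rng_comp fmor_comp)
    qed
    obtain \<tau> where t: "\<tau> \<in> Mor E" "rng E \<tau> = src E \<mu>" "fmor F \<tau> = p \<cdot>\<^bsub>B\<^esub> u"
      "\<alpha> \<cdot>\<^bsub>E\<^esub> y (q \<cdot>\<^bsub>B\<^esub> u) = \<mu> \<cdot>\<^bsub>E\<^esub> \<tau>" using ext[OF s f uv(1,3,6)] by blast
    obtain \<tau>' where t': "\<tau>' \<in> Mor E" "rng E \<tau>' = src E \<mu>'" "fmor F \<tau>' = p' \<cdot>\<^bsub>B\<^esub> v"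
      "\<alpha> \<cdot>\<^bsub>E\<^esub> y (q' \<cdot>\<^bsub>B\<^esub> v) = \<mu>' \<cdot>\<^bsub>E\<^esub> \<tau>'" using ext[OF s' f' uv(2,4,7)] by blast
    show ?thesis
      by (rule factor_unique(1)[of \<mu> \<tau> \<mu>' \<tau>'])
        (use f f' t t' uv in \<open>simp_all add: fac_def\<close>)
  qed
  have sq_ex: "\<exists>p q. sq m p q" if "m \<in> ?S" for m
  proof -
    have "m \<in> Mor B" "rng B m = rng B ?a" using that Fa by simp_all
    from right_Ore[OF this(1) Fa(1) this(2)] show ?thesis unfolding sq_def by metis
  qed
  have "\<forall>m\<in>?S. \<exists>\<mu>. \<forall>p q. sq m p q \<longrightarrow> fac m p q \<mu>"
    using sq_ex fac_ex fac_unique by metis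
  then obtain x0 where x0: "\<forall>m\<in>?S. \<forall>p q. sq m p q \<longrightarrow> fac m p q (x0 m)"
    by (rule bchoice[THEN exE])
  define x where "x = restrict x0 ?S"
  have xfac: "fac m p q (x m)" if "m \<in> ?S" "sq m p q" for m p q
    using x0 that by (simp add: x_def)
  have "\<exists>\<gamma>\<in>Mor E. rng E \<gamma> = src E (x b) \<and> fmor F \<gamma> = c \<and> x (b \<cdot>\<^bsub>B\<^esub> c) = x b \<cdot>\<^bsub>E\<^esub> \<gamma>"
    if b: "b \<in> Mor B" "rng B b = fobj F (rng E \<alpha>)" and c: "c \<in> Mor B" "rng B c = src B b" for b c
  proof -
    have bS: "b \<in> ?S" and bcS: "b \<cdot>\<^bsub>B\<^esub> c \<in> ?S"
      using b c by (simp_all add: cod.comp_closed cod.rng_comp)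
    \<comment> \<open>A square for \<open>b c\<close> is also one for \<open>b\<close>, so one factorization of \<open>\<alpha> y(q)\<close> serves both.\<close>
    obtain p q where s: "sq (b \<cdot>\<^bsub>B\<^esub> c) p q" using sq_ex[OF bcS] by blast
    have s': "sq b (c \<cdot>\<^bsub>B\<^esub> p) q"
    proof -
      have "p \<in> Mor B" "src B c = rng B p" using s b c by (simp_all add: sq_def cod.src_comp)
      then show ?thesis
        using s b c cod.comp_assoc[OF b(1) c(1), of p]
        by (simp add: sq_def cod.comp_closed cod.rng_comp cod.src_comp)
    qed
    obtain \<pi> where p: "x (b \<cdot>\<^bsub>B\<^esub> c) \<in> Mor E" "rng E (x (b \<cdot>\<^bsub>B\<^esub> c)) = rng E \<alpha>" "fmor F (x (b \<cdot>\<^bsub>B\<^esub> c)) = b \<cdot>\<^bsub>B\<^esub> c"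
      "\<pi> \<in> Mor E" "rng E \<pi> = src E (x (b \<cdot>\<^bsub>B\<^esub> c))" "fmor F \<pi> = p" "\<alpha> \<cdot>\<^bsub>E\<^esub> y q = x (b \<cdot>\<^bsub>B\<^esub> c) \<cdot>\<^bsub>E\<^esub> \<pi>"
      using xfac[OF bcS s] unfolding fac_def by blast
    obtain \<mu> \<gamma> where mg: "\<mu> \<in> Mor E" "\<gamma> \<in> Mor E" "src E \<mu> = rng E \<gamma>" "x (b \<cdot>\<^bsub>B\<^esub> c) = \<mu> \<cdot>\<^bsub>E\<^esub> \<gamma>"
      "fmor F \<mu> = b" "fmor F \<gamma> = c" "rng E \<mu> = rng E (x (b \<cdot>\<^bsub>B\<^esub> c))"
      by (rule factor_exists[OF p(1) b(1) c(1) c(2)[symmetric] p(3)])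
    have sg: "src E \<gamma> = rng E \<pi>" using p(5) mg by (simp add: dom.src_comp)
    have "fac b (c \<cdot>\<^bsub>B\<^esub> p) q \<mu>"
      unfolding fac_def using mg p sg
      by (auto intro!: bexI[of _ "\<gamma> \<cdot>\<^bsub>E\<^esub> \<pi>"] simp: dom.comp_closed dom.rng_comp fmor_comp dom.comp_assoc)
    then have "\<mu> = x b" using fac_unique[OF bS s' s' _ xfac[OF bS s']] by blast
    then show ?thesis using mg by auto
  qed
  moreover have "x m \<in> fibre E F (rng E \<alpha>) m" if "m \<in> ?S" for m
    using sq_ex[OF that] xfac[OF that] by (auto simp: fac_def fibre_def)
  ultimately have path: "is_path (rng E \<alpha>) x"
    unfolding is_path_def by (auto simp: x_def)
  have "x (?a \<cdot>\<^bsub>B\<^esub> c) = \<alpha> \<cdot>\<^bsub>E\<^esub> y c" if c: "c \<in> Mor B" "rng B c = fobj F (src E \<alpha>)" for c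
  proof -
    \<comment> \<open>On multiples of \<open>F(\<alpha>)\<close> the trivial square can be used.\<close>
    let ?i = "ident B (src B c)"
    have S: "?a \<cdot>\<^bsub>B\<^esub> c \<in> ?S" using c Fa by (simp add: cod.comp_closed cod.rng_comp)
    have sc: "src B (?a \<cdot>\<^bsub>B\<^esub> c) = src B c" using c Fa by (simp add: cod.src_comp)
    have i: "?i \<in> Mor B" "rng B ?i = src B c"
      using c by (simp_all add: cod.ident_closed cod.rng_ident cod.src_closed)
    have "?a \<cdot>\<^bsub>B\<^esub> c \<cdot>\<^bsub>B\<^esub> ?i = ?a \<cdot>\<^bsub>B\<^esub> c" using cod.ident_right[of "?a \<cdot>\<^bsub>B\<^esub> c"] S sc by simp
    then have s: "sq (?a \<cdot>\<^bsub>B\<^esub> c) ?i c" using c i sc Fa by (simp add: sq_def)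
    let ?j = "ident E (src E (y c))"
    have o: "src E (y c) \<in> Obj E" using yq[OF c] by (simp add: dom.src_closed)
    have sy: "src E (\<alpha> \<cdot>\<^bsub>E\<^esub> y c) = src E (y c)" using yq[OF c] a by (simp add: dom.src_comp)
    have j: "?j \<in> Mor E" "rng E ?j = src E (\<alpha> \<cdot>\<^bsub>E\<^esub> y c)" "fmor F ?j = ?i"
      using o sy yq[OF c] fmor_src[OF yq(1)[OF c]]
      by (simp_all add: dom.ident_closed dom.rng_ident fmor_ident)
    have "\<alpha> \<cdot>\<^bsub>E\<^esub> y c = \<alpha> \<cdot>\<^bsub>E\<^esub> y c \<cdot>\<^bsub>E\<^esub> ?j" using dom.ident_right[OF yq(4)[OF c]] sy by simp
    then have "fac (?a \<cdot>\<^bsub>B\<^esub> c) ?i c (\<alpha> \<cdot>\<^bsub>E\<^esub> y c)"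
      unfolding fac_def using yq[OF c] j by blast
    then show ?thesis using fac_unique[OF S s s xfac[OF S s]] by blast
  qed
  from actI[OF a path y this] show thesis by (rule that)
qed

text \<open>The images of the morphisms over a fixed \<open>b\<close> with range \<open>X\<close> therefore partition the paths at
  \<open>X\<close> according to the value \<open>x(b)\<close>. This is behind both the orthogonality relation and the
  summation relation.\<close>

lemma Domain_act:
  "\<alpha> \<in> Mor E \<Longrightarrow> (X, x) \<in> Domain (act \<alpha>) \<longleftrightarrow> X = rng E \<alpha> \<and> is_path X x \<and> x (fmor F \<alpha>) = \<alpha>"
  using act_value actD(2,4) by (auto elim!: DomainE act_shift[of \<alpha> x] intro: DomainI)

lemma Range_act:
  assumes "\<alpha> \<in> Mor E"
  shows "Range (act \<alpha>) = {src E \<alpha>} \<times> Collect (is_path (src E \<alpha>))"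
proof (rule equalityI; rule subsetI)
  fix p assume "p \<in> {src E \<alpha>} \<times> Collect (is_path (src E \<alpha>))"
  then obtain y where "p = (src E \<alpha>, y)" "is_path (src E \<alpha>) y" by blast
  then show "p \<in> Range (act \<alpha>)" using act_prefix[OF assms] by (metis RangeI)
qed (use actD(3,5) in \<open>auto elim!: RangeE\<close>)

lemma act_ident:
  assumes X: "X \<in> Obj E"
  shows "act (ident E X) = Id_on ({X} \<times> Collect (is_path X))"
proof -
  let ?i = "ident E X"
  have i: "?i \<in> Mor E" "rng E ?i = X" "src E ?i = X" "fmor F ?i = ident B (fobj F X)"
    using X by (simp_all add: dom.ident_closed dom.rng_ident dom.src_ident fmor_ident)
  have refl: "((X, x), (X, x)) \<in> act ?i" if x: "is_path X x" for x
  proof -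
    have "x (fmor F ?i \<cdot>\<^bsub>B\<^esub> c) = ?i \<cdot>\<^bsub>E\<^esub> x c" if c: "c \<in> Mor B" "rng B c = fobj F X" for c
      using cod.ident_left[OF c(1)] dom.ident_left[OF pathD(1)[OF x c]] pathD(2)[OF x c] c i by simp
    then show ?thesis using actI[OF i(1), of x x] x i by simp
  qed
  \<comment> \<open>Every path is its own image, and images are unique.\<close>
  show ?thesis
  proof (rule equalityI; rule subrelI)
    fix p q assume pq: "(p, q) \<in> act ?i"
    obtain Y y Z z where e: "p = (Y, y)" "q = (Z, z)" by fastforce
    note d = actD[OF pq[unfolded e]]
    have "Y = X" "Z = X" using d i by simp_all
    with act_left_unique[OF pq[unfolded e]] refl[of z] d e show "(p, q) \<in> Id_on ({X} \<times> Collect (is_path X))"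
      by auto
  qed (auto intro: refl)
qed

text \<open>One inclusion is a computation. For the other, \<open>\<alpha>(\<beta>z)\<close> exists whenever \<open>z\<close> is a path at the
  source of \<open>\<beta>\<close>, and it must be \<open>(\<alpha>\<beta>)z\<close> because the latter is unique.\<close>

lemma act_comp:
  assumes a: "\<alpha> \<in> Mor E" and b: "\<beta> \<in> Mor E" and ab: "src E \<alpha> = rng E \<beta>"
  shows "act (\<alpha> \<cdot>\<^bsub>E\<^esub> \<beta>) = act \<alpha> O act \<beta>"
proof -
  have m: "\<alpha> \<cdot>\<^bsub>E\<^esub> \<beta> \<in> Mor E" "rng E (\<alpha> \<cdot>\<^bsub>E\<^esub> \<beta>) = rng E \<alpha>" "src E (\<alpha> \<cdot>\<^bsub>E\<^esub> \<beta>) = src E \<beta>"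
    "fmor F (\<alpha> \<cdot>\<^bsub>E\<^esub> \<beta>) = fmor F \<alpha> \<cdot>\<^bsub>B\<^esub> fmor F \<beta>"
    using assms by (simp_all add: dom.comp_closed dom.rng_comp dom.src_comp fmor_comp)
  have comp: "((X, x), (Z, z)) \<in> act (\<alpha> \<cdot>\<^bsub>E\<^esub> \<beta>)"
    if 1: "((X, x), (Y, y)) \<in> act \<alpha>" and 2: "((Y, y), (Z, z)) \<in> act \<beta>" for X x Y y Z z
  proof -
    note d = actD[OF 1] and d' = actD[OF 2]
    have "x (fmor F (\<alpha> \<cdot>\<^bsub>E\<^esub> \<beta>) \<cdot>\<^bsub>B\<^esub> c) = \<alpha> \<cdot>\<^bsub>E\<^esub> \<beta> \<cdot>\<^bsub>E\<^esub> z c" if c: "c \<in> Mor B" "rng B c = fobj F (src E \<beta>)" for c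
    proof -
      let ?b = "fmor F \<beta>"
      have bc: "?b \<cdot>\<^bsub>B\<^esub> c \<in> Mor B" "rng B (?b \<cdot>\<^bsub>B\<^esub> c) = fobj F Y"
        using c b d'(2) by (simp_all add: cod.comp_closed cod.rng_comp fmor_closed fmor_src fmor_rng)
      have "fmor F (\<alpha> \<cdot>\<^bsub>E\<^esub> \<beta>) \<cdot>\<^bsub>B\<^esub> c = fmor F \<alpha> \<cdot>\<^bsub>B\<^esub> (?b \<cdot>\<^bsub>B\<^esub> c)"
        unfolding m(4) by (rule cod.comp_assoc) (use a b c ab in \<open>simp_all add: fmor_closed fmor_src fmor_rng\<close>)
      then have "x (fmor F (\<alpha> \<cdot>\<^bsub>E\<^esub> \<beta>) \<cdot>\<^bsub>B\<^esub> c) = \<alpha> \<cdot>\<^bsub>E\<^esub> (\<beta> \<cdot>\<^bsub>E\<^esub> z c)"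
        using d(6)[OF bc] d'(6) d'(3) c by simp
      also have "\<dots> = \<alpha> \<cdot>\<^bsub>E\<^esub> \<beta> \<cdot>\<^bsub>E\<^esub> z c"
        by (rule dom.comp_assoc[symmetric]) (use a b ab pathD[OF d'(5)] d'(3) c in simp_all)
      finally show ?thesis .
    qed
    then show ?thesis using actI[OF m(1), of x z] m d d' by simp
  qed
  show ?thesis
  proof (rule equalityI; rule subrelI)
    fix p q assume pq: "(p, q) \<in> act (\<alpha> \<cdot>\<^bsub>E\<^esub> \<beta>)"
    obtain X x Z z where e: "p = (X, x)" "q = (Z, z)" by fastforce
    note d = actD[OF pq[unfolded e]]
    have z: "is_path (src E \<beta>) z" "Z = src E \<beta>" using d m by simp_all
    obtain y where y: "((rng E \<beta>, y), (src E \<beta>, z)) \<in> act \<beta>" using act_prefix[OF b z(1)] by blast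
    then have "is_path (src E \<alpha>) y" using actD(4) ab by simp
    then obtain x' where x': "((rng E \<alpha>, x'), (src E \<alpha>, y)) \<in> act \<alpha>" using act_prefix[OF a] by blast
    have "((rng E \<alpha>, x'), (Z, z)) \<in> act (\<alpha> \<cdot>\<^bsub>E\<^esub> \<beta>)" using comp x' y ab z by simp
    then have "(rng E \<alpha>, x') = p" using act_left_unique pq e by blast
    then show "(p, q) \<in> act \<alpha> O act \<beta>" using x' y ab z e by auto
  qed (use comp in auto)
qed


section \<open>The path representation\<close>

sublocale paths: partial_bijections act
  by unfold_locales (rule act_bij)

lemma act_single_valued: "single_valued (act \<alpha>)" "single_valued ((act \<alpha>)\<inverse>)"
  using act_bij by (simp_all add: partial_bijection_def)

text \<open>Oriented so that a product of operators becomes the operator of one composed relation.\<close>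

lemmas rep_simps = paths.rep_minus paths.rep_mult paths.rep_gen paths.rep_star_gen
  pull_relcomp[OF act_single_valued(1) act_single_valued(1), symmetric]
  pull_relcomp[OF act_single_valued(1) act_single_valued(2), symmetric]
  pull_relcomp[OF act_single_valued(2) act_single_valued(1), symmetric]

text \<open>Composing a partial bijection with its converse gives a partial identity on its range or its
  domain, so every relation reduces to a statement about the domains and ranges of \<open>act\<close>. In the
  last one, the summands over \<open>\<alpha>\<close> in the fibre of \<open>b\<close> all vanish at a path \<open>x\<close> except for
  \<open>\<alpha> = x(b)\<close>; row-finiteness makes the sum a genuine finite one.\<close>

lemma rep_relator:
  assumes fin: "row_finite E B F" and "r \<in> ck_relators E B F"
  shows "paths.rep r f = (\<lambda>p. 0)"
  using assms(2) unfolding ck_relators_def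
proof (elim UnE CollectE exE conjE)
  fix X Y assume "X \<in> Obj E" "Y \<in> Obj E" "X \<noteq> Y" "r = free_gen (ident E X) * free_gen (ident E Y)"
  then show ?thesis by (auto simp: rep_simps act_ident pull_Id_on fun_eq_iff)
next
  fix \<alpha> \<beta> assume "\<alpha> \<in> Mor E" "\<beta> \<in> Mor E" "src E \<alpha> = rng E \<beta>"
    "r = free_gen (\<alpha> \<cdot>\<^bsub>E\<^esub> \<beta>) - free_gen \<alpha> * free_gen \<beta>"
  then show ?thesis by (simp add: rep_simps act_comp)
next
  fix X assume "X \<in> Obj E" "r = free_star (free_gen (ident E X)) - free_gen (ident E X)"
  then show ?thesis by (simp add: rep_simps act_ident)
next
  fix \<alpha> assume "\<alpha> \<in> Mor E" "r = free_star (free_gen \<alpha>) * free_gen \<alpha> - free_gen (ident E (src E \<alpha>))"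
  then show ?thesis
    by (simp add: rep_simps converse_relcomp_self[OF act_single_valued(1)] Range_act act_ident
        dom.src_closed)
next
  fix \<alpha> \<beta> assume ab: "\<alpha> \<in> Mor E" "\<beta> \<in> Mor E" "fmor F \<alpha> = fmor F \<beta>" "\<alpha> \<noteq> \<beta>"
    and r: "r = free_star (free_gen \<beta>) * free_gen \<alpha>"
  have "(act \<beta>)\<inverse> O act \<alpha> = {}" 
  proof (rule equals0I)
    fix pq assume "pq \<in> (act \<beta>)\<inverse> O act \<alpha>"
    then obtain Z z Y y Y' y' where "((Z, z), (Y, y)) \<in> act \<beta>" "((Z, z), (Y', y')) \<in> act \<alpha>" by force
    from this[THEN act_value] show False using ab by simp
  qed
  then show ?thesis unfolding r by (simp add: rep_simps fun_eq_iff pull_outside)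
next
  fix X b assume X: "X \<in> Obj E" and b: "b \<in> Mor B" "rng B b = fobj F X"
    and r: "r = (\<Sum>\<alpha>\<in>fibre E F X b. free_gen \<alpha> * free_star (free_gen \<alpha>)) - free_gen (ident E X)"
  have finite: "finite (fibre E F X b)" using fin X b by (simp add: row_finite_def)
  have "(\<Sum>\<alpha>\<in>fibre E F X b. pull (act \<alpha> O (act \<alpha>)\<inverse>) f p) = pull (act (ident E X)) f p" for p
  proof -
    obtain Y x where p: "p = (Y, x)" by fastforce
    have dom: "p \<in> Domain (act \<alpha>) \<longleftrightarrow> Y = X \<and> is_path X x \<and> x b = \<alpha>" if "\<alpha> \<in> fibre E F X b" for \<alpha>
      using that p Domain_act[of \<alpha> Y x] by (auto simp: fibre_def)
    have "(\<Sum>\<alpha>\<in>fibre E F X b. pull (act \<alpha> O (act \<alpha>)\<inverse>) f p) =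
        (\<Sum>\<alpha>\<in>fibre E F X b. if p \<in> Domain (act \<alpha>) then f p else 0)"
      using converse_relcomp_self[OF act_single_valued(2)] by (simp add: pull_Id_on)
    also have "\<dots> = (\<Sum>\<alpha>\<in>fibre E F X b. if x b = \<alpha> then (if Y = X \<and> is_path X x then f p else 0) else 0)"
      by (intro sum.cong refl) (auto simp: dom)
    also have "\<dots> = (if Y = X \<and> is_path X x then f p else 0)"
      using finite b by (auto simp: sum.delta' fibre_def pathD)
    also have "\<dots> = pull (act (ident E X)) f p"
      by (auto simp: act_ident[OF X] pull_Id_on p)
    finally show ?thesis .
  qed
  then show ?thesis unfolding r by (simp add: rep_simps paths.rep_sum)
qed

end


section \<open>Nonvanishing of the universal C*-algebra\<close>

theorem proposition3p19:
  fixes E :: "('o1, 'm1) cat" and B :: "('o2, 'm2) cat"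
    and F :: "('o1, 'm1, 'o2, 'm2) cat_map"
  assumes "kumjian_pask_fibration E B F"
    and "row_finite E B F"
    and "Obj E \<noteq> {}"
  shows "carrier (cstar_of E B F) \<noteq> {\<zero>\<^bsub>cstar_of E B F\<^esub>}"
proof -
  interpret kumjian_pask E B F
    using assms(1)
    by (simp add: kumjian_pask_def kumjian_pask_axioms_def kumjian_pask_fibration_def
        discrete_conduche_fibration_def)
  obtain X where X: "X \<in> Obj E" using assms(3) by blast
  let ?g = "free_gen (ident E X)"
  have g: "?g \<in> A" using X by (intro free_gen_closed dom.ident_closed)
  obtain x where "is_path X x" using path_exists[OF X] by blast
  then have "((X, x), (X, x)) \<in> act (ident E X)" by (auto simp: act_ident[OF X])
  then have "paths.op_seminorm ?g \<noteq> 0" by (rule paths.op_seminorm_gen_nonzero)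
  then have "0 < paths.op_seminorm ?g" using paths.op_seminorm_nonneg[of ?g] by simp
  also have "paths.op_seminorm \<in> ck_seminorms E B F"
    using paths.cstar_seminorm_op_seminorm paths.op_seminorm_eq_0 rep_relator[OF assms(2)]
    by (auto simp: ck_seminorms_def)
  then have "paths.op_seminorm ?g \<le> ck_norm E B F ?g" by (rule ck_norm_upper[OF g])
  finally have "ck_norm E B F (?g - 0) \<noteq> 0" by simp
  then have "univ.emb ?g \<noteq> univ.emb 0"
    by (simp only: univ.emb_eq_iff[OF g univ.A_zero] not_False_eq_True)
  then show ?thesis
    using univ.emb_closed[OF g] by (auto simp: cstar_of_eq univ.emb_zero)
qed

end
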